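(* Fix integers $k\leq n$. An acyclic NFA $M$ of size $O^*(4^k\cdot k^{O(\log^2 k)})$ with $L(M)=L_k(n)$ can be constructed (deterministically) in time $O^*(4^k\cdot k^{O(\log^2 k)})$.
   Context: For integers $k\leq n$, $L_k(n)\subseteq [n]^k$ is the set of words $w_1\cdots w_k\in[n]^k$ such that $w_1,\ldots,w_k$ are all distinct. An NFA over alphabet $[n]$ is a directed graph of states with transitions labeled by elements of $[n]$ (here $\epsilon$-transitions are also allowed), a start state and a set of accepting states; $L(M)$ is the set of words labeling a path from the start state to an accepting state. The size of an NFA is the number of its states plus the number of its transitions; it is acyclic if it is acyclic as a directed graph. The notation $O^*(\cdot)$ suppresses factors polynomial in $n$. *)

theory Defs
  imports Complex_Main "HOL-Library.Landau_Symbols" "HOL-Library.Log_Nat"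
begin

section \<open>Nondeterministic finite automata with epsilon-transitions\<close>

text \<open>A label \<open>None\<close> stands for an epsilon-transition.\<close>

record ('q, 'a) nfa =
  states :: "'q set"
  start_state :: 'q
  accepting :: "'q set"
  transitions :: "('q \<times> 'a option \<times> 'q) set"

definition nfa_over :: "'a set \<Rightarrow> ('q, 'a) nfa \<Rightarrow> bool" where
  "nfa_over \<Sigma> M \<longleftrightarrow>
     finite (states M) \<and> start_state M \<in> states M \<and> accepting M \<subseteq> states M \<and>
     transitions M \<subseteq> states M \<times> insert None (Some ` \<Sigma>) \<times> states M \<and>
     finite (transitions M)"

inductive nfa_path :: "('q, 'a) nfa \<Rightarrow> 'q \<Rightarrow> 'a list \<Rightarrow> 'q \<Rightarrow> bool" for M where
  empty: "nfa_path M p [] p"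
| epsilon: "(p, None, q) \<in> transitions M \<Longrightarrow> nfa_path M q w r \<Longrightarrow> nfa_path M p w r"
| letter: "(p, Some a, q) \<in> transitions M \<Longrightarrow> nfa_path M q w r \<Longrightarrow> nfa_path M p (a # w) r"

definition nfa_lang :: "('q, 'a) nfa \<Rightarrow> 'a list set" where
  "nfa_lang M = {w. \<exists>f \<in> accepting M. nfa_path M (start_state M) w f}"

definition nfa_size :: "('q, 'a) nfa \<Rightarrow> nat" where
  "nfa_size M = card (states M) + card (transitions M)"

definition nfa_acyclic :: "('q, 'a) nfa \<Rightarrow> bool" where
  "nfa_acyclic M \<longleftrightarrow> acyclic {(p, q). \<exists>l. (p, l, q) \<in> transitions M}"

definition distinct_words :: "nat \<Rightarrow> nat \<Rightarrow> nat list set" where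
  "distinct_words k n = {w. length w = k \<and> set w \<subseteq> {1..n} \<and> distinct w}"

section \<open>Deterministic computation with logarithmic cost\<close>

text \<open>
  The model is a deterministic random access machine with the logarithmic cost criterion,
  programmed in a structured language. The memory consists of scalar variables and arrays over the
  natural numbers, all named by constants of the program; a program mentions only finitely many
  of them. Evaluating an expression costs, for each of its nodes, one plus the bit length of the
  value of that node, so that operands, results and array addresses are all paid for by
  their length.
\<close>

datatype binop = Plus | Monus | Times | Div | Mod | Less | Eq

datatype aexp =
    Const nat
  | Var nat
  | Read nat aexp \<comment> \<open>\<open>Read a e\<close>: the cell of array \<open>a\<close> at index \<open>e\<close>\<close>
  | Bin binop aexp aexp

datatype com =
    Skip
  | Assign nat aexp
  | Write nat aexp aexp \<comment> \<open>\<open>Write a i e\<close>: store \<open>e\<close> in array \<open>a\<close> at index \<open>i\<close>\<close>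
  | Seq com com
  | Cond aexp com com
  | While aexp com

record store =
  var :: "nat \<Rightarrow> nat"
  arr :: "nat \<Rightarrow> nat \<Rightarrow> nat"

fun binop_val :: "binop \<Rightarrow> nat \<Rightarrow> nat \<Rightarrow> nat" where
  "binop_val Plus x y = x + y"
| "binop_val Monus x y = x - y"
| "binop_val Times x y = x * y"
| "binop_val Div x y = x div y"
| "binop_val Mod x y = x mod y"
| "binop_val Less x y = of_bool (x < y)"
| "binop_val Eq x y = of_bool (x = y)"

fun aval :: "aexp \<Rightarrow> store \<Rightarrow> nat" where
  "aval (Const c) s = c"
| "aval (Var x) s = var s x"
| "aval (Read a e) s = arr s a (aval e s)"
| "aval (Bin f e1 e2) s = binop_val f (aval e1 s) (aval e2 s)"

text \<open>\<open>floorlog 2 v\<close> is the number of binary digits of \<open>v\<close> (zero if \<open>v = 0\<close>).\<close>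

definition len_cost :: "nat \<Rightarrow> nat" where
  "len_cost v = 1 + floorlog 2 v"

fun acost :: "aexp \<Rightarrow> store \<Rightarrow> nat" where
  "acost (Const c) s = len_cost c"
| "acost (Var x) s = len_cost (var s x)"
| "acost (Read a e) s = acost e s + len_cost (arr s a (aval e s))"
| "acost (Bin f e1 e2) s =
     acost e1 s + acost e2 s + len_cost (binop_val f (aval e1 s) (aval e2 s))"

text \<open>
  \<open>exec c s t s'\<close>: started in store \<open>s\<close>, the program \<open>c\<close> halts in store \<open>s'\<close> after time
  exactly \<open>t\<close>. A test succeeds if its value is nonzero.
\<close>

inductive exec :: "com \<Rightarrow> store \<Rightarrow> nat \<Rightarrow> store \<Rightarrow> bool" where
  Skip: "exec Skip s 1 s"
| Assign: "exec (Assign x e) s (1 + acost e s) (s\<lparr>var := (var s)(x := aval e s)\<rparr>)"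
| Write: "exec (Write a i e) s (1 + acost i s + acost e s)
            (s\<lparr>arr := (arr s)(a := (arr s a)(aval i s := aval e s))\<rparr>)"
| Seq: "exec c1 s t1 s1 \<Longrightarrow> exec c2 s1 t2 s2 \<Longrightarrow> exec (Seq c1 c2) s (t1 + t2) s2"
| CondTrue: "aval b s \<noteq> 0 \<Longrightarrow> exec c1 s t s' \<Longrightarrow> exec (Cond b c1 c2) s (1 + acost b s + t) s'"
| CondFalse: "aval b s = 0 \<Longrightarrow> exec c2 s t s' \<Longrightarrow> exec (Cond b c1 c2) s (1 + acost b s + t) s'"
| WhileFalse: "aval b s = 0 \<Longrightarrow> exec (While b c) s (1 + acost b s) s"
| WhileTrue: "aval b s \<noteq> 0 \<Longrightarrow> exec c s t1 s1 \<Longrightarrow> exec (While b c) s1 t2 s2 \<Longrightarrow>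
              exec (While b c) s (1 + acost b s + t1 + t2) s2"

inductive_cases exec_SkipE: "exec Skip s t s'"
inductive_cases exec_AssignE: "exec (Assign x e) s t s'"
inductive_cases exec_WriteE: "exec (Write a i e) s t s'"
inductive_cases exec_SeqE: "exec (Seq c1 c2) s t s'"
inductive_cases exec_CondE: "exec (Cond b c1 c2) s t s'"
inductive_cases exec_WhileE: "exec (While b c) s t s'"

theorem exec_deterministic:
  "exec c s t s' \<Longrightarrow> exec c s u s'' \<Longrightarrow> u = t \<and> s'' = s'"
proof (induction arbitrary: u s'' rule: exec.induct)
  case (Skip s)
  then show ?case by (auto elim: exec_SkipE)
next
  case (Assign x e s)
  then show ?case by (auto elim: exec_AssignE)
next
  case (Write a i e s)
  then show ?case by (auto elim: exec_WriteE)
next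
  case (Seq c1 s t1 s1 c2 t2 s2)
  from Seq.prems obtain u1 u2 r where u: "u = u1 + u2" "exec c1 s u1 r" "exec c2 r u2 s''"
    by (rule exec_SeqE)
  with Seq.IH(1)[OF u(2)] Seq.IH(2)[of u2 s''] show ?case by simp
next
  case (CondTrue b s c1 t s' c2)
  from CondTrue.prems obtain r where "u = 1 + acost b s + r" "exec c1 s r s''"
    by (rule exec_CondE) (use CondTrue.hyps in simp_all)
  with CondTrue.IH[of r s''] show ?case by simp
next
  case (CondFalse b s c2 t s' c1)
  from CondFalse.prems obtain r where "u = 1 + acost b s + r" "exec c2 s r s''"
    by (rule exec_CondE) (use CondFalse.hyps in simp_all)
  with CondFalse.IH[of r s''] show ?case by simp
next
  case (WhileFalse b s c)
  from WhileFalse.prems show ?case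
    by (rule exec_WhileE) (use WhileFalse.hyps in simp_all)
next
  case (WhileTrue b s c t1 s1 t2 s2)
  from WhileTrue.prems obtain u1 u2 r where u: "u = 1 + acost b s + u1 + u2"
    "exec c s u1 r" "exec (While b c) r u2 s''"
    by (rule exec_WhileE) (use WhileTrue.hyps in simp_all)
  with WhileTrue.IH(1)[OF u(2)] WhileTrue.IH(2)[of u2 s''] show ?case by simp
qed

text \<open>
  Input: \<open>n\<close> and \<open>k\<close> in variables 0 and 1, everything else zero.
  Output: the states are \<open>0, \<dots>, var s 0 - 1\<close>, the start state is \<open>var s 1\<close>, array 3 marks the
  accepting states, and there are \<open>var s 2\<close> transitions, the \<open>j\<close>-th of which leads from
  \<open>arr s 0 j\<close> to \<open>arr s 2 j\<close> with label \<open>arr s 1 j\<close>, where 0 encodes epsilon.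
\<close>

definition input_store :: "nat \<Rightarrow> nat \<Rightarrow> store" where
  "input_store n k = \<lparr>var = (\<lambda>_. 0)(0 := n, 1 := k), arr = (\<lambda>_ _. 0)\<rparr>"

definition output_nfa :: "store \<Rightarrow> (nat, nat) nfa" where
  "output_nfa s =
     \<lparr>states = {..<var s 0},
      start_state = var s 1,
      accepting = {q. q < var s 0 \<and> arr s 3 q \<noteq> 0},
      transitions =
        {(arr s 0 j, if arr s 1 j = 0 then None else Some (arr s 1 j), arr s 2 j) | j. j < var s 2}\<rparr>"

definition constructs_in_time :: "com \<Rightarrow> nat \<Rightarrow> nat \<Rightarrow> (nat, nat) nfa \<Rightarrow> nat \<Rightarrow> bool" where
  "constructs_in_time P n k M t \<longleftrightarrow> (\<exists>s. exec P (input_store n k) t s \<and> output_nfa s = M)"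

section \<open>Asymptotic bounds\<close>

text \<open>
  Functions of the two parameters \<open>1 \<le> k \<le> n\<close> bounded by \<open>g\<close> up to a factor polynomial in \<open>n\<close>,
  uniformly in both parameters.
\<close>

definition O_star :: "(nat \<Rightarrow> nat \<Rightarrow> real) \<Rightarrow> (nat \<Rightarrow> nat \<Rightarrow> nat) set" where
  "O_star g = {f. \<exists>(C::real) (d::nat). \<forall>n k. 1 \<le> k \<and> k \<le> n \<longrightarrow>
                    real (f n k) \<le> C * real n ^ d * g n k}"

text \<open>The class O*(4^k * k^(O(log^2 k))); the exponent \<open>e\<close> depends on \<open>k\<close> only.\<close>

definition target_bound :: "(nat \<Rightarrow> nat \<Rightarrow> nat) set" where
  "target_bound =
     (\<Union>e \<in> O(\<lambda>k::nat. (log 2 (real k))\<^sup>2). O_star (\<lambda>n k. 4 ^ k * real k powr e k))"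

end

theory Submission
  imports Defs
begin

text \<open>
  Divide and colour. Reduction modulo a suitable \<open>\<mu> \<le> m = O(k\<^sup>2 log n)\<close> keeps the letters of a given
  word distinct, since otherwise all of \<open>1, \<dots>, m\<close> would divide the product of their differences,
  whereas the least common multiple of these numbers is at least \<open>2\<^bsup>m div 2\<^esup>\<close>. So the letters may be
  replaced by \<open>m\<close> colours. The positions \<open>0, \<dots>, k - 1\<close> are halved recursively, and for each
  node of the recursion the automaton guesses a set of colours that contains none of the letters in
  the left half of the node and all of those in the right half. A word with a repeated letter fails
  at the node that separates the two occurrences. For a node of \<open>K\<close> positions the set is chosen from
  a family of size \<open>2\<^bsup>K\<^esup> m\<^bsup>O(log m)\<^esup>\<close>: the colours are cut into \<open>l = O(log m)\<close> intervals containing at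
  most about \<open>K / l\<close> of the relevant colours each, and within every interval one uses a universal
  family for so few elements, which is small enough to be found greedily. At any time only the
  guesses for the current nodes of the \<open>O(log k)\<close> levels have to be remembered, which makes
  \<open>2\<^bsup>k + k/2 + k/4 + \<dots>\<^esup> \<le> 4\<^sup>k\<close> combinations up to a factor \<open>m\<^bsup>O(log m log k)\<^esup>\<close>.
\<close>

section \<open>Time-bounded execution\<close>

text \<open>The interval cut serves the construction time. A greedy search lists all demands on t
  positions, (2m)^t codes, for each of about 2^t functions; with t = K this would be of order m^K.
  With m = 2^L and t about K / l for l = L + 2, the product (2m)^t 2^t = 2^(l t) is only about 2^K
  m^2, while gluing l functions costs O(L) further bits for each of them. The second obstacle is
  that m depends on n, so the overhead 2^O(log^2 m log k) is not yet of the required form. As log m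
  = O(log k + log log n), it is bounded by splitting a cube: (log k)^3 yields k^O(log^2 k), and (log
  log n)^3 = O(log n) yields a factor polynomial in n. Finally, the logarithmic cost criterion
  demands a bound on the length of every stored value. All correctness statements therefore carry a
  length \<beta>, which is fixed only after all numbers that occur have been bounded; it is
  polynomial in n up to the same overhead, and so is the price of a step.\<close>

definition bdd :: "nat \<Rightarrow> store \<Rightarrow> bool" where
  "bdd \<beta> s \<longleftrightarrow> 2 \<le> \<beta> \<and> (\<forall>x. var s x < 2 ^ \<beta>) \<and> (\<forall>a i. arr s a i < 2 ^ \<beta>)"

fun esize :: "aexp \<Rightarrow> nat" where
  "esize (Const c) = 1"
| "esize (Var x) = 1"
| "esize (Read a e) = esize e + 1"
| "esize (Bin f e1 e2) = esize e1 + esize e2 + 1"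

text \<open>Constants below 4 have at most two bits, and \<open>bdd\<close> provides
  \<open>2 \<le> \<beta>\<close>.\<close>

fun small_consts :: "aexp \<Rightarrow> bool" where
  "small_consts (Const c) \<longleftrightarrow> c < 4"
| "small_consts (Var x) \<longleftrightarrow> True"
| "small_consts (Read a e) \<longleftrightarrow> small_consts e"
| "small_consts (Bin f e1 e2) \<longleftrightarrow> small_consts e1 \<and> small_consts e2"

lemma binop_val_less:
  assumes "x < 2 ^ p" "y < 2 ^ q" "1 \<le> p" "1 \<le> q"
  shows "binop_val f x y < 2 ^ (p + q + 1)"
proof -
  have pq: "(2::nat) ^ p \<le> 2 ^ (p + q + 1)" "(2::nat) ^ q \<le> 2 ^ (p + q + 1)"
    by (rule power_increasing; simp)+
  have xy: "x * y < 2 ^ (p + q + 1)"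
  proof -
    have "x * y \<le> 2 ^ p * 2 ^ q"
      using assms by (intro mult_le_mono) auto
    also have "\<dots> < 2 ^ (p + q + 1)"
      by (simp add: power_add)
    finally show ?thesis .
  qed
  have add: "x + y < 2 ^ (p + q + 1)"
  proof -
    have "(2::nat) ^ p \<le> 2 ^ (p + q)" "(2::nat) ^ q \<le> 2 ^ (p + q)"
      by (rule power_increasing; simp)+
    then have "x + y < 2 ^ (p + q) + 2 ^ (p + q)"
      using assms by linarith
    then show ?thesis by simp
  qed
  have b: "(1::nat) < 2 ^ (p + q + 1)" by (rule one_less_power) auto
  show ?thesis
  proof (cases f)
    case Div
    have "x div y < 2 ^ (p + q + 1)"
      using assms(1) pq(1) div_le_dividend[of x y] by linarith
    with Div show ?thesis by simp
  next
    case Mod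
    then show ?thesis using assms pq
      by (metis binop_val.simps(5) mod_less_eq_dividend order_le_less_trans order_less_le_trans)
  next
    case Monus
    then show ?thesis using assms pq by (simp add: less_imp_diff_less order_less_le_trans)
  qed (use xy add b in \<open>auto simp: of_bool_def\<close>)
qed

lemma esize_pos: "1 \<le> esize e"
  by (induction e) auto

text \<open>A variable or cell contributes \<beta> bits, whatever its address, and an operator at
  most adds the lengths of its operands plus one. So the length is linear in the size of the
  expression.\<close>

lemma aval_less:
  assumes "bdd \<beta> s" "small_consts e"
  shows "aval e s < 2 ^ (\<beta> * esize e + esize e)"
  using assms(2)
proof (induction e)
  case (Const c)
  have "(2::nat) ^ 2 \<le> 2 ^ (\<beta> + 1)"
    using assms(1) by (intro power_increasing) (auto simp: bdd_def)
  then show ?case using Const by simp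
next
  case (Var x)
  have "var s x < 2 ^ \<beta>" using assms(1) by (simp add: bdd_def)
  then show ?case by (simp add: less_imp_le trans_less_add1)
next
  case (Read a e)
  have "arr s a (aval e s) < 2 ^ \<beta>" using assms(1) by (simp add: bdd_def)
  also have "\<dots> \<le> 2 ^ (\<beta> * esize (Read a e) + esize (Read a e))"
    by (rule power_increasing) auto
  finally show ?case by simp
next
  case (Bin f e1 e2)
  have "aval (Bin f e1 e2) s < 2 ^ ((\<beta> * esize e1 + esize e1) + (\<beta> * esize e2 + esize e2) + 1)"
    unfolding aval.simps
    by (rule binop_val_less) (use Bin esize_pos[of e1] esize_pos[of e2] in auto)
  also have "\<dots> \<le> 2 ^ (\<beta> * esize (Bin f e1 e2) + esize (Bin f e1 e2))"
    by (rule power_increasing) (auto simp: algebra_simps)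
  finally show ?case .
qed

lemma len_cost_le: "v < 2 ^ b \<Longrightarrow> len_cost v \<le> 1 + b"
  unfolding len_cost_def by (simp add: floorlog_leI)

lemma acost_le_aux:
  assumes "bdd \<beta> s" "small_consts e" "esize e \<le> K"
  shows "acost e s \<le> esize e * (1 + (\<beta> + 1) * K)"
proof -
  have len: "len_cost (aval e' s) \<le> 1 + (\<beta> + 1) * K"
    if "small_consts e'" "esize e' \<le> K" for e'
  proof -
    have "aval e' s < 2 ^ (\<beta> * esize e' + esize e')"
      using assms(1) that(1) by (rule aval_less)
    also have "\<dots> \<le> 2 ^ ((\<beta> + 1) * K)"
      using mult_le_mono2[OF that(2), of "\<beta> + 1"]
      by (intro power_increasing) (auto simp: algebra_simps)
    finally show ?thesis by (rule len_cost_le)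
  qed
  show ?thesis using assms(2,3)
  proof (induction e)
    case (Bin f e1 e2)
    then show ?case using len[of "Bin f e1 e2"] by (simp add: add_mult_distrib)
  next
    case (Const c)
    then show ?case using len[of "Const c"] by simp
  next
    case (Var x)
    then show ?case using len[of "Var x"] by simp
  next
    case (Read a e)
    then show ?case using len[of "Read a e"] by simp
  qed
qed

text \<open>Pays for two expressions of size at most 16 with small constants over a store of \<open>\<beta>\<close>-bit values:
  their intermediate values have at most \<open>(\<beta> + 1) * 16\<close> bits.\<close>

definition step_cost :: "nat \<Rightarrow> nat" where
  "step_cost \<beta> = 1 + 2 * (16 * (1 + (\<beta> + 1) * 16))"

lemma acost_le:
  assumes "bdd \<beta> s" "small_consts e" "esize e \<le> 16"
  shows "2 * acost e s < step_cost \<beta>"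
proof -
  have "acost e s \<le> esize e * (1 + (\<beta> + 1) * 16)"
    by (rule acost_le_aux[OF assms])
  also have "\<dots> \<le> 16 * (1 + (\<beta> + 1) * 16)"
    using assms(3) by (rule mult_le_mono1)
  finally show ?thesis by (simp add: step_cost_def)
qed

text \<open>\<open>T\<close> counts steps, each of which is charged \<open>step_cost \<beta>\<close>.\<close>

definition wp :: "nat \<Rightarrow> nat \<Rightarrow> com \<Rightarrow> (store \<Rightarrow> bool) \<Rightarrow> store \<Rightarrow> bool" where
  "wp \<beta> T c Q s \<longleftrightarrow> (\<exists>t s'. exec c s t s' \<and> t \<le> T * step_cost \<beta> \<and> bdd \<beta> s' \<and> Q s')"

fun wvars :: "com \<Rightarrow> nat set" where
  "wvars Skip = {}"
| "wvars (Assign x e) = {x}"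
| "wvars (Write a i e) = {}"
| "wvars (Seq c1 c2) = wvars c1 \<union> wvars c2"
| "wvars (Cond b c1 c2) = wvars c1 \<union> wvars c2"
| "wvars (While b c) = wvars c"

fun warrs :: "com \<Rightarrow> nat set" where
  "warrs Skip = {}"
| "warrs (Assign x e) = {}"
| "warrs (Write a i e) = {a}"
| "warrs (Seq c1 c2) = warrs c1 \<union> warrs c2"
| "warrs (Cond b c1 c2) = warrs c1 \<union> warrs c2"
| "warrs (While b c) = warrs c"

definition set_var :: "nat \<Rightarrow> nat \<Rightarrow> store \<Rightarrow> store" where
  "set_var x v s = s\<lparr>var := (var s)(x := v)\<rparr>"

definition set_arr :: "nat \<Rightarrow> nat \<Rightarrow> nat \<Rightarrow> store \<Rightarrow> store" where
  "set_arr a i v s = s\<lparr>arr := (arr s)(a := (arr s a)(i := v))\<rparr>"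

lemma set_var_simps [simp]:
  "var (set_var x v s) y = (if y = x then v else var s y)" "arr (set_var x v s) = arr s"
  by (simp_all add: set_var_def)

lemma set_arr_simps [simp]:
  "arr (set_arr a i v s) b = (if b = a then (arr s a)(i := v) else arr s b)" "var (set_arr a i v s) = var s"
  by (simp_all add: set_arr_def)

definition same_off :: "nat set \<Rightarrow> nat set \<Rightarrow> store \<Rightarrow> store \<Rightarrow> bool" where
  "same_off X A s s' \<longleftrightarrow> (\<forall>x. x \<notin> X \<longrightarrow> var s' x = var s x) \<and> (\<forall>a. a \<notin> A \<longrightarrow> arr s' a = arr s a)"

lemma same_offD:
  assumes "same_off X A s s'"
  shows "x \<notin> X \<Longrightarrow> var s' x = var s x" "a \<notin> A \<Longrightarrow> arr s' a = arr s a"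
  using assms by (auto simp: same_off_def)

lemma same_off_refl: "same_off X A s s"
  by (simp add: same_off_def)

lemma same_off_trans: "same_off X A s s' \<Longrightarrow> same_off X A s' s'' \<Longrightarrow> same_off X A s s''"
  by (simp add: same_off_def)

lemma exec_same_off: "exec c s t s' \<Longrightarrow> same_off (wvars c) (warrs c) s s'"
  by (induction rule: exec.induct) (auto simp: same_off_def)

text \<open>The frame condition enters here, from the syntactic write sets. Postconditions and
  invariants then only have to mention what changes.\<close>

lemma wp_conseq:
  assumes "wp \<beta> T c Q s" "T \<le> T'"
    and "\<And>s'. same_off (wvars c) (warrs c) s s' \<Longrightarrow> bdd \<beta> s' \<Longrightarrow> Q s' \<Longrightarrow> R s'"
  shows "wp \<beta> T' c R s"
proof -
  obtain t s' where "exec c s t s'" "t \<le> T * step_cost \<beta>" "bdd \<beta> s'" "Q s'"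
    using assms(1) by (auto simp: wp_def)
  moreover have "T * step_cost \<beta> \<le> T' * step_cost \<beta>"
    using assms(2) by simp
  ultimately show ?thesis
    unfolding wp_def using assms(3) exec_same_off le_trans by blast
qed

lemma wp_mono: "wp \<beta> T c Q s \<Longrightarrow> T \<le> T' \<Longrightarrow> wp \<beta> T' c Q s"
  by (rule wp_conseq)

lemma wp_Skip: "bdd \<beta> s \<Longrightarrow> Q s \<Longrightarrow> wp \<beta> 1 Skip Q s"
  unfolding wp_def by (intro exI[of _ 1] exI[of _ s]) (auto simp: step_cost_def intro: exec.Skip[simplified])

definition ok_exp :: "aexp \<Rightarrow> bool" where
  "ok_exp e \<longleftrightarrow> small_consts e \<and> esize e \<le> 16"

lemma wp_Assign:
  assumes "bdd \<beta> s" "ok_exp e"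
    and "\<And>v. v = aval e s \<Longrightarrow> bdd \<beta> (set_var x v s) \<Longrightarrow> Q (set_var x v s)"
    and "aval e s < 2 ^ \<beta>"
  shows "wp \<beta> 1 (Assign x e) Q s"
  unfolding wp_def
proof (intro exI conjI)
  show "exec (Assign x e) s (1 + acost e s) (s\<lparr>var := (var s)(x := aval e s)\<rparr>)"
    by (rule exec.Assign)
  show "1 + acost e s \<le> 1 * step_cost \<beta>"
    using acost_le[OF assms(1), of e] assms(2) by (simp add: ok_exp_def)
qed (use assms in \<open>auto simp: bdd_def set_var_def\<close>)

lemma wp_Write:
  assumes "bdd \<beta> s" "ok_exp i" "ok_exp e"
    and "\<And>j v. j = aval i s \<Longrightarrow> v = aval e s \<Longrightarrow> bdd \<beta> (set_arr a j v s) \<Longrightarrow> Q (set_arr a j v s)"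
    and "aval e s < 2 ^ \<beta>"
  shows "wp \<beta> 1 (Write a i e) Q s"
  unfolding wp_def
proof (intro exI conjI)
  show "exec (Write a i e) s (1 + acost i s + acost e s)
    (s\<lparr>arr := (arr s)(a := (arr s a)(aval i s := aval e s))\<rparr>)"
    by (rule exec.Write)
  show "1 + acost i s + acost e s \<le> 1 * step_cost \<beta>"
    using acost_le[OF assms(1), of i] acost_le[OF assms(1), of e] assms(2,3) by (simp add: ok_exp_def)
qed (use assms in \<open>auto simp: bdd_def set_arr_def\<close>)

lemma wp_Seq:
  assumes "wp \<beta> T1 c1 (wp \<beta> T2 c2 Q) s"
  shows "wp \<beta> (T1 + T2) (Seq c1 c2) Q s"
proof -
  obtain t1 s1 t2 s2 where "exec c1 s t1 s1" "t1 \<le> T1 * step_cost \<beta>"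
    "exec c2 s1 t2 s2" "t2 \<le> T2 * step_cost \<beta>" "bdd \<beta> s2" "Q s2"
    using assms by (auto simp: wp_def)
  then show ?thesis unfolding wp_def
    using exec.Seq add_le_mono by (metis add_mult_distrib)
qed

text \<open>Charging both branches instead of the longer one keeps the time a function of the
  command alone.\<close>

lemma wp_Cond:
  assumes "aval b s \<noteq> 0 \<Longrightarrow> wp \<beta> T1 c1 Q s" "aval b s = 0 \<Longrightarrow> wp \<beta> T2 c2 Q s"
    and "bdd \<beta> s" "ok_exp b"
  shows "wp \<beta> (T1 + T2 + 1) (Cond b c1 c2) Q s"
proof -
  have c: "1 + acost b s \<le> step_cost \<beta>" using acost_le[OF assms(3), of b] assms(4) by (simp add: ok_exp_def)
  obtain t s' where "exec (Cond b c1 c2) s (1 + acost b s + t) s'" "t \<le> (T1 + T2) * step_cost \<beta>"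
    "bdd \<beta> s'" "Q s'"
  proof (cases "aval b s = 0")
    case True
    then obtain t s' where "exec c2 s t s'" "t \<le> T2 * step_cost \<beta>" "bdd \<beta> s'" "Q s'"
      using assms(2) by (auto simp: wp_def)
    moreover from this(2) have "t \<le> (T1 + T2) * step_cost \<beta>" by (simp add: add_mult_distrib)
    ultimately show ?thesis using True exec.CondFalse that by blast
  next
    case False
    then obtain t s' where "exec c1 s t s'" "t \<le> T1 * step_cost \<beta>" "bdd \<beta> s'" "Q s'"
      using assms(1) by (auto simp: wp_def)
    moreover from this(2) have "t \<le> (T1 + T2) * step_cost \<beta>" by (simp add: add_mult_distrib)
    ultimately show ?thesis using False exec.CondTrue that by blast
  qed
  moreover from this(2) c have "1 + acost b s + t \<le> (T1 + T2 + 1) * step_cost \<beta>" by simp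
  ultimately show ?thesis unfolding wp_def by blast
qed

text \<open>The number \<open>N\<close> of rounds is fixed in advance and the invariant is indexed
  by the rounds done, so termination and time come from one induction on the rounds left.\<close>

lemma wp_While:
  assumes b: "ok_exp b"
    and true: "\<And>j s'. j < N \<Longrightarrow> I j s' \<Longrightarrow> bdd \<beta> s' \<Longrightarrow> same_off (wvars c) (warrs c) s s' \<Longrightarrow> aval b s' \<noteq> 0"
    and body: "\<And>j s'. j < N \<Longrightarrow> I j s' \<Longrightarrow> bdd \<beta> s' \<Longrightarrow> same_off (wvars c) (warrs c) s s' \<Longrightarrow>
                wp \<beta> T c (I (Suc j)) s'"
    and false: "\<And>s'. I N s' \<Longrightarrow> bdd \<beta> s' \<Longrightarrow> same_off (wvars c) (warrs c) s s' \<Longrightarrow> aval b s' = 0"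
    and fin: "\<And>s'. I N s' \<Longrightarrow> bdd \<beta> s' \<Longrightarrow> same_off (wvars c) (warrs c) s s' \<Longrightarrow> Q s'"
    and init: "I 0 s" "bdd \<beta> s"
  shows "wp \<beta> (1 + N * (T + 1)) (While b c) Q s"
proof -
  have main: "wp \<beta> (1 + r * (T + 1)) (While b c) Q s'"
    if "j + r = N" "I j s'" "bdd \<beta> s'" "same_off (wvars c) (warrs c) s s'" for j r s'
    using that
  proof (induction r arbitrary: j s')
    case 0
    then have "exec (While b c) s' (1 + acost b s') s'"
      using false by (intro exec.WhileFalse) auto
    moreover have "1 + acost b s' \<le> step_cost \<beta>"
      using acost_le[OF 0(3), of b] b by (simp add: ok_exp_def)
    ultimately show ?case unfolding wp_def using 0 fin by auto
  next
    case (Suc r)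
    then have j: "j < N" by simp
    have true': "aval b s' \<noteq> 0" using true j Suc by blast
    obtain t1 s1 where 1: "exec c s' t1 s1" "t1 \<le> T * step_cost \<beta>" "bdd \<beta> s1" "I (Suc j) s1"
      using body[OF j Suc.prems(2-4)] by (auto simp: wp_def)
    have "same_off (wvars c) (warrs c) s s1"
      using Suc.prems(4) exec_same_off[OF 1(1)] by (rule same_off_trans)
    with Suc.prems 1 have "wp \<beta> (1 + r * (T + 1)) (While b c) Q s1"
      by (intro Suc.IH[of "Suc j"]) auto
    then obtain t2 s2 where
      2: "exec (While b c) s1 t2 s2" "t2 \<le> (1 + r * (T + 1)) * step_cost \<beta>" "bdd \<beta> s2" "Q s2"
      unfolding wp_def by blast
    have "exec (While b c) s' (1 + acost b s' + t1 + t2) s2"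
      using true' 1 2 exec.WhileTrue by blast
    moreover have "1 + acost b s' + t1 + t2 \<le> (1 + Suc r * (T + 1)) * step_cost \<beta>"
      using acost_le[OF Suc(4), of b] b 1 2 by (simp add: algebra_simps ok_exp_def)
    ultimately show ?case unfolding wp_def using 2 by blast
  qed
  show ?thesis using main[of 0 N s] init same_off_refl by simp
qed

section \<open>Symbolic execution of loop-free code\<close>

fun straight :: "com \<Rightarrow> bool" where
  "straight Skip \<longleftrightarrow> True"
| "straight (Assign x e) \<longleftrightarrow> ok_exp e"
| "straight (Write a i e) \<longleftrightarrow> ok_exp i \<and> ok_exp e"
| "straight (Seq c1 c2) \<longleftrightarrow> straight c1 \<and> straight c2"
| "straight (Cond b c1 c2) \<longleftrightarrow> ok_exp b \<and> straight c1 \<and> straight c2"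
| "straight (While b c) \<longleftrightarrow> False"

fun steps :: "com \<Rightarrow> nat" where
  "steps (Seq c1 c2) = steps c1 + steps c2"
| "steps (Cond b c1 c2) = steps c1 + steps c2 + 1"
| "steps c = 1"

fun run :: "com \<Rightarrow> store \<Rightarrow> store" where
  "run (Assign x e) s = set_var x (aval e s) s"
| "run (Write a i e) s = set_arr a (aval i s) (aval e s) s"
| "run (Seq c1 c2) s = run c2 (run c1 s)"
| "run (Cond b c1 c2) s = (if aval b s \<noteq> 0 then run c1 s else run c2 s)"
| "run c s = s"

text \<open>The one obligation left by \<open>run\<close>: stored values must again have \<beta>
  bits. Intermediate values may be longer, which \<open>step_cost\<close> pays for.\<close>

fun safe :: "nat \<Rightarrow> com \<Rightarrow> store \<Rightarrow> bool" where
  "safe \<beta> (Assign x e) s \<longleftrightarrow> aval e s < 2 ^ \<beta>"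
| "safe \<beta> (Write a i e) s \<longleftrightarrow> aval e s < 2 ^ \<beta>"
| "safe \<beta> (Seq c1 c2) s \<longleftrightarrow> safe \<beta> c1 s \<and> safe \<beta> c2 (run c1 s)"
| "safe \<beta> (Cond b c1 c2) s \<longleftrightarrow> (if aval b s \<noteq> 0 then safe \<beta> c1 s else safe \<beta> c2 s)"
| "safe \<beta> c s \<longleftrightarrow> True"

text \<open>\<open>run\<close> and \<open>safe\<close> unfold by simplification, so loop-free code
  needs no intermediate assertions.\<close>

lemma wp_straight:
  assumes "straight c" "bdd \<beta> s" "safe \<beta> c s" "bdd \<beta> (run c s) \<Longrightarrow> Q (run c s)"
  shows "wp \<beta> (steps c) c Q s"
  using assms
proof (induction c arbitrary: s Q)
  case Skip
  show ?case unfolding steps.simps by (rule wp_Skip) (use Skip in simp_all)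
next
  case (Assign x e)
  show ?case unfolding steps.simps by (rule wp_Assign) (use Assign in simp_all)
next
  case (Write a i e)
  show ?case unfolding steps.simps by (rule wp_Write) (use Write in simp_all)
next
  case (Seq c1 c2)
  show ?case unfolding steps.simps
  proof (intro wp_Seq Seq.IH(1))
    assume "bdd \<beta> (run c1 s)"
    then show "wp \<beta> (steps c2) c2 Q (run c1 s)"
      using Seq.prems by (intro Seq.IH(2)) simp_all
  qed (use Seq.prems in simp_all)
next
  case (Cond b c1 c2)
  show ?case unfolding steps.simps
  proof (rule wp_Cond)
    assume "aval b s \<noteq> 0"
    then show "wp \<beta> (steps c1) c1 Q s" using Cond.prems by (intro Cond.IH(1)) simp_all
  next
    assume "aval b s = 0"
    then show "wp \<beta> (steps c2) c2 Q s" using Cond.prems by (intro Cond.IH(2)) simp_all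
  qed (use Cond.prems in simp_all)
next
  case (While b c)
  then show ?case by simp
qed

lemma wp_straight_Seq:
  assumes "straight c1" "bdd \<beta> s" "safe \<beta> c1 s" "bdd \<beta> (run c1 s) \<Longrightarrow> wp \<beta> T c2 Q (run c1 s)"
  shows "wp \<beta> (steps c1 + T) (Seq c1 c2) Q s"
  by (intro wp_Seq wp_straight assms)

lemma wp_SeqI:
  assumes "wp \<beta> T1 c1 R s"
    and "\<And>s'. same_off (wvars c1) (warrs c1) s s' \<Longrightarrow> bdd \<beta> s' \<Longrightarrow> R s' \<Longrightarrow> wp \<beta> T2 c2 Q s'"
  shows "wp \<beta> (T1 + T2) (Seq c1 c2) Q s"
  by (rule wp_Seq, rule wp_conseq[OF assms(1) order_refl assms(2)])

section \<open>Counting loops\<close>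

definition For :: "nat \<Rightarrow> nat \<Rightarrow> com \<Rightarrow> com" where
  "For i v c = Seq (Assign i (Const 0))
     (While (Bin Less (Var i) (Var v)) (Seq c (Assign i (Bin Plus (Var i) (Const 1)))))"

lemma wvars_For [simp]: "wvars (For i v c) = insert i (wvars c)"
  and warrs_For [simp]: "warrs (For i v c) = warrs c"
  by (auto simp: For_def)

text \<open>The increment belongs to the loop, not to \<open>c\<close>, so the body has to establish
  the invariant for the store with the counter already advanced. The two extra steps per round are
  test and increment.\<close>

lemma wp_For:
  assumes bdd: "bdd \<beta> s"
    and fresh: "i \<noteq> v" "i \<notin> wvars c" "v \<notin> wvars c" and N: "var s v = N"
    and init: "I 0 (set_var i 0 s)"
    and body: "\<And>j s'. j < N \<Longrightarrow> I j s' \<Longrightarrow> var s' i = j \<Longrightarrow> bdd \<beta> s' \<Longrightarrow>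
                same_off (insert i (wvars c)) (warrs c) s s' \<Longrightarrow>
                wp \<beta> T c (\<lambda>s''. I (Suc j) (set_var i (Suc j) s'')) s'"
    and fin: "\<And>s'. I N s' \<Longrightarrow> var s' i = N \<Longrightarrow> bdd \<beta> s' \<Longrightarrow>
                same_off (insert i (wvars c)) (warrs c) s s' \<Longrightarrow> Q s'"
  shows "wp \<beta> (2 + N * (T + 2)) (For i v c) Q s"
proof -
  let ?s = "set_var i 0 s"
  let ?c = "Seq c (Assign i (Bin Plus (Var i) (Const 1)))"
  have N_less: "N < 2 ^ \<beta>" using bdd N by (auto simp: bdd_def)
  have bdd': "bdd \<beta> ?s" using bdd by (auto simp: bdd_def)
  have off: "same_off (insert i (wvars c)) (warrs c) s s'"
    if "same_off (wvars ?c) (warrs ?c) ?s s'" for s'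
    using that by (auto simp: same_off_def)
  have v: "var s' v = N" if "same_off (wvars ?c) (warrs ?c) ?s s'" for s'
    using same_offD(1)[OF that, of v] fresh N by simp
  have "wp \<beta> (1 + N * ((T + 1) + 1)) (While (Bin Less (Var i) (Var v)) ?c) Q ?s"
  proof (rule wp_While[where I = "\<lambda>j s'. I j s' \<and> var s' i = j"], goal_cases)
    case (3 j s')
    have s': "same_off (insert i (wvars c)) (warrs c) s s'" using 3 off by blast
    have "wp \<beta> T c (\<lambda>s''. I (Suc j) (set_var i (Suc j) s'')) s'"
      using body s' 3 by blast
    then have "wp \<beta> T c (wp \<beta> 1 (Assign i (Bin Plus (Var i) (Const 1)))
        (\<lambda>s'. I (Suc j) s' \<and> var s' i = Suc j)) s'"
    proof (rule wp_conseq, goal_cases)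
      case (2 s'')
      have "var s'' i = j" using same_offD(1)[OF 2(1), of i] fresh 3 by simp
      then show ?case
        using 2 N_less 3(1) by (intro wp_Assign) (auto simp: ok_exp_def)
    qed simp
    then show ?case by (rule wp_Seq)
  next
    case (5 s')
    then show ?case using off fin by blast
  qed (use v init bdd' in \<open>auto simp: ok_exp_def\<close>)
  then have "wp \<beta> (1 + (1 + N * ((T + 1) + 1))) (For i v c) Q s"
    unfolding For_def by (intro wp_Seq wp_Assign) (use bdd in \<open>auto simp: ok_exp_def\<close>)
  then show ?thesis by (simp add: add.assoc)
qed

section \<open>An injective modulus\<close>

text \<open>The entries of Leibniz's harmonic triangle are \<open>1 / (Suc j * (n choose Suc j))\<close>; each is a
  difference of two entries with smaller \<open>j\<close>, and those with \<open>j = 0\<close> are \<open>1 / n\<close>.\<close>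

lemma binomial_dvd_common_multiple:
  fixes L :: nat
  assumes "\<And>i. 1 \<le> i \<Longrightarrow> i \<le> n \<Longrightarrow> i dvd L" "j < n"
  shows "Suc j * (n choose Suc j) dvd L"
  using assms
proof (induction j arbitrary: n)
  case 0
  then show ?case by simp
next
  case (Suc j)
  obtain n' where n: "n = Suc n'" using Suc.prems(2) by (cases n) auto
  define a where "a = Suc j * (n' choose Suc j)"
  define b where "b = Suc j * (n choose Suc j)"
  define c where "c = Suc (Suc j) * (n choose Suc (Suc j))"
  have "a dvd L" unfolding a_def using Suc.prems n by (intro Suc.IH) auto
  moreover have "b dvd L" unfolding b_def using Suc.prems n by (intro Suc.IH) auto
  ultimately obtain u v where u: "L = a * u" and v: "L = b * v" by (metis dvdE)
  have pos: "b > 0" using Suc.prems n by (auto simp: b_def)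
  have b: "b = n * (n' choose j)" and c: "c = n * (n' choose Suc j)"
    unfolding b_def c_def n by (rule Suc_times_binomial)+
  have "b + c = n * (n choose Suc j)"
    unfolding b c n by (simp add: algebra_simps)
  \<comment> \<open>This is 1/c = 1/a - 1/b without denominators. Consequently L/c = u - v is an
    integer.\<close>
  then have "a * (b + c) = b * c"
    unfolding c by (simp add: a_def b_def del: mult_Suc)
  then have "b * c * u = a * (b + c) * u" by simp
  then have "b * (c * u) = (b + c) * L"
    by (simp add: u mult_ac)
  also have "\<dots> = b * (L + c * v)"
    by (simp add: v algebra_simps)
  finally have "c * u = L + c * v" using pos by simp
  then have "c dvd L" by (metis dvd_add_left_iff dvd_triv_left)
  then show ?case by (simp add: c_def)
qed

text \<open>Each step at least doubles the value: C(2j+2, j+1) = 2 C(2j+1, j) \<ge> 2 C(2j,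
  j).\<close>

lemma two_power_le_binomial: "2 ^ j \<le> (2 * j) choose j"
proof (induction j)
  case (Suc j)
  have "Suc j * (2 * Suc j choose Suc j) = 2 * Suc j * (Suc (2 * j) choose j)"
    using Suc_times_binomial[of j "Suc (2 * j)"] by simp
  then have "2 * Suc j choose Suc j = 2 * (Suc (2 * j) choose j)"
    using mult_cancel1[of "Suc j"] by (simp only: mult_ac) blast
  moreover have "2 * j choose j \<le> Suc (2 * j) choose j"
    by (cases j) simp_all
  ultimately show ?case using Suc by simp
qed simp

text \<open>For j = m div 2 > 0 the number j C(2j, j) divides \<open>L\<close>, and the binomial
  coefficient alone is at least 2^j.\<close>

lemma common_multiple_ge:
  fixes L :: nat
  assumes "\<And>i. 1 \<le> i \<Longrightarrow> i \<le> m \<Longrightarrow> i dvd L" "L > 0"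
  shows "2 ^ (m div 2) \<le> L"
proof (cases "m div 2")
  case 0
  then show ?thesis using assms(2) by simp
next
  case (Suc j)
  have "Suc j * ((2 * Suc j) choose Suc j) dvd L"
    using Suc by (intro binomial_dvd_common_multiple assms(1)) auto
  then have "Suc j * ((2 * Suc j) choose Suc j) \<le> L"
    using assms(2) by (rule dvd_imp_le)
  moreover have "((2 * Suc j) choose Suc j) \<le> Suc j * ((2 * Suc j) choose Suc j)"
    by simp
  ultimately show ?thesis
    using two_power_le_binomial[of "Suc j"] unfolding Suc by (meson order_trans)
qed

lemma exists_injective_modulus:
  fixes S :: "nat set"
  assumes S: "S \<subseteq> {..<2 ^ b}" "finite S" "card S \<le> k" and m: "2 * (k * k * b + 1) \<le> m"
  obtains \<mu> where "1 \<le> \<mu>" "\<mu> \<le> m" "inj_on (\<lambda>x. x mod \<mu>) S"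
proof -
  define D where "D = {(x, y). x \<in> S \<and> y \<in> S \<and> x < y}"
  define L where "L = (\<Prod>(x, y)\<in>D. y - x)"
  have D: "D \<subseteq> S \<times> S" "finite D" "card D \<le> k * k"
  proof -
    show *: "D \<subseteq> S \<times> S" by (auto simp: D_def)
    then show "finite D" using S(2) by (meson finite_SigmaI finite_subset)
    have "card D \<le> card (S \<times> S)" using * S(2) by (intro card_mono) auto
    also have "\<dots> \<le> k * k" using S(3) by (auto simp: card_cartesian_product intro: mult_le_mono)
    finally show "card D \<le> k * k" .
  qed
  have pos: "L > 0" unfolding L_def by (rule prod_pos) (auto simp: D_def)
  have "L \<le> (\<Prod>(x, y)\<in>D. 2 ^ b)"
    unfolding L_def using S(1) by (intro prod_mono) (auto simp: D_def intro!: order_trans[OF diff_le_self] less_imp_le)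
  also have "\<dots> = (2 ^ b) ^ card D" by simp
  also have "\<dots> \<le> (2 ^ b) ^ (k * k)" using D(3) by (intro power_increasing) auto
  also have "\<dots> = 2 ^ (k * k * b)" by (simp add: power_mult[symmetric] mult.commute)
  finally have L_le: "L \<le> 2 ^ (k * k * b)" .
  show ?thesis
  proof (cases "\<exists>\<mu>. 1 \<le> \<mu> \<and> \<mu> \<le> m \<and> \<not> \<mu> dvd L")
    case True
    then obtain \<mu> where \<mu>: "1 \<le> \<mu>" "\<mu> \<le> m" "\<not> \<mu> dvd L" by blast
    have "x mod \<mu> \<noteq> y mod \<mu>" if "(x, y) \<in> D" for x y
    proof
      assume "x mod \<mu> = y mod \<mu>"
      then have "\<mu> dvd y - x" using that mod_eq_dvd_iff_nat[of x y \<mu>] by (auto simp: D_def)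
      also have "y - x dvd L" unfolding L_def using dvd_prodI[OF D(2) that, of "\<lambda>(x, y). y - x"] by simp
      finally show False using \<mu>(3) by simp
    qed
    then have "inj_on (\<lambda>x. x mod \<mu>) S"
      by (intro linorder_inj_onI) (auto simp: D_def)
    with \<mu> that show ?thesis by blast
  next
    case False
    then have dvd: "\<And>i. 1 \<le> i \<Longrightarrow> i \<le> m \<Longrightarrow> i dvd L" by blast
    have "2 ^ (m div 2) \<le> L" by (rule common_multiple_ge[OF dvd pos])
    with L_le have "(2::nat) ^ (m div 2) \<le> 2 ^ (k * k * b)" by (rule order_trans[rotated])
    then have "m div 2 \<le> k * k * b" by simp
    \<comment> \<open>The bound on \<open>m\<close> gives
      \<open>m div 2 \<ge> k * k * b + 1\<close>, a contradiction.\<close>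
    then show ?thesis using m by simp
  qed
qed

section \<open>Universal families by conditional expectations\<close>

text \<open>Both patterns and splittings are coded by digit strings; this supplies a code for
  prescribed digits.\<close>

lemma exists_digits:
  fixes d :: "nat \<Rightarrow> nat"
  assumes "\<And>j. j < l \<Longrightarrow> d j < r"
  shows "\<exists>c < r ^ l. \<forall>j<l. c div r ^ j mod r = d j"
  using assms
proof (induction l)
  case (Suc l)
  then obtain c where c: "c < r ^ l" "\<And>j. j < l \<Longrightarrow> c div r ^ j mod r = d j" by auto
  have d: "d l < r" using Suc.prems by simp
  let ?c = "c + d l * r ^ l"
  have "?c < r ^ Suc l"
  proof -
    have "?c < r ^ l + d l * r ^ l" using c(1) by simp
    also have "\<dots> = Suc (d l) * r ^ l" by simp
    also have "\<dots> \<le> r * r ^ l" using d by (intro mult_le_mono1) simp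
    finally show ?thesis by simp
  qed
  moreover have "?c div r ^ j mod r = d j" if "j < Suc l" for j
  proof (cases "j = l")
    case True
    then show ?thesis using c(1) d by simp
  next
    case False
    then have j: "j < l" using that by simp
    have r: "r > 0" using d by simp
    have "r ^ l = r ^ j * (r * r ^ (l - Suc j))"
      using j by (metis Suc_diff_Suc add_diff_inverse_nat not_less_iff_gr_or_eq power_Suc power_add)
    then have "?c div r ^ j = c div r ^ j + r * (d l * r ^ (l - Suc j))"
      using r by (simp add: mult.assoc mult.left_commute[of "d l"] mult.left_commute[of _ "r ^ j"])
    then show ?thesis using c(2)[OF j] by simp
  qed
  ultimately show ?case by blast
qed simp

text \<open>A pattern demands the bits \<open>b j\<close> at the positions \<open>p 0 < p 1 < \<dots>\<close>. If \<open>h\<close> has been fixed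
  below \<open>cur\<close>, the number of patterns met by a random extension of \<open>h\<close> has expectation proportional
  to the sum of the weights; \<open>h cur\<close> is the bit for which this expectation does not decrease.\<close>

primrec next_pos :: "(nat \<Rightarrow> nat) \<Rightarrow> nat \<Rightarrow> nat" where
  "next_pos p 0 = 0"
| "next_pos p (Suc j) = Suc (p j)"

primrec weight :: "(nat \<Rightarrow> nat) \<Rightarrow> nat \<Rightarrow> nat \<Rightarrow> (nat \<Rightarrow> nat) \<Rightarrow> (nat \<Rightarrow> nat) \<Rightarrow> nat \<Rightarrow> nat" where
  "weight h cur a p b 0 = a"
| "weight h cur a p b (Suc j) =
     (let w = (if p j < next_pos p j then 0 else weight h cur a p b j) in
      if p j < cur then if h (p j) = b j then 2 * w else 0 else w)"

text \<open>The value 2 means that no bit is demanded at \<open>cur\<close>.\<close>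

primrec demand :: "nat \<Rightarrow> (nat \<Rightarrow> nat) \<Rightarrow> (nat \<Rightarrow> nat) \<Rightarrow> nat \<Rightarrow> nat" where
  "demand cur p b 0 = 2"
| "demand cur p b (Suc j) = (if p j = cur then b j else demand cur p b j)"

definition increasing :: "(nat \<Rightarrow> nat) \<Rightarrow> nat \<Rightarrow> bool" where
  "increasing p t \<longleftrightarrow> (\<forall>j<t. next_pos p j \<le> p j)"

lemma increasing_Suc: "increasing p (Suc j) \<longleftrightarrow> increasing p j \<and> next_pos p j \<le> p j"
  unfolding increasing_def by (auto simp: less_Suc_eq)

text \<open>Codes whose positions do not increase are not patterns; the weight 0 removes them from
  every count.\<close>

lemma weight_not_increasing: "\<not> increasing p t \<Longrightarrow> weight h cur a p b t = 0"
proof (induction t)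
  case (Suc t)
  then show ?case by (cases "increasing p t") (auto simp: increasing_Suc Let_def)
qed (simp add: increasing_def)

text \<open>Positions increase, so if the last one lies below \<open>cur\<close>, none of them
  equals \<open>cur\<close>.\<close>

lemma demand_unmet: "increasing p t \<Longrightarrow> next_pos p t \<le> cur \<Longrightarrow> demand cur p b t = 2"
proof (induction t)
  case (Suc t)
  have "next_pos p t \<le> cur" using Suc.prems by (cases t) (auto simp: increasing_Suc)
  then show ?case using Suc by (auto simp: increasing_Suc)
qed simp

text \<open>The martingale property: without a demand the weight stays, with one it is doubled or
  killed, so the average over both bits is the old weight.\<close>

lemma weight_step:
  assumes "\<And>j. j < t \<Longrightarrow> b j < 2" "h' cur < 2" and h': "\<And>x. x < cur \<Longrightarrow> h' x = h x"
  shows "weight h' (Suc cur) a p b t =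
    (if demand cur p b t = 2 then weight h cur a p b t
     else if demand cur p b t = h' cur then 2 * weight h cur a p b t else 0)"
proof (cases "increasing p t")
  case True
  then show ?thesis using assms(1)
  proof (induction t)
    case (Suc t)
    have b: "b t < 2" using Suc.prems by simp
    have IH: "weight h' (Suc cur) a p b t =
      (if demand cur p b t = 2 then weight h cur a p b t
       else if demand cur p b t = h' cur then 2 * weight h cur a p b t else 0)"
      by (rule Suc.IH) (use Suc.prems in \<open>auto simp: increasing_Suc\<close>)
    consider "p t < cur" | "p t = cur" | "cur < p t" by linarith
    then show ?case
    proof cases
      case 1
      then have "demand cur p b t = 2"
        using Suc.prems by (intro demand_unmet) (auto simp: increasing_Suc)
      then show ?thesis using 1 IH h'[OF 1] by (auto simp: Let_def)
    next
      case 2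
      then have "demand cur p b t = 2"
        using Suc.prems by (intro demand_unmet) (auto simp: increasing_Suc)
      then show ?thesis using 2 IH b assms(2) by (auto simp: Let_def)
    next
      case 3
      then show ?thesis using IH by (auto simp: Let_def)
    qed
  qed simp
qed (simp add: weight_not_increasing)

lemma weight_initial: "increasing p t \<Longrightarrow> weight h 0 a p b t = a"
  by (induction t) (auto simp: increasing_Suc Let_def)

lemma weight_final:
  assumes "\<And>j. j < t \<Longrightarrow> p j < cur" "increasing p t"
  shows "weight h cur a p b t = (if \<forall>j<t. h (p j) = b j then 2 ^ t * a else 0)"
  using assms by (induction t) (auto simp: increasing_Suc Let_def less_Suc_eq)

lemma weight_le: "weight h cur a p b t \<le> 2 ^ t * a"
  by (induction t) (auto simp: Let_def)

text \<open>Patterns with \<open>t\<close> positions below \<open>m\<close> are coded by \<open>t\<close> digits to the base \<open>2 * m\<close>.\<close>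

definition pat_pos :: "nat \<Rightarrow> nat \<Rightarrow> nat \<Rightarrow> nat" where
  "pat_pos m c j = c div (2 * m) ^ j mod (2 * m) div 2"

definition pat_bit :: "nat \<Rightarrow> nat \<Rightarrow> nat \<Rightarrow> nat" where
  "pat_bit m c j = c div (2 * m) ^ j mod (2 * m) mod 2"

definition pat_weight :: "nat \<Rightarrow> nat \<Rightarrow> (nat \<Rightarrow> nat) \<Rightarrow> (nat \<Rightarrow> nat) \<Rightarrow> nat \<Rightarrow> nat \<Rightarrow> nat" where
  "pat_weight m t al h cur c = weight h cur (al c) (pat_pos m c) (pat_bit m c) t"

definition pat_demand :: "nat \<Rightarrow> nat \<Rightarrow> nat \<Rightarrow> nat \<Rightarrow> nat" where
  "pat_demand m t cur c = demand cur (pat_pos m c) (pat_bit m c) t"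

definition ballot :: "nat \<Rightarrow> nat \<Rightarrow> (nat \<Rightarrow> nat) \<Rightarrow> (nat \<Rightarrow> nat) \<Rightarrow> nat \<Rightarrow> nat \<Rightarrow> nat \<Rightarrow> nat" where
  "ballot m t al h cur q v =
     (\<Sum>c<q. if pat_demand m t cur c = v then pat_weight m t al h cur c else 0)"

text \<open>The zero function at the start mirrors blank memory; \<open>weight\<close> inspects only
  positions below \<open>cur\<close>, so later cells have no influence.\<close>

primrec greedy :: "nat \<Rightarrow> nat \<Rightarrow> (nat \<Rightarrow> nat) \<Rightarrow> nat \<Rightarrow> nat \<Rightarrow> nat" where
  "greedy m t al 0 = (\<lambda>_. 0)"
| "greedy m t al (Suc cur) = (greedy m t al cur)(cur := of_bool
     (ballot m t al (greedy m t al cur) cur ((2 * m) ^ t) 0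
      < ballot m t al (greedy m t al cur) cur ((2 * m) ^ t) 1))"

text \<open>The values 0 and 1 are at once the flag of a pattern not yet met and its initial
  weight.\<close>

primrec alive :: "nat \<Rightarrow> nat \<Rightarrow> nat \<Rightarrow> nat \<Rightarrow> nat" where
  "alive m t 0 = (\<lambda>_. 1)"
| "alive m t (Suc g) = (\<lambda>c. if pat_weight m t (alive m t g) (greedy m t (alive m t g) m) m c = 0
     then alive m t g c else 0)"

definition family :: "nat \<Rightarrow> nat \<Rightarrow> nat \<Rightarrow> nat \<Rightarrow> nat" where
  "family m t g = greedy m t (alive m t g) m"

lemma pat_bit_less: "pat_bit m c j < 2"
  by (simp add: pat_bit_def)

lemma pat_pos_less: "0 < m \<Longrightarrow> pat_pos m c j < m"
  by (simp add: pat_pos_def less_mult_imp_div_less mult.commute)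

lemma alive_le: "alive m t g c \<le> 1"
  by (induction g) auto

lemma demand_cases: "(\<And>j. j < t \<Longrightarrow> b j < 2) \<Longrightarrow> demand cur p b t \<in> {0, 1, 2}"
proof (induction t)
  case (Suc t)
  moreover have "b t = 0 \<or> b t = 1" using Suc.prems[of t] by auto
  ultimately show ?case by auto
qed simp

text \<open>Patterns without a demand keep their weight, and the two ballots are replaced by twice
  the larger one.\<close>

lemma sum_weight_greedy_mono:
  defines "\<Phi> \<equiv> \<lambda>m t al cur. \<Sum>c<(2 * m) ^ t. pat_weight m t al (greedy m t al cur) cur c"
  shows "\<Phi> m t al cur \<le> \<Phi> m t al (Suc cur)"
proof -
  let ?h = "greedy m t al cur" and ?q = "(2 * m) ^ t"
  let ?S = "ballot m t al ?h cur ?q"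
  define v :: nat where "v = of_bool (?S 0 < ?S 1)"
  have v: "v < 2" "?S 0 \<le> ?S v" "?S 1 \<le> ?S v" by (auto simp: v_def)
  have d: "pat_demand m t cur c \<in> {0, 1, 2}" for c
    unfolding pat_demand_def by (rule demand_cases) (rule pat_bit_less)
  have "\<Phi> m t al cur = ?S 2 + ?S 0 + ?S 1"
    unfolding \<Phi>_def ballot_def sum.distrib[symmetric]
  proof (intro sum.cong refl)
    fix c
    show "pat_weight m t al ?h cur c =
      (if pat_demand m t cur c = 2 then pat_weight m t al ?h cur c else 0) +
      (if pat_demand m t cur c = 0 then pat_weight m t al ?h cur c else 0) +
      (if pat_demand m t cur c = 1 then pat_weight m t al ?h cur c else 0)"
      using d[of c] by auto
  qed
  also have "\<dots> \<le> ?S 2 + 2 * ?S v" using v by simp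
  also have "\<dots> = (\<Sum>c<?q. pat_weight m t al (?h(cur := v)) (Suc cur) c)"
    unfolding ballot_def sum_distrib_left sum.distrib[symmetric] pat_weight_def pat_demand_def
    using v(1) by (intro sum.cong refl, subst weight_step[where h = ?h]) (auto simp: pat_bit_less)
  also have "\<dots> = \<Phi> m t al (Suc cur)"
    unfolding \<Phi>_def by (simp add: v_def)
  finally show ?thesis .
qed

definition uncovered :: "nat \<Rightarrow> nat \<Rightarrow> nat \<Rightarrow> nat set" where
  "uncovered m t g = {c. c < (2 * m) ^ t \<and> increasing (pat_pos m c) t \<and> alive m t g c \<noteq> 0}"

lemma alive_eq_1: "alive m t g c \<noteq> 0 \<Longrightarrow> alive m t g c = 1"
  using alive_le[of m t g c] by simp

text \<open>The total weight starts as the number of unmet patterns and ends as 2^t times the number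
  of newly met ones. As it never decreases, each function meets at least a fraction 2^-t of what is
  left.\<close>

lemma card_uncovered_step:
  assumes "0 < m"
  shows "card (uncovered m t g) \<le> 2 ^ t * (card (uncovered m t g) - card (uncovered m t (Suc g)))"
    and "uncovered m t (Suc g) \<subseteq> uncovered m t g"
proof -
  let ?al = "alive m t g" and ?q = "(2 * m) ^ t"
  let ?\<Phi> = "\<lambda>cur. \<Sum>c<?q. pat_weight m t ?al (greedy m t ?al cur) cur c"
  show sub: "uncovered m t (Suc g) \<subseteq> uncovered m t g"
    by (auto simp: uncovered_def split: if_splits)
  have "?\<Phi> 0 \<le> ?\<Phi> m"
    using lift_Suc_mono_le[of ?\<Phi> 0 m] sum_weight_greedy_mono by blast
  moreover have "?\<Phi> 0 = card (uncovered m t g)"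
  proof -
    have "?\<Phi> 0 = (\<Sum>c<?q. if c \<in> uncovered m t g then 1 else 0)"
    proof (intro sum.cong refl)
      fix c assume "c \<in> {..<?q}"
      then show "pat_weight m t ?al (greedy m t ?al 0) 0 c = (if c \<in> uncovered m t g then 1 else 0)"
        using alive_eq_1[of m t g c] unfolding pat_weight_def uncovered_def
        by (cases "increasing (pat_pos m c) t") (auto simp: weight_initial weight_not_increasing)
    qed
    also have "\<dots> = card (uncovered m t g)"
      by (subst sum.If_cases) (auto simp: uncovered_def intro!: arg_cong[where f = card])
    finally show ?thesis .
  qed
  moreover have "?\<Phi> m = (\<Sum>c<?q. if c \<in> uncovered m t g - uncovered m t (Suc g) then 2 ^ t else 0)"
  proof (intro sum.cong refl)
    fix c assume "c \<in> {..<?q}"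
    then show "pat_weight m t ?al (greedy m t ?al m) m c =
        (if c \<in> uncovered m t g - uncovered m t (Suc g) then 2 ^ t else 0)"
      using alive_eq_1[of m t g c] pat_pos_less[OF assms, of c] unfolding pat_weight_def uncovered_def
      by (cases "increasing (pat_pos m c) t")
         (auto simp: weight_final weight_not_increasing pat_weight_def)
  qed
  moreover have "\<dots> = 2 ^ t * card (uncovered m t g - uncovered m t (Suc g))"
    by (subst sum.If_cases) (auto simp: uncovered_def intro!: arg_cong[where f = card])
  moreover have "card (uncovered m t g - uncovered m t (Suc g)) =
      card (uncovered m t g) - card (uncovered m t (Suc g))"
    using sub by (intro card_Diff_subset) (auto simp: uncovered_def)
  ultimately show "card (uncovered m t g) \<le> 2 ^ t * (card (uncovered m t g) - card (uncovered m t (Suc g)))"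
    by simp
qed

text \<open>Within 2^t rounds the number shrinks by (1 - 2^-t)^(2^t) \<le> 1/e \<le> 1/2. After
  \<open>2 ^ t * B\<close> rounds it is at most 2^-B (2m)^t < 1, hence 0.\<close>

lemma uncovered_empty:
  assumes "0 < m" "(2 * m) ^ t < 2 ^ B"
  shows "uncovered m t (2 ^ t * B) = {}"
proof -
  let ?u = "\<lambda>g. real (card (uncovered m t g))"
  define T :: real where "T = 2 ^ t"
  have T: "1 \<le> T" by (simp add: T_def)
  have fin: "finite (uncovered m t g)" for g by (simp add: uncovered_def)
  have step: "?u (Suc g) \<le> (1 - 1 / T) * ?u g" for g
  proof -
    have le: "card (uncovered m t (Suc g)) \<le> card (uncovered m t g)"
      using card_uncovered_step(2)[OF assms(1)] fin by (rule card_mono[rotated])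
    have "?u g \<le> T * (?u g - ?u (Suc g))"
      using card_uncovered_step(1)[OF assms(1), of t g] le unfolding T_def
      by (metis of_nat_diff of_nat_le_iff of_nat_mult of_nat_numeral of_nat_power)
    then show ?thesis using T by (simp add: field_simps)
  qed
  have "?u g \<le> (1 - 1 / T) ^ g * ?u 0" for g
  proof (induction g)
    case (Suc g)
    have "?u (Suc g) \<le> (1 - 1 / T) * ((1 - 1 / T) ^ g * ?u 0)"
      using step[of g] mult_left_mono[OF Suc, of "1 - 1 / T"] T by simp
    then show ?case by simp
  qed simp
  then have "?u (2 ^ t * B) \<le> (1 - 1 / T) ^ (2 ^ t * B) * ?u 0" .
  also have "\<dots> \<le> (1 / 2) ^ B * ?u 0"
  proof -
    have "(1 - 1 / T) ^ (2 ^ t) \<le> exp (- 1 / T) ^ (2 ^ t)"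
      using T exp_ge_add_one_self[of "- 1 / T"] by (intro power_mono) auto
    also have "\<dots> = exp (- 1)"
      using T by (simp add: exp_of_nat_mult[symmetric] T_def)
    also have "\<dots> \<le> 1 / 2"
      using exp_ge_add_one_self[of 1] by (simp add: exp_minus field_simps)
    finally show ?thesis
      using T by (simp add: power_mult power_mono mult_right_mono)
  qed
  also have "\<dots> \<le> (1 / 2) ^ B * real ((2 * m) ^ t)"
  proof -
    have "card (uncovered m t 0) \<le> card {..<(2 * m) ^ t}"
      by (rule card_mono) (auto simp: uncovered_def)
    then have "?u 0 \<le> real ((2 * m) ^ t)" by (simp only: card_lessThan of_nat_le_iff)
    then show ?thesis by (rule mult_left_mono) simp
  qed
  also have "\<dots> < 1"
  proof -
    have "(1 / 2) ^ B * x < 1" if "x < 2 ^ B" for x :: real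
      using that by (simp add: power_divide)
    moreover have "real ((2 * m) ^ t) < 2 ^ B"
      using assms(2) by (metis of_nat_less_iff of_nat_numeral of_nat_power)
    ultimately show ?thesis .
  qed
  finally show ?thesis using fin by simp
qed

theorem family_universal:
  assumes m: "0 < m" "(2 * m) ^ t < 2 ^ B" "t \<le> m"
    and Z: "Z \<subseteq> {..<m}" "card Z \<le> t" and \<pi>: "\<And>x. \<pi> x < 2"
  shows "\<exists>g < 2 ^ t * B. \<forall>x\<in>Z. family m t g x = \<pi> x"
proof -
  \<comment> \<open>A pattern has exactly \<open>t\<close> positions, so \<open>Z\<close> is padded;
    \<open>t \<le> m\<close> leaves the room for it.\<close>
  obtain Z' where Z': "Z \<subseteq> Z'" "Z' \<subseteq> {..<m}" "card Z' = t"
    using exists_subset_between[of Z t "{..<m}"] Z m(3) by auto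
  have fin: "finite Z'" using Z'(2) finite_subset by blast
  define xs where "xs = sorted_list_of_set Z'"
  have xs: "sorted_wrt (<) xs" "set xs = Z'" "length xs = t"
    using fin Z'(3) by (auto simp: xs_def)
  have xs_less: "xs ! j < m" if "j < t" for j
    using that xs Z'(2) nth_mem[of j xs] by auto
  have "2 * (xs ! j) + \<pi> (xs ! j) < 2 * m" if "j < t" for j
    using xs_less[OF that] \<pi>[of "xs ! j"] by linarith
  then obtain c where c: "c < (2 * m) ^ t"
    and dig: "\<And>j. j < t \<Longrightarrow> c div (2 * m) ^ j mod (2 * m) = 2 * (xs ! j) + \<pi> (xs ! j)"
    using exists_digits[of t "\<lambda>j. 2 * (xs ! j) + \<pi> (xs ! j)" "2 * m"] by blast
  have pos: "pat_pos m c j = xs ! j" and bit: "pat_bit m c j = \<pi> (xs ! j)" if "j < t" for j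
    using dig[OF that] \<pi>[of "xs ! j"] by (auto simp: pat_pos_def pat_bit_def)
  have inc: "increasing (pat_pos m c) t"
    unfolding increasing_def
  proof (intro allI impI)
    fix j assume "j < t"
    then show "next_pos (pat_pos m c) j \<le> pat_pos m c j"
      using pos xs by (cases j) (auto simp: sorted_wrt_nth_less Suc_leI)
  qed
  have "alive m t (2 ^ t * B) c = 0"
    using uncovered_empty[OF m(1,2)] c inc by (auto simp: uncovered_def)
  moreover have "\<exists>g<G. pat_weight m t (alive m t g) (family m t g) m c \<noteq> 0"
    if "alive m t G c = 0" for G
    using that by (induction G) (auto simp: family_def less_Suc_eq split: if_splits)
  ultimately obtain g where g: "g < 2 ^ t * B" "pat_weight m t (alive m t g) (family m t g) m c \<noteq> 0"
    by blast
  then have "\<forall>j<t. family m t g (pat_pos m c j) = pat_bit m c j"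
    using weight_final[OF pat_pos_less[OF m(1)] inc] by (auto simp: pat_weight_def split: if_splits)
  then have "\<forall>j<t. family m t g (xs ! j) = \<pi> (xs ! j)"
    using pos bit by simp
  then have "\<forall>x\<in>Z'. family m t g x = \<pi> x"
    using xs by (metis in_set_conv_nth)
  then show ?thesis using g(1) Z'(1) by blast
qed

section \<open>The automaton\<close>

text \<open>Independent of how the families are found: \<open>D\<close> is the number of levels,
  \<open>l\<close> the number of intervals of a splitting, \<open>U d g\<close> the g-th function
  for level \<open>d\<close>, and \<open>W d\<close> the number of values of one digit, which codes
  a threshold and a function.\<close>

locale split_nfa =
  fixes n k m D l :: nat and W :: "nat \<Rightarrow> nat" and U :: "nat \<Rightarrow> nat \<Rightarrow> nat \<Rightarrow> nat"
  assumes k_pos: "1 \<le> k" and k_less: "k < 2 ^ D" and m_pos: "0 < m" and W_pos: "\<And>d. 0 < W d"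
begin

text \<open>At level \<open>d\<close> the positions are divided into nearly equal consecutive nodes, the left and right
  halves of which are told apart by \<open>half\<close>.\<close>

definition node :: "nat \<Rightarrow> nat \<Rightarrow> nat" where
  "node d i = i * 2 ^ d div k"

definition half :: "nat \<Rightarrow> nat \<Rightarrow> nat" where
  "half d i = i * 2 ^ Suc d div k mod 2"

text \<open>Arithmetic form of "a node of level \<open>d\<close> begins at \<open>i\<close>". It
  also makes sense at 0, which has no predecessor, and at the end \<open>k\<close>; both start every
  level.\<close>

definition starts :: "nat \<Rightarrow> nat \<Rightarrow> bool" where
  "starts d i \<longleftrightarrow> i * 2 ^ d mod k < 2 ^ d"

lemma node_Suc: "node (Suc d) i div 2 = node d i"
proof -
  have "i * 2 ^ Suc d div k div 2 = (2 * (i * 2 ^ d)) div (2 * k)"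
    by (simp add: div_mult2_eq[symmetric] mult_ac)
  then show ?thesis by (simp add: node_def)
qed

text \<open>Adding \<open>2 ^ d\<close> changes the quotient by \<open>k\<close> exactly if the new
  remainder is below \<open>2 ^ d\<close>; this includes increments that exceed
  \<open>k\<close>.\<close>

lemma starts_Suc_iff: "starts d (Suc i) \<longleftrightarrow> node d (Suc i) \<noteq> node d i"
proof -
  define u where "u = Suc i * 2 ^ d"
  have u: "i * 2 ^ d = u - 2 ^ d" "2 ^ d \<le> u" by (auto simp: u_def)
  have u_eq: "u = k * (u div k) + u mod k" by simp
  show ?thesis
  proof (cases "u mod k < 2 ^ d")
    case True
    have "(u - 2 ^ d) div k < u div k"
    proof (rule ccontr)
      assume "\<not> ?thesis"
      then have "k * (u div k) \<le> k * ((u - 2 ^ d) div k)" by simp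
      also have "\<dots> \<le> u - 2 ^ d" by simp
      finally show False using True u(2) u_eq by linarith
    qed
    then show ?thesis using True unfolding starts_def node_def u_def[symmetric] u(1) by simp
  next
    case False
    then have eq: "u - 2 ^ d = k * (u div k) + (u mod k - 2 ^ d)" using u_eq by linarith
    have "(k * a + b) div k = a" if "b < k" for a b using that by simp
    moreover have "u mod k - 2 ^ d < k" using k_pos by (simp add: less_imp_diff_less)
    ultimately have "(u - 2 ^ d) div k = u div k" unfolding eq by blast
    then show ?thesis using False unfolding starts_def node_def u_def[symmetric] u(1) by simp
  qed
qed

text \<open>Doubling a remainder and reducing it modulo \<open>k\<close> keeps it below the doubled
  bound. So the levels starting at a position are all those from some level on, and what must be
  guessed anew is a final segment of the digits.\<close>

lemma starts_mono: "starts d i \<Longrightarrow> d \<le> d' \<Longrightarrow> starts d' i"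
proof (induction d')
  case (Suc d')
  show ?case
  proof (cases "d = Suc d'")
    case False
    then have "i * 2 ^ d' mod k < 2 ^ d'" using Suc by (auto simp: starts_def)
    moreover have "i * 2 ^ Suc d' mod k = 2 * (i * 2 ^ d' mod k) mod k"
      by (simp add: mod_mult_right_eq mult.left_commute)
    ultimately show ?thesis
      by (auto simp: starts_def intro: le_less_trans[OF mod_less_eq_dividend])
  qed (use Suc in simp)
qed simp

lemma starts_D: "starts D i"
  unfolding starts_def using k_pos k_less by (auto intro: less_trans[OF mod_less_divisor])

lemma starts_0: "starts d 0" and starts_k: "starts d k"
  by (auto simp: starts_def)

text \<open>As \<open>k < 2 ^ D\<close>, distinct positions have distinct nodes on level
  \<open>D\<close>; the level just before the nodes first differ separates the positions by their
  halves.\<close>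

lemma exists_separating_level:
  assumes "i < j" "j < k"
  obtains d where "d < D" "node d i = node d j" "half d i \<noteq> half d j"
proof -
  have "node D i \<noteq> node D j"
  proof -
    have "i * 2 ^ D + k \<le> j * 2 ^ D"
      using assms(1) k_less mult_le_mono1[of "Suc i" j "2 ^ D"] by simp
    then have "node D i + 1 \<le> node D j"
      unfolding node_def using k_pos div_le_mono[of "i * 2 ^ D + k" "j * 2 ^ D" k] by simp
    then show ?thesis by simp
  qed
  then have *: "\<exists>d. node d i \<noteq> node d j" by blast
  define e where "e = (LEAST d. node d i \<noteq> node d j)"
  have e: "node e i \<noteq> node e j" unfolding e_def using * by (rule LeastI_ex)
  have "e \<noteq> 0" using e assms by (auto simp: node_def intro: ccontr)
  then obtain d where d: "e = Suc d" by (cases e) auto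
  have eq: "node d i = node d j"
    using not_less_Least[of d "\<lambda>d. node d i \<noteq> node d j"] d by (simp add: e_def)
  have "e \<le> D" unfolding e_def using \<open>node D i \<noteq> node D j\<close> by (rule Least_le)
  moreover have "half d i \<noteq> half d j"
  proof
    assume "half d i = half d j"
    then have "node e i mod 2 = node e j mod 2" by (simp add: half_def node_def d)
    moreover have "node e i div 2 = node e j div 2" using eq node_Suc d by simp
    ultimately show False using e by (metis div_mult_mod_eq)
  qed
  ultimately show ?thesis using that[of d] eq d by simp
qed

text \<open>If i * 2^d and a * 2^d have the same quotient by \<open>k\<close>, they differ by at
  most \<open>k\<close>.\<close>

lemma card_node: "card {i. i < k \<and> node d i = j} \<le> k div 2 ^ d + 1"
proof (cases "{i. i < k \<and> node d i = j} = {}")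
  case False
  define a where "a = (LEAST i. i < k \<and> node d i = j)"
  have a: "node d a = j" "\<And>i. i < k \<Longrightarrow> node d i = j \<Longrightarrow> a \<le> i"
    using False LeastI_ex[of "\<lambda>i. i < k \<and> node d i = j"] by (auto simp: a_def intro: Least_le)
  have "{i. i < k \<and> node d i = j} \<subseteq> {a..a + k div 2 ^ d}"
  proof safe
    fix i assume i: "i < k" "j = node d i"
    have "a \<le> i" using i a by simp
    have "i * 2 ^ d div k = a * 2 ^ d div k" using i(2) a(1) by (simp add: node_def)
    then have "i * 2 ^ d = k * (a * 2 ^ d div k) + i * 2 ^ d mod k" by (metis mult_div_mod_eq)
    moreover have "k * (a * 2 ^ d div k) \<le> a * 2 ^ d" by simp
    moreover have "i * 2 ^ d mod k < k" using k_pos by simp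
    ultimately have "i * 2 ^ d < a * 2 ^ d + k" by linarith
    then have "(i - a) * 2 ^ d \<le> k" by (simp add: diff_mult_distrib)
    then have "i - a \<le> k div 2 ^ d" by (simp add: less_eq_div_iff_mult_less_eq)
    then show "i \<in> {a..a + k div 2 ^ d}" using \<open>a \<le> i\<close> by simp
  qed
  then have "card {i. i < k \<and> node d i = j} \<le> card {a..a + k div 2 ^ d}"
    by (intro card_mono) auto
  then show ?thesis by simp
qed (simp only: card.empty)

definition P :: "nat \<Rightarrow> nat" where
  "P d = (\<Prod>e\<in>{d..<D}. W e ^ l)"

definition A :: nat where
  "A = P 0 * m"

text \<open>A state \<open>i * A + y\<close> stands for the position \<open>i\<close> together with the data \<open>y\<close>: a modulus and, for
  each level, the code of a splitting for the current node, the deeper levels in the lower digits.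
  The data below \<open>block i\<close> are discarded and guessed anew at position \<open>i\<close>.\<close>

definition block :: "nat \<Rightarrow> nat" where
  "block i = (let d = (LEAST d. starts d i) in if d = 0 then A else P d)"

definition colour :: "nat \<Rightarrow> nat \<Rightarrow> nat" where
  "colour y a = a mod (y div P 0 + 1)"

text \<open>The highest digit with threshold \<open>z mod (2 * m) \<le> x\<close> decides, so the
  thresholds cut the colours into intervals with one function \<open>z div (2 * m)\<close> each. The
  base \<open>2 * m\<close> leaves room for the threshold \<open>m\<close>, which makes an interval
  empty.\<close>

primrec lookup :: "nat \<Rightarrow> nat \<Rightarrow> nat \<Rightarrow> nat \<Rightarrow> nat" where
  "lookup d f x 0 = 0"
| "lookup d f x (Suc b) =
     (let z = f div W d ^ b mod W d in
      if z mod (2 * m) \<le> x then U d (z div (2 * m)) x else lookup d f x b)"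

definition allowed :: "nat \<Rightarrow> nat \<Rightarrow> nat \<Rightarrow> bool" where
  "allowed i y a \<longleftrightarrow> (\<forall>d<D. lookup d (y div P (Suc d)) (colour y a) l = half d i)"

text \<open>One position further, with all digits below the new block reset to 0.\<close>

definition next_state :: "nat \<Rightarrow> nat" where
  "next_state q = q + A - q mod block (Suc (q div A))"

text \<open>Guessing is counting: from the reset digits, epsilon edges count up to the guess, so a
  state has at most one epsilon edge rather than one per possible guess. The side condition stops
  the count before it carries into digits that must be kept.\<close>

definition trans :: "(nat \<times> nat option \<times> nat) set" where
  "trans = {(q, None, Suc q) | q. q < k * A \<and> Suc q mod block (q div A) \<noteq> 0} \<union>
     {(q, Some a, next_state q) | q a. q < k * A \<and> a \<in> {1..n} \<and> allowed (q div A) (q mod A) a}"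

definition machine :: "(nat, nat) nfa" where
  "machine = \<lparr>states = {..<k * A + 1}, start_state = 0, accepting = {k * A}, transitions = trans\<rparr>"

section \<open>Arithmetic of states and blocks\<close>

lemma P_pos: "0 < P d" by (simp add: P_def W_pos prod_pos)
lemma A_pos: "0 < A" by (simp add: A_def P_pos m_pos)
lemma P_D: "P D = 1" by (simp add: P_def)
lemma P_Suc: "d < D \<Longrightarrow> P d = W d ^ l * P (Suc d)"
  unfolding P_def by (simp add: prod.atLeast_Suc_lessThan)

lemma P_dvd: "d \<le> e \<Longrightarrow> e \<le> D \<Longrightarrow> P e dvd P d"
proof (induction e)
  case (Suc e)
  then show ?case
    by (cases "d = Suc e") (auto simp: P_Suc intro: dvd_trans[of _ "P e"])
qed simp

lemma P_dvd_A: "d \<le> D \<Longrightarrow> P d dvd A"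
  using P_dvd[of 0 d] by (auto simp: A_def)

lemma Least_starts: "starts (LEAST d. starts d i) i" "(LEAST d. starts d i) \<le> D"
  using LeastI[of "\<lambda>d. starts d i" D] Least_le[of "\<lambda>d. starts d i" D] starts_D by blast+

lemma block_dvd_A: "block i dvd A"
  unfolding block_def using Least_starts[of i] P_dvd_A by (simp add: Let_def)

lemma block_pos: "0 < block i"
  using A_pos P_pos by (simp add: block_def Let_def)

text \<open>The least level starting at \<open>i\<close> is then deeper than \<open>d\<close>, so
  the digits guessed anew lie below those of the levels up to \<open>d\<close>.\<close>

lemma block_dvd_P: "\<not> starts d i \<Longrightarrow> block i dvd P (Suc d)"
  unfolding block_def using Least_starts[of i] starts_mono[of 0 i d] starts_mono[of "LEAST d. starts d i" i d]
  by (cases "Suc d \<le> (LEAST d. starts d i)") (auto simp: Let_def not_less_eq_eq intro!: P_dvd)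

text \<open>Level 0 starts at both ends, where the block also covers the modulus: it is guessed at
  position 0, and the last letter resets everything, which makes \<open>k * A\<close> the only final
  state.\<close>

lemma block_0: "block 0 = A" and block_k: "block k = A"
  by (auto simp: block_def Least_eq_0 starts_0 starts_k)

text \<open>The modulus and the guesses of the levels up to \<open>d\<close>: all that
  \<open>allowed\<close> consults on level \<open>d\<close>.\<close>

definition prefix :: "nat \<Rightarrow> nat \<Rightarrow> nat" where
  "prefix d q = q mod A div P (Suc d)"

text \<open>One statement for both kinds of edges: \<open>r = 0\<close> for epsilon,
  \<open>r = 1\<close> for a letter.\<close>

lemma prefix_eqI:
  assumes "d < D" "\<not> starts d i" "q div block i = (q' + r * A) div block i"
  shows "prefix d q = prefix d q'"
proof -
  obtain c where c: "P (Suc d) = block i * c" using block_dvd_P[OF assms(2)] by blast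
  obtain e where e: "A = P (Suc d) * e" using P_dvd_A[of "Suc d"] assms(1) by auto
  have "x mod A div P (Suc d) = x div P (Suc d) mod e" for x
    unfolding e using P_pos[of "Suc d"] by (simp add: mod_mult2_eq)
  moreover have "q div P (Suc d) = (q' + r * A) div P (Suc d)"
    unfolding c div_mult2_eq assms(3) ..
  moreover have "(q' + r * A) div P (Suc d) = q' div P (Suc d) + r * e"
    using P_pos[of "Suc d"] by (simp add: e mult.left_commute[of r])
  ultimately show ?thesis by (simp add: prefix_def)
qed

lemma next_state_div:
  "next_state q div block (Suc (q div A)) = (q + A) div block (Suc (q div A))"
  "next_state q div A = Suc (q div A)"
proof -
  define b where "b = block (Suc (q div A))"
  obtain c where c: "A = b * c" using block_dvd_A b_def by blast
  have "q mod b = (q + A) mod b" unfolding c by simp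
  then have "next_state q = (q + A) div b * b"
    unfolding next_state_def b_def[symmetric] by (simp only: minus_mod_eq_div_mult)
  then have *: "next_state q div b = (q + A) div b"
    using block_pos[of "Suc (q div A)"] by (simp add: b_def)
  then show "next_state q div block (Suc (q div A)) = (q + A) div block (Suc (q div A))"
    by (simp add: b_def)
  have "next_state q div A = next_state q div b div c" unfolding c by (rule div_mult2_eq)
  also have "\<dots> = (q + A) div A" unfolding * div_mult2_eq[symmetric] c[symmetric] ..
  finally show "next_state q div A = Suc (q div A)" using A_pos by simp
qed

lemma Suc_div_eq: "Suc q mod b \<noteq> 0 \<Longrightarrow> Suc q div b = q div b"
  by (simp add: div_Suc)

lemma eps_div:
  assumes "Suc q mod block (q div A) \<noteq> 0"
  shows "Suc q div A = q div A"
proof -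
  have "Suc q mod A \<noteq> 0" using assms block_dvd_A[of "q div A"] by (meson dvd_trans mod_0_imp_dvd mod_greater_zero_iff_not_dvd not_gr0)
  then show ?thesis by (rule Suc_div_eq)
qed

lemma trans_less: "(q, x, q') \<in> trans \<Longrightarrow> q < q'"
proof -
  assume "(q, x, q') \<in> trans"
  moreover have "q < next_state q"
  proof -
    have "q mod block (Suc (q div A)) < block (Suc (q div A))" using block_pos by simp
    also have "\<dots> \<le> A" using block_dvd_A A_pos by (rule dvd_imp_le)
    finally show ?thesis by (simp add: next_state_def)
  qed
  ultimately show ?thesis by (auto simp: trans_def)
qed

lemma next_state_le:
  assumes "q < k * A"
  shows "next_state q \<le> k * A"
proof (cases "Suc (q div A) = k")
  case True
  then have "next_state q = q + A - q mod A" by (simp add: next_state_def block_k)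
  also have "\<dots> = q div A * A + A" by (metis Nat.add_diff_assoc2 minus_mod_eq_div_mult mod_less_eq_dividend)
  also have "\<dots> = Suc (q div A) * A" by simp
  finally show ?thesis using True by simp
next
  case False
  moreover have "q div A < k" using assms A_pos by (simp add: less_mult_imp_div_less)
  ultimately have "next_state q div A < k" using next_state_div(2)[of q] by simp
  then show ?thesis using A_pos by (metis div_less_iff_less_mult less_imp_le)
qed

lemma trans_le: "(q, x, q') \<in> trans \<Longrightarrow> q < k * A \<and> q' \<le> k * A"
  using next_state_le by (auto simp: trans_def)

section \<open>Well-formedness, acyclicity and soundness\<close>

lemma machine_over: "nfa_over {1..n} machine"
proof -
  have sub: "trans \<subseteq> {..<k * A + 1} \<times> insert None (Some ` {1..n}) \<times> {..<k * A + 1}"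
  proof
    fix e assume e: "e \<in> trans"
    obtain q x q' where [simp]: "e = (q, x, q')" by (cases e)
    have "x \<in> insert None (Some ` {1..n})" using e by (auto simp: trans_def)
    then show "e \<in> {..<k * A + 1} \<times> insert None (Some ` {1..n}) \<times> {..<k * A + 1}"
      using trans_le[of q x q'] e by auto
  qed
  moreover have "finite trans" using sub by (rule finite_subset) auto
  ultimately show ?thesis by (auto simp: nfa_over_def machine_def)
qed

lemma machine_acyclic: "nfa_acyclic machine"
proof -
  have "{(p, q). \<exists>x. (p, x, q) \<in> transitions machine} \<subseteq> less_than"
    using trans_less by (auto simp: machine_def)
  then show ?thesis unfolding nfa_acyclic_def
    by (rule acyclic_subset[rotated]) (simp add: wf_acyclic)
qed

text \<open>\<open>s j\<close> is the state in which the j-th letter is read. The clause relating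
  \<open>s j\<close> to \<open>q\<close> lets the induction prepend a letter to the clause about
  pairs \<open>s j\<close>, \<open>s j'\<close>. Its range includes the position of \<open>q\<close>
  itself, where epsilon edges may still change digits; between two reading states only the later
  positions matter.\<close>

lemma path_states:
  assumes "nfa_path machine q w r" "r = k * A"
  shows "length w = k - q div A \<and> set w \<subseteq> {1..n} \<and>
    (\<exists>s. (\<forall>j<length w. allowed (q div A + j) (s j mod A) (w ! j)) \<and>
      (\<forall>d<D. \<forall>j<length w. (\<forall>i. q div A \<le> i \<and> i \<le> q div A + j \<longrightarrow> \<not> starts d i) \<longrightarrow>
         prefix d (s j) = prefix d q) \<and>
      (\<forall>d<D. \<forall>j j'. j \<le> j' \<and> j' < length w \<and>
         (\<forall>i. q div A + j < i \<and> i \<le> q div A + j' \<longrightarrow> \<not> starts d i) \<longrightarrow> prefix d (s j) = prefix d (s j')))"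
  using assms
proof (induction rule: nfa_path.induct)
  case (empty p)
  then show ?case using A_pos by simp
next
  case (epsilon p q w r)
  then have q: "q = Suc p" and b: "Suc p mod block (p div A) \<noteq> 0"
    by (auto simp: machine_def trans_def)
  have i: "q div A = p div A" using eps_div[OF b] q by simp
  have pre: "prefix d q = prefix d p" if "d < D" "\<not> starts d (p div A)" for d
    using that Suc_div_eq[OF b] q by (intro prefix_eqI[of _ "p div A" _ _ 0]) auto
  from epsilon.IH[OF epsilon.prems] obtain s where
    len: "length w = k - p div A" "set w \<subseteq> {1..n}" and
    s1: "\<forall>j<length w. allowed (p div A + j) (s j mod A) (w ! j)" and
    s2: "\<And>d j. d < D \<Longrightarrow> j < length w \<Longrightarrow> (\<forall>i. p div A \<le> i \<and> i \<le> p div A + j \<longrightarrow> \<not> starts d i) \<Longrightarrow>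
         prefix d (s j) = prefix d q" and
    s3: "\<forall>d<D. \<forall>j j'. j \<le> j' \<and> j' < length w \<and>
         (\<forall>i. p div A + j < i \<and> i \<le> p div A + j' \<longrightarrow> \<not> starts d i) \<longrightarrow> prefix d (s j) = prefix d (s j')"
    unfolding i by blast
  have "prefix d (s j) = prefix d p"
    if "d < D" "j < length w" "\<forall>i. p div A \<le> i \<and> i \<le> p div A + j \<longrightarrow> \<not> starts d i" for d j
    using s2[OF that] pre[of d] that by simp
  then show ?case using len s1 s3 by blast
next
  case (letter p a q w r)
  then have q: "q = next_state p" and p: "p < k * A" and a: "a \<in> {1..n}" "allowed (p div A) (p mod A) a"
    by (auto simp: machine_def trans_def)
  have i: "q div A = Suc (p div A)" using next_state_div q by simp
  have ik: "p div A < k" using p A_pos by (simp add: less_mult_imp_div_less)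
  have pre: "prefix d q = prefix d p" if "d < D" "\<not> starts d (Suc (p div A))" for d
    using that next_state_div(1)[of p] q by (intro prefix_eqI[of _ "Suc (p div A)" _ _ 1]) auto
  from letter.IH[OF letter.prems] obtain s where
    len: "length w = k - q div A" "set w \<subseteq> {1..n}" and
    s1: "\<forall>j<length w. allowed (q div A + j) (s j mod A) (w ! j)" and
    s2: "\<forall>d<D. \<forall>j<length w. (\<forall>i. q div A \<le> i \<and> i \<le> q div A + j \<longrightarrow> \<not> starts d i) \<longrightarrow>
         prefix d (s j) = prefix d q" and
    s3: "\<forall>d<D. \<forall>j j'. j \<le> j' \<and> j' < length w \<and>
         (\<forall>i. q div A + j < i \<and> i \<le> q div A + j' \<longrightarrow> \<not> starts d i) \<longrightarrow> prefix d (s j) = prefix d (s j')"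
    by (elim conjE exE)
  define s' where "s' = (\<lambda>j. case j of 0 \<Rightarrow> p | Suc j \<Rightarrow> s j)"
  have s'_simps [simp]: "s' 0 = p" "s' (Suc j) = s j" for j by (auto simp: s'_def)
  have fresh: "prefix d (s' j) = prefix d p"
    if "d < D" "j < length (a # w)" "\<And>i. p div A < i \<Longrightarrow> i \<le> p div A + j \<Longrightarrow> \<not> starts d i" for d j
  proof (cases j)
    case (Suc j')
    have "prefix d (s j') = prefix d q" using that Suc i by (intro s2[rule_format]) auto
    also have "\<dots> = prefix d p" using that(1) that(3)[of "Suc (p div A)"] Suc by (intro pre) auto
    finally show ?thesis using Suc by simp
  qed simp
  show ?case
  proof (intro conjI exI[of _ s'] allI impI)
    show "length (a # w) = k - p div A" using len i ik by simp
    show "set (a # w) \<subseteq> {1..n}" using len a by simp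
  next
    fix j assume "j < length (a # w)"
    then show "allowed (p div A + j) (s' j mod A) ((a # w) ! j)"
      using a(2) s1[rule_format, of "j - 1"] i by (cases j) auto
  next
    fix d j assume "d < D" "j < length (a # w)" "\<forall>i. p div A \<le> i \<and> i \<le> p div A + j \<longrightarrow> \<not> starts d i"
    then show "prefix d (s' j) = prefix d p" by (intro fresh) auto
  next
    fix d j j'
    assume *: "d < D" "j \<le> j' \<and> j' < length (a # w) \<and>
      (\<forall>i. p div A + j < i \<and> i \<le> p div A + j' \<longrightarrow> \<not> starts d i)"
    show "prefix d (s' j) = prefix d (s' j')"
    proof (cases j)
      case 0
      then show ?thesis using fresh[of d j'] * by simp
    next
      case (Suc j0)
      then obtain j1 where "j' = Suc j1" using * by (cases j') auto
      then show ?thesis using s3[rule_format, of d j0 j1] * Suc i by simp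
    qed
  qed
qed

lemma machine_sound: "nfa_lang machine \<subseteq> distinct_words k n"
proof
  fix w assume "w \<in> nfa_lang machine"
  then have "nfa_path machine 0 w (k * A)" by (simp add: nfa_lang_def machine_def)
  from path_states[OF this refl, unfolded div_0 add_0 diff_zero] obtain s where
    w: "length w = k" "set w \<subseteq> {1..n}" and
    s: "\<forall>j<length w. allowed j (s j mod A) (w ! j)" and
    pre: "\<forall>d<D. \<forall>j j'. j \<le> j' \<and> j' < length w \<and> (\<forall>i. j < i \<and> i \<le> j' \<longrightarrow> \<not> starts d i) \<longrightarrow>
      prefix d (s j) = prefix d (s j')"
    by (elim conjE exE)
  have "w ! i \<noteq> w ! j" if ij: "i < j" "j < k" for i j
  proof
    assume eq: "w ! i = w ! j"
    obtain d where d: "d < D" "node d i = node d j" "half d i \<noteq> half d j"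
      using exists_separating_level[OF ij] .
    \<comment> \<open>By monotonicity all positions from \<open>i\<close> to \<open>j\<close> lie in
      one node, so none after \<open>i\<close> starts a new one.\<close>
    have mono: "node d i \<le> node d i'" "node d i' \<le> node d j" if "i \<le> i'" "i' \<le> j" for i'
      using that by (auto simp: node_def intro!: div_le_mono)
    have "\<not> starts d i'" if i': "i < i'" "i' \<le> j" for i'
    proof -
      obtain i0 where i0: "i' = Suc i0" using i' by (cases i') auto
      show ?thesis using mono[of i'] mono[of i0] i' d(2) starts_Suc_iff[of d i0] i0 by simp
    qed
    then have p: "prefix d (s i) = prefix d (s j)" 
      using d ij w(1) by (intro pre[rule_format]) auto
    have "s i mod A div P 0 = s j mod A div P 0"
    proof -
      obtain c where "P 0 = P (Suc d) * c" using P_dvd[of 0 "Suc d"] d(1) by auto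
      then show ?thesis using p by (simp add: prefix_def div_mult2_eq)
    qed
    then have "colour (s i mod A) (w ! i) = colour (s j mod A) (w ! j)" using eq by (simp add: colour_def)
    then show False
      using s[rule_format, of i] s[rule_format, of j] ij d p w(1)
      unfolding allowed_def prefix_def by (metis order.strict_trans)
  qed
  then have "distinct w" using w(1) by (metis distinct_conv_nth linorder_neqE_nat)
  then show "w \<in> distinct_words k n" using w by (simp add: distinct_words_def)
qed

end

section \<open>Completeness: a correct choice of all guesses\<close>

context split_nfa begin

lemma lookup_cong:
  assumes "\<And>j. j < b \<Longrightarrow> f div W d ^ j mod W d = f' div W d ^ j mod W d"
  shows "lookup d f x b = lookup d f' x b"
  using assms by (induction b) (simp_all add: Let_def)

text \<open>Intervals are cut off from the top: \<open>c\<close> is the least threshold with at most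
  \<open>t\<close> elements of \<open>Z\<close> from \<open>c\<close> on. By minimality these are at
  least \<open>t\<close> elements unless \<open>c = 0\<close>, so at most \<open>b * t\<close>
  remain for the lower digits.\<close>

lemma exists_splitting:
  assumes W: "W d = 2 * m * G"
    and univ: "\<And>Z \<pi>. Z \<subseteq> {..<m} \<Longrightarrow> card Z \<le> t \<Longrightarrow> (\<And>x. \<pi> x < 2) \<Longrightarrow> \<exists>g<G. \<forall>x\<in>Z. U d g x = \<pi> x"
    and \<pi>: "\<And>x. \<pi> x < 2"
  shows "Z \<subseteq> {..<m} \<Longrightarrow> card Z \<le> b * t \<Longrightarrow> \<exists>f < W d ^ b. \<forall>x\<in>Z. lookup d f x b = \<pi> x"
proof (induction b arbitrary: Z)
  case 0
  then have "Z = {}" using finite_subset[of Z] by simp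
  then show ?case by simp
next
  case (Suc b)
  have fin: "finite Z" using Suc.prems finite_subset by blast
  have ex: "card {x\<in>Z. m \<le> x} \<le> t"
  proof -
    have "{x\<in>Z. m \<le> x} = {}" using Suc.prems by auto
    then show ?thesis by (simp only: card.empty)
  qed
  define c where "c = (LEAST c. card {x\<in>Z. c \<le> x} \<le> t)"
  have c: "card {x\<in>Z. c \<le> x} \<le> t" unfolding c_def using ex by (rule LeastI)
  have "c \<le> m" unfolding c_def using ex by (rule Least_le)
  have low: "card {x\<in>Z. x < c} \<le> b * t"
  proof (cases c)
    case 0
    then have "{x\<in>Z. x < c} = {}" by simp
    then show ?thesis by (simp only: card.empty)
  next
    case (Suc c')
    then have "\<not> card {x\<in>Z. c' \<le> x} \<le> t" unfolding c_def by (intro not_less_Least) simp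
    moreover have "card {x\<in>Z. c' \<le> x} \<le> card (insert c' {x\<in>Z. c \<le> x})"
      using fin Suc by (intro card_mono) auto
    moreover have "\<dots> \<le> Suc (card {x\<in>Z. c \<le> x})" by (rule card_insert_le_m1) simp_all
    ultimately have "t \<le> card {x\<in>Z. c \<le> x}" by simp
    moreover have "card Z = card {x\<in>Z. x < c} + card {x\<in>Z. c \<le> x}"
      using fin by (subst card_Un_disjoint[symmetric]) (auto intro!: arg_cong[where f = card])
    ultimately show ?thesis using Suc.prems(2) by simp
  qed
  obtain f where f: "f < W d ^ b" "\<And>x. x \<in> Z \<Longrightarrow> x < c \<Longrightarrow> lookup d f x b = \<pi> x"
    using Suc.IH[of "{x\<in>Z. x < c}"] Suc.prems(1) low by auto
  obtain g where g: "g < G" "\<And>x. x \<in> Z \<Longrightarrow> c \<le> x \<Longrightarrow> U d g x = \<pi> x"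
  proof -
    have "{x\<in>Z. c \<le> x} \<subseteq> {..<m}" using Suc.prems(1) by auto
    from univ[of _ \<pi>, OF this c \<pi>] obtain g where "g < G" "\<forall>x\<in>{x\<in>Z. c \<le> x}. U d g x = \<pi> x" by blast
    then show ?thesis using that[of g] by simp
  qed
  define z where "z = g * (2 * m) + c"
  have z: "z mod (2 * m) = c" "z div (2 * m) = g"
    using \<open>c \<le> m\<close> m_pos by (simp_all add: z_def)
  have "z < W d"
  proof -
    have "z < g * (2 * m) + 2 * m" using \<open>c \<le> m\<close> m_pos by (simp add: z_def)
    also have "\<dots> = Suc g * (2 * m)" by simp
    also have "\<dots> \<le> G * (2 * m)" using g(1) by (intro mult_le_mono1) simp
    finally show ?thesis by (simp add: W mult.commute)
  qed
  then have "\<exists>f' < W d ^ Suc b. \<forall>j<Suc b. f' div W d ^ j mod W d = (if j < b then f div W d ^ j mod W d else z)"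
    using W_pos by (intro exists_digits) simp
  then obtain f' where f': "f' < W d ^ Suc b"
    "\<And>j. j < b \<Longrightarrow> f' div W d ^ j mod W d = f div W d ^ j mod W d" "f' div W d ^ b mod W d = z"
    by (metis less_Suc_eq less_irrefl)
  have "lookup d f' x (Suc b) = \<pi> x" if "x \<in> Z" for x
    using f(2)[OF that] g(2)[OF that] lookup_cong[OF f'(2), of b x] z f'(3) by (simp add: Let_def)
  then show ?case using f'(1) by blast
qed

text \<open>A Horner scheme. Since \<open>i\<close> enters only through its nodes, positions in a
  common node share the leading digits.\<close>

primrec guess :: "nat \<Rightarrow> (nat \<Rightarrow> nat \<Rightarrow> nat) \<Rightarrow> nat \<Rightarrow> nat \<Rightarrow> nat" where
  "guess p f i 0 = p"
| "guess p f i (Suc d) = guess p f i d * W d ^ l + f d (node d i)"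

lemma guess_div:
  assumes f: "\<And>d j. d < D \<Longrightarrow> f d j < W d ^ l"
  shows "d \<le> D \<Longrightarrow> guess p f i D div P d = guess p f i d"
proof (induction "D - d" arbitrary: d)
  case 0
  then have "d = D" by simp
  then show ?case by (simp only: P_D div_by_1)
next
  case (Suc r)
  then have d: "d < D" by simp
  have "guess p f i D div P d = guess p f i D div P (Suc d) div W d ^ l"
    unfolding P_Suc[OF d] mult.commute[of "W d ^ l"] div_mult2_eq ..
  also have "\<dots> = guess p f i (Suc d) div W d ^ l" using Suc d by simp
  also have "\<dots> = guess p f i d"
    using f[OF d, of "node d i"] W_pos[of d] by (simp add: add.commute)
  finally show ?case .
qed

lemma guess_less:
  assumes f: "\<And>d j. d < D \<Longrightarrow> f d j < W d ^ l" and p: "p < m"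
  shows "guess p f i D < A"
proof -
  have "guess p f i D div P 0 < m" using guess_div[OF f, of 0] p by simp
  then show ?thesis using P_pos[of 0] by (simp add: A_def div_less_iff_less_mult mult.commute)
qed

lemma lookup_guess:
  assumes f: "\<And>d j. d < D \<Longrightarrow> f d j < W d ^ l" and d: "d < D"
  shows "lookup d (guess p f i D div P (Suc d)) x l = lookup d (f d (node d i)) x l"
proof (rule lookup_cong)
  fix j assume j: "j < l"
  have "W d ^ l = W d ^ j * (W d * W d ^ (l - Suc j))"
    using j by (metis Suc_diff_Suc add_diff_inverse_nat not_less_iff_gr_or_eq power_Suc power_add)
  then have "guess p f i (Suc d) div W d ^ j = W d * (guess p f i d * W d ^ (l - Suc j)) + f d (node d i) div W d ^ j"
  proof -
    have eq: "guess p f i d * W d ^ l = W d ^ j * (W d * (guess p f i d * W d ^ (l - Suc j)))"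
      unfolding \<open>W d ^ l = _\<close> by (simp only: mult_ac)
    show ?thesis unfolding guess.simps eq using W_pos[of d] by simp
  qed
  then show "guess p f i D div P (Suc d) div W d ^ j mod W d = f d (node d i) div W d ^ j mod W d"
    using guess_div[OF f, of "Suc d"] d by simp
qed

text \<open>Above the first level that starts at \<open>Suc i\<close> both positions have the same
  nodes; all other digits are divided away by the block.\<close>

lemma guess_block:
  assumes f: "\<And>d j. d < D \<Longrightarrow> f d j < W d ^ l" and p: "p < m"
  shows "guess p f i D div block (Suc i) = guess p f (Suc i) D div block (Suc i)"
proof -
  define e where "e = (LEAST d. starts d (Suc i))"
  have e: "e \<le> D" unfolding e_def by (rule Least_starts)
  have "\<not> starts d (Suc i)" if "d < e" for d using not_less_Least that unfolding e_def by blast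
  then have "node d (Suc i) = node d i" if "d < e" for d using starts_Suc_iff that by blast
  then have "guess p f i d = guess p f (Suc i) d" if "d \<le> e" for d
    using that by (induction d) auto
  then show ?thesis
    using guess_div[OF f e] guess_less[OF f p] by (simp add: block_def e_def[symmetric] Let_def)
qed

lemma path_append:
  "nfa_path M p u q \<Longrightarrow> nfa_path M q v r \<Longrightarrow> nfa_path M p (u @ v) r"
  by (induction rule: nfa_path.induct) (auto intro: nfa_path.intros)

lemma eps_path:
  assumes "y < A" "i < k"
  shows "nfa_path machine (i * A + (y - y mod block i)) [] (i * A + y)"
proof -
  have "nfa_path machine (i * A + (y - y mod block i)) [] (i * A + (y - y mod block i) + r)"
    if "r \<le> y mod block i" for r
    using that
  proof (induction r)
    case 0
    show ?case by (simp add: nfa_path.empty)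
  next
    case (Suc r)
    define b where "b = block i"
    define u where "u = y - y mod b + r"
    define q where "q = i * A + u"
    obtain c where c: "A = b * c" using block_dvd_A b_def by blast
    have r: "Suc r \<le> y mod b" using Suc.prems by (simp add: b_def)
    have "y mod b < b" using block_pos[of i] by (simp add: b_def)
    then have r': "Suc r < b" using r by simp
    have "y mod b \<le> y" by simp
    then have "u < A" using assms(1) r unfolding u_def by linarith
    then have q: "q < k * A" "q div A = i"
      using assms(2) mult_le_mono1[of "Suc i" k A] by (auto simp: q_def)
    have "u = b * (y div b) + r" by (simp add: u_def minus_mod_eq_mult_div)
    then have "Suc q = Suc r + b * (i * c + y div b)"
      unfolding q_def by (simp add: c add_mult_distrib2 mult.left_commute)
    then have "Suc q mod b = Suc r" using r' by simp
    then have "(q, None, Suc q) \<in> transitions machine"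
      using q by (simp add: machine_def trans_def b_def)
    then have "nfa_path machine q [] (Suc q)"
      by (rule nfa_path.epsilon) (rule nfa_path.empty)
    moreover have q_eq: "i * A + (y - y mod block i) + r = q"
      by (simp only: q_def u_def b_def add.assoc)
    moreover have "nfa_path machine (i * A + (y - y mod block i)) [] q"
      using Suc.IH[OF Suc_leD[OF Suc.prems]] unfolding q_eq .
    ultimately have "nfa_path machine (i * A + (y - y mod block i)) [] (Suc q)"
      using path_append by fastforce
    then show ?case by (simp only: add_Suc_right q_eq)
  qed
  from this[OF order_refl] show ?thesis
    unfolding add.assoc le_add_diff_inverse2[OF mod_less_eq_dividend] .
qed

lemma machine_complete:
  assumes univ: "\<And>d Z \<pi>. d < D \<Longrightarrow> Z \<subseteq> {..<m} \<Longrightarrow> card Z \<le> k div 2 ^ d + 1 \<Longrightarrow> (\<And>x. \<pi> x < 2) \<Longrightarrow>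
      \<exists>f < W d ^ l. \<forall>x\<in>Z. lookup d f x l = \<pi> x"
    and n: "n < 2 ^ b" and m: "2 * (k * k * b + 1) \<le> m"
  shows "distinct_words k n \<subseteq> nfa_lang machine"
proof
  fix w assume "w \<in> distinct_words k n"
  then have w: "length w = k" "set w \<subseteq> {1..n}" "distinct w" by (auto simp: distinct_words_def)
  have "set w \<subseteq> {..<2 ^ b}" using w(2) n by auto
  moreover have "card (set w) \<le> k" using w(1) card_length[of w] by simp
  ultimately obtain \<mu> where \<mu>: "1 \<le> \<mu>" "\<mu> \<le> m" "inj_on (\<lambda>x. x mod \<mu>) (set w)"
    using exists_injective_modulus[of "set w" b k m] m by auto
  define col where "col i = w ! i mod \<mu>" for i
  have col_less: "col i < m" for i
    using \<mu>(1,2) mod_less_divisor[of \<mu> "w ! i"] unfolding col_def by linarith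
  have col_inj: "inj_on col {..<k}"
  proof (rule inj_onI)
    fix i j assume ij: "i \<in> {..<k}" "j \<in> {..<k}" "col i = col j"
    then have "w ! i = w ! j" using w(1) by (intro inj_onD[OF \<mu>(3), of "w ! i" "w ! j"]) (auto simp: col_def)
    then show "i = j" using w(1,3) ij by (simp add: nth_eq_iff_index_eq)
  qed
  have "\<exists>f. f < W d ^ l \<and> (\<forall>i<k. node d i = j \<longrightarrow> lookup d f (col i) l = half d i)" if d: "d < D" for d j
  proof -
    let ?I = "{i. i < k \<and> node d i = j}"
    \<comment> \<open>A colour determines its position because \<open>col\<close> is injective, so
      the half of that position is a function of the colour.\<close>
    define \<pi> where "\<pi> x = half d (the_inv_into {..<k} col x)" for x
    have "card (col ` ?I) \<le> k div 2 ^ d + 1"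
      using card_node[of d j] card_image_le[of ?I col] by simp
    then obtain f where f: "f < W d ^ l" "\<forall>x\<in>col ` ?I. lookup d f x l = \<pi> x"
      using univ[OF d, of "col ` ?I" \<pi>] col_less by (auto simp: \<pi>_def half_def)
    have "\<pi> (col i) = half d i" if "i < k" for i
      using that col_inj by (simp add: \<pi>_def the_inv_into_f_f)
    then show ?thesis using f by auto
  qed
  then obtain f0 where f0: "\<And>d j. d < D \<Longrightarrow> f0 d j < W d ^ l"
    "\<And>d i. d < D \<Longrightarrow> i < k \<Longrightarrow> lookup d (f0 d (node d i)) (col i) l = half d i"
    by metis
  \<comment> \<open>The digit \<open>p\<close> stands for the modulus \<open>p + 1\<close>, whence
    the \<open>+ 1\<close> in \<open>colour\<close>.\<close>
  define p where "p = \<mu> - 1"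
  have p: "p < m" using \<mu> by (simp add: p_def)
  \<comment> \<open>The value 0 at \<open>i = k\<close> makes the target the state
    \<open>k * A\<close>.\<close>
  define y where "y i = (if i < k then guess p f0 i D else 0)" for i
  have y_less: "y i < A" for i using guess_less[OF f0(1) p] A_pos by (simp add: y_def)
  \<comment> \<open>Position \<open>i\<close> is entered with the digits below
    \<open>block i\<close> still 0, the form in which \<open>next_state\<close> delivers it.\<close>
  have "nfa_path machine (i * A + (y i - y i mod block i)) (drop i w) (k * A)" if "i \<le> k" for i
    using that
  proof (induction i rule: inc_induct)
    case base
    then show ?case using w(1) by (simp add: y_def nfa_path.empty)
  next
    case (step i)
    define q where "q = i * A + y i"
    have q: "q < k * A" "q div A = i" "q mod A = y i"
      using y_less[of i] step.hyps mult_le_mono1[of "Suc i" k A] by (auto simp: q_def)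
    have "y i div P 0 = p" using guess_div[OF f0(1), of 0] step.hyps by (simp add: y_def)
    then have "colour (y i) (w ! i) = col i" using \<mu>(1) by (simp add: colour_def p_def col_def)
    then have "allowed i (y i) (w ! i)"
      using lookup_guess[OF f0(1)] f0(2) step.hyps by (simp add: allowed_def y_def)
    moreover have "w ! i \<in> {1..n}" using w(1,2) step.hyps nth_mem by blast
    ultimately have "(q, Some (w ! i), next_state q) \<in> transitions machine"
      using q by (simp add: machine_def trans_def)
    moreover have "next_state q = Suc i * A + (y (Suc i) - y (Suc i) mod block (Suc i))"
    proof -
      define B where "B = block (Suc i)"
      obtain c where c: "A = B * c" using block_dvd_A B_def by blast
      have "q mod B = y i mod B" by (simp add: q_def c mult.left_commute[of i])
      then have "next_state q = Suc i * A + (y i - y i mod B)"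
        using q by (simp add: next_state_def B_def q_def)
      also have "y i - y i mod B = y (Suc i) - y (Suc i) mod B"
      proof (cases "Suc i < k")
        case True
        then have "y i div B = y (Suc i) div B"
          using guess_block[OF f0(1) p] step.hyps by (simp add: y_def B_def)
        then show ?thesis by (simp only: minus_mod_eq_div_mult)
      next
        case False
        then have "Suc i = k" using step.hyps by simp
        then show ?thesis using y_less[of i] y_less[of "Suc i"] by (simp add: B_def block_k)
      qed
      finally show ?thesis by (simp add: B_def)
    qed
    ultimately have "nfa_path machine q (w ! i # drop (Suc i) w) (k * A)"
      using step.IH by (auto intro: nfa_path.letter)
    then have "nfa_path machine q (drop i w) (k * A)"
      using w(1) step.hyps by (simp add: Cons_nth_drop_Suc)
    then show ?case
      using path_append[OF eps_path[OF y_less step.hyps(2)]] by (simp add: q_def)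
  qed
  from this[of 0] have "nfa_path machine 0 w (k * A)"
    using y_less[of 0] by (simp add: block_0)
  then show "w \<in> nfa_lang machine" by (simp add: nfa_lang_def machine_def)
qed

end

section \<open>The program\<close>

abbreviation seq (infixr \<open>;;\<close> 60) where "c1 ;; c2 \<equiv> Seq c1 c2"
abbreviation plus_exp (infixl \<open>\<oplus>\<close> 65) where "a \<oplus> b \<equiv> Bin Plus a b"
abbreviation monus_exp (infixl \<open>\<ominus>\<close> 65) where "a \<ominus> b \<equiv> Bin Monus a b"
abbreviation times_exp (infixl \<open>\<otimes>\<close> 70) where "a \<otimes> b \<equiv> Bin Times a b"
abbreviation div_exp (infixl \<open>\<oslash>\<close> 70) where "a \<oslash> b \<equiv> Bin Div a b"
abbreviation mod_exp (infixl \<open>\<odot>\<close> 70) where "a \<odot> b \<equiv> Bin Mod a b"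
abbreviation less_exp (infix \<open>\<prec>\<close> 50) where "a \<prec> b \<equiv> Bin Less a b"
abbreviation eq_exp (infix \<open>\<doteq>\<close> 50) where "a \<doteq> b \<equiv> Bin Eq a b"
abbreviation assign (infix \<open>::=\<close> 61) where "x ::= e \<equiv> Assign x e"

text \<open>The input and output conventions prescribe the numbers of \<open>vN\<close>, \<open>vK\<close>, \<open>vCount\<close> and of the arrays
  \<open>aSrc\<close>, \<open>aLab\<close>, \<open>aDst\<close>, \<open>aAcc\<close>.\<close>

abbreviation (input) "vN \<equiv> 0"
abbreviation (input) "vK \<equiv> 1"
abbreviation (input) "vCount \<equiv> 2"
abbreviation (input) "vNb \<equiv> 3"
abbreviation (input) "vTmp \<equiv> 4"
abbreviation (input) "vD \<equiv> 5"
abbreviation (input) "vPw \<equiv> 6"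
abbreviation (input) "vBnd \<equiv> 7"
abbreviation (input) "vL \<equiv> 8"
abbreviation (input) "vM \<equiv> 9"
abbreviation (input) "vl \<equiv> 10"
abbreviation (input) "vM2 \<equiv> 11"
abbreviation (input) "vTb \<equiv> 12"
abbreviation (input) "vR \<equiv> 13"
abbreviation (input) "vd \<equiv> 14"
abbreviation (input) "vT \<equiv> 15"
abbreviation (input) "vG \<equiv> 16"
abbreviation (input) "vQ \<equiv> 17"
abbreviation (input) "vW \<equiv> 18"
abbreviation (input) "vWl \<equiv> 19"
abbreviation (input) "vPi \<equiv> 20"
abbreviation (input) "vC \<equiv> 21"
abbreviation (input) "vg \<equiv> 22"
abbreviation (input) "vCur \<equiv> 23"
abbreviation (input) "vJ \<equiv> 24"
abbreviation (input) "vZ \<equiv> 25"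
abbreviation (input) "vX \<equiv> 26"
abbreviation (input) "vB \<equiv> 27"
abbreviation (input) "vNext \<equiv> 28"
abbreviation (input) "vWt \<equiv> 29"
abbreviation (input) "vDem \<equiv> 30"
abbreviation (input) "vV \<equiv> 31"
abbreviation (input) "vA \<equiv> 32"
abbreviation (input) "vKA \<equiv> 33"
abbreviation (input) "vq \<equiv> 34"
abbreviation (input) "vI \<equiv> 35"
abbreviation (input) "vY \<equiv> 36"
abbreviation (input) "vBl \<equiv> 37"
abbreviation (input) "vNxt \<equiv> 38"
abbreviation (input) "vMd \<equiv> 39"
abbreviation (input) "vAi \<equiv> 40"
abbreviation (input) "va \<equiv> 41"
abbreviation (input) "vOk \<equiv> 42"
abbreviation (input) "vDd \<equiv> 43"
abbreviation (input) "vF \<equiv> 44"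
abbreviation (input) "vBit \<equiv> 45"
abbreviation (input) "vBi \<equiv> 46"
abbreviation (input) "vCol \<equiv> 47"
abbreviation (input) "vTwo \<equiv> 48"
abbreviation (input) "vD1 \<equiv> 49"
abbreviation (input) "vLab \<equiv> 50"

abbreviation (input) "aSrc \<equiv> 0"
abbreviation (input) "aLab \<equiv> 1"
abbreviation (input) "aDst \<equiv> 2"
abbreviation (input) "aAcc \<equiv> 3"
abbreviation (input) "aAlive \<equiv> 4"
abbreviation (input) "aS \<equiv> 5"
abbreviation (input) "aU \<equiv> 6"
abbreviation (input) "aP \<equiv> 7"
abbreviation (input) "aW \<equiv> 8"
abbreviation (input) "aTb \<equiv> 9"

section \<open>Evaluating one pattern\<close>

definition eval_init :: com where
  "eval_init = (vWt ::= Read aAlive (Var vC);; vZ ::= Var vC;; vNext ::= Const 0;; vDem ::= Const 2)"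

definition eval_body :: com where
  "eval_body =
      (vX ::= Var vZ \<odot> Var vM2 \<oslash> Const 2;;
       vB ::= Var vZ \<odot> Var vM2 \<odot> Const 2;;
       vZ ::= Var vZ \<oslash> Var vM2;;
       Cond (Var vX \<prec> Var vNext) (vWt ::= Const 0) Skip;;
       vNext ::= Var vX \<oplus> Const 1;;
       Cond (Var vX \<prec> Var vCur)
         (vWt ::= Const 2 \<otimes> Var vWt \<otimes> (Read aU (Var vTb \<oplus> Var vX) \<doteq> Var vB)) Skip;;
       Cond (Var vX \<doteq> Var vCur) (vDem ::= Var vB) Skip)"

definition eval_com :: com where
  "eval_com = eval_init;; For vJ vT eval_body"

lemma wvars_eval [simp]: "wvars eval_com = {vWt, vZ, vNext, vDem, vJ, vX, vB}"
  and warrs_eval [simp]: "warrs eval_com = {}"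
  by (auto simp: eval_com_def eval_init_def eval_body_def)

lemma bdd_var: "bdd \<beta> s \<Longrightarrow> var s x < 2 ^ \<beta>"
  and bdd_arr: "bdd \<beta> s \<Longrightarrow> arr s a i < 2 ^ \<beta>"
  and bdd_const: "bdd \<beta> s \<Longrightarrow> v < 4 \<Longrightarrow> (v::nat) < 2 ^ \<beta>"
proof -
  assume "bdd \<beta> s" "v < 4"
  moreover have "(2::nat) ^ 2 \<le> 2 ^ \<beta>" using \<open>bdd \<beta> s\<close> by (intro power_increasing) (auto simp: bdd_def)
  ultimately show "v < 2 ^ \<beta>" by simp
qed (auto simp: bdd_def)

text \<open>A weight doubles at most once per position, so \<open>wt\<close> bounds all values that
  \<open>vWt\<close> takes.\<close>

lemma wp_eval:
  assumes bdd: "bdd \<beta> s" and M2: "var s vM2 = 2 * m" "0 < m"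
    and wt: "2 ^ var s vT * arr s aAlive (var s vC) < 2 ^ \<beta>"
  defines "h \<equiv> \<lambda>x. arr s aU (var s vTb + x)" and "p \<equiv> pat_pos m (var s vC)" and "b \<equiv> pat_bit m (var s vC)"
  shows "wp \<beta> (6 + var s vT * 20) eval_com
    (\<lambda>s'. var s' vWt = weight h (var s vCur) (arr s aAlive (var s vC)) p b (var s vT) \<and>
          var s' vDem = demand (var s vCur) p b (var s vT)) s"
proof (rule wp_mono)
  define s0 where "s0 = run eval_init s"
  have s0: "var s0 = (var s)(vWt := arr s aAlive (var s vC), vZ := var s vC, vNext := 0, vDem := 2)"
    "arr s0 = arr s"
    by (auto simp: s0_def eval_init_def)
  let ?I = "\<lambda>j s'. var s' vZ = var s vC div (2 * m) ^ j \<and> var s' vNext = next_pos p j \<and>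
      var s' vWt = weight h (var s vCur) (arr s aAlive (var s vC)) p b j \<and> var s' vDem = demand (var s vCur) p b j"
  show "wp \<beta> (steps eval_init + (2 + var s vT * (steps eval_body + 2))) eval_com
    (\<lambda>s'. var s' vWt = weight h (var s vCur) (arr s aAlive (var s vC)) p b (var s vT) \<and>
          var s' vDem = demand (var s vCur) p b (var s vT)) s"
    unfolding eval_com_def
  proof (rule wp_straight_Seq)
    show "straight eval_init" by (simp add: eval_init_def ok_exp_def)
    show "safe \<beta> eval_init s"
      using bdd_var[OF bdd] bdd_arr[OF bdd] bdd_const[OF bdd] by (simp add: eval_init_def)
    assume "bdd \<beta> (run eval_init s)"
    then have "bdd \<beta> s0" by (simp add: s0_def)
    then show "wp \<beta> (2 + var s vT * (steps eval_body + 2)) (For vJ vT eval_body)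
     (\<lambda>s'. var s' vWt = weight h (var s vCur) (arr s aAlive (var s vC)) p b (var s vT) \<and>
          var s' vDem = demand (var s vCur) p b (var s vT)) (run eval_init s)"
      unfolding s0_def[symmetric]
    proof (rule wp_For[where I = ?I])
      fix j s' assume j: "j < var s vT" and I: "?I j s'" and bdd': "bdd \<beta> s'"
        and off: "same_off (insert vJ (wvars eval_body)) (warrs eval_body) s0 s'"
      have same: "var s' vM2 = 2 * m" "var s' vCur = var s vCur" "var s' vTb = var s vTb"  "arr s' aU = arr s aU"
        using same_offD(1)[OF off] same_offD(2)[OF off] M2 by (simp_all add: s0 eval_body_def)
      have dig: "pat_pos m (var s vC) j = p j" "pat_bit m (var s vC) j = b j" by (simp_all add: p_def b_def)
      have I1: "var s' vZ = var s vC div (2 * m) ^ j"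
        and I2: "var s' vNext = next_pos p j" "var s' vDem = demand (var s vCur) p b j"
          "var s' vWt = weight h (var s vCur) (arr s aAlive (var s vC)) p b j"
        using I by simp_all
      have x: "var s' vZ mod (2 * m) div 2 = p j" "var s' vZ mod (2 * m) mod 2 = b j"
        by (simp_all add: I1 p_def b_def pat_pos_def pat_bit_def)
      have h: "arr s aU (var s vTb + p j) = h (p j)" by (simp add: h_def)
      have pj: "p j < m" using M2 by (simp add: p_def pat_pos_less)
      have m: "2 * m < 2 ^ \<beta>" using bdd_var[OF bdd, of vM2] M2 by simp
      have w: "weight h (var s vCur) (arr s aAlive (var s vC)) p b j * 2 \<le> 2 ^ var s vT * arr s aAlive (var s vC)"
      proof -
        have "weight h (var s vCur) (arr s aAlive (var s vC)) p b j * 2 \<le> 2 ^ Suc j * arr s aAlive (var s vC)"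
          using weight_le[of h "var s vCur" "arr s aAlive (var s vC)" p b j] by simp
        also have "\<dots> \<le> 2 ^ var s vT * arr s aAlive (var s vC)"
          using j by (intro mult_le_mono1 power_increasing) auto
        finally show ?thesis .
      qed
      show "wp \<beta> (steps eval_body) eval_body (\<lambda>s''. ?I (Suc j) (set_var vJ (Suc j) s'')) s'"
      proof (rule wp_straight)
        show "straight eval_body" by (simp add: eval_body_def ok_exp_def)
        have z: "var s' vZ div (2 * m) < 2 ^ \<beta>"
          using bdd_var[OF bdd', of vZ] by (rule le_less_trans[OF div_le_dividend])
        have le: "p j < 2 ^ \<beta>" "Suc (p j) < 2 ^ \<beta>" "b j < 2 ^ \<beta>" "0 < (2::nat) ^ \<beta>"
          "2 * weight h (var s vCur) (arr s aAlive (var s vC)) p b j * of_bool P < 2 ^ \<beta>" for P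
          using pj m w wt bdd_const[OF bdd, of "b j"] pat_bit_less[of m "var s vC" j] by (auto simp: b_def)
        show "safe \<beta> eval_body s'"
          by (simp add: eval_body_def same x h I2 le z)
        have "var s' vZ div (2 * m) = var s vC div (2 * m) ^ Suc j"
          by (simp add: I1 div_mult2_eq[symmetric] mult.commute)
        then show "?I (Suc j) (set_var vJ (Suc j) (run eval_body s'))"
          by (simp add: eval_body_def same x h I2 Let_def)
      qed (rule bdd')
    qed (use s0 in \<open>simp_all add: eval_body_def p_def b_def\<close>)
  qed (rule bdd)
qed (simp add: eval_init_def eval_body_def)


section \<open>The greedy vote on one bit\<close>

definition vote_init :: com where
  "vote_init = (Write aS (Const 0) (Const 0);; Write aS (Const 1) (Const 0);; Write aS (Const 2) (Const 0))"

text \<open>The demand itself is the index; cell 2 takes the patterns without a demand and so saves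
  a case distinction.\<close>

definition vote_count :: com where
  "vote_count = Write aS (Var vDem) (Read aS (Var vDem) \<oplus> Var vWt)"

definition vote_set :: com where
  "vote_set = Write aU (Var vTb \<oplus> Var vCur) (Read aS (Const 0) \<prec> Read aS (Const 1))"

definition vote_com :: com where
  "vote_com = vote_init;; For vC vQ (eval_com;; vote_count);; vote_set"

lemma wvars_vote [simp]: "wvars vote_com = {vC, vWt, vZ, vNext, vDem, vJ, vX, vB}"
  and warrs_vote [simp]: "warrs vote_com = {aS, aU}"
  by (auto simp: vote_com_def vote_init_def vote_count_def vote_set_def)

lemma ballot_Suc: "ballot m t al h cur (Suc q) v =
    ballot m t al h cur q v + (if pat_demand m t cur q = v then pat_weight m t al h cur q else 0)"
  by (simp add: ballot_def)

lemma ballot_le: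
  assumes "\<And>c. c < q \<Longrightarrow> al c \<le> 1"
  shows "ballot m t al h cur q v \<le> q * 2 ^ t"
  using assms
proof (induction q)
  case (Suc q)
  have "pat_weight m t al h cur q \<le> 2 ^ t"
    unfolding pat_weight_def
    using order_trans[OF weight_le mult_le_mono2[of "al q" 1]] Suc.prems[of q] by (metis lessI mult.right_neutral)
  then show ?case using Suc by (simp add: ballot_Suc)
qed (simp add: ballot_def)

lemma pat_demand_less: "pat_demand m t cur c < 3"
  using demand_cases[of t "pat_bit m c" cur "pat_pos m c"] by (auto simp: pat_demand_def pat_bit_less)

lemma wp_vote:
  assumes bdd: "bdd \<beta> s" and M2: "var s vM2 = 2 * m" "0 < m" and t: "var s vT = t" and q: "var s vQ = q"
    and al: "\<And>c. c < q \<Longrightarrow> arr s aAlive c = al c" "\<And>c. c < q \<Longrightarrow> al c \<le> 1"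
    and wt: "Suc q * 2 ^ t < 2 ^ \<beta>"
  defines "h \<equiv> \<lambda>x. arr s aU (var s vTb + x)"
  shows "wp \<beta> (6 + q * (t * 20 + 9)) vote_com
    (\<lambda>s'. arr s' aU = (arr s aU)(var s vTb + var s vCur :=
       of_bool (ballot m t al h (var s vCur) q 0 < ballot m t al h (var s vCur) q 1))) s"
proof -
  let ?cur = "var s vCur"
  let ?I = "\<lambda>j s'. \<forall>v<3. arr s' aS v = ballot m t al h ?cur j v"
  define s0 where "s0 = run vote_init s"
  have s0: "var s0 = var s" "arr s0 aS 0 = 0" "arr s0 aS 1 = 0" "arr s0 aS 2 = 0"
    "a \<noteq> aS \<Longrightarrow> arr s0 a = arr s a" for a
    by (auto simp: s0_def vote_init_def)
  have le: "x * 2 ^ t < 2 ^ \<beta>" if "x \<le> q" for x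
    using wt mult_le_mono1[of x "Suc q" "2 ^ t"] that by linarith
  have count: "wp \<beta> (6 + t * 20 + 1) (eval_com;; vote_count) (\<lambda>s''. ?I (Suc j) (set_var vC (Suc j) s'')) s'"
    if j: "j < q" and I: "?I j s'" and C: "var s' vC = j" and bdd': "bdd \<beta> s'"
      and off: "same_off (insert vC (wvars (eval_com;; vote_count))) (warrs (eval_com;; vote_count)) s0 s'" for j s'
  proof -
    have same: "var s' vM2 = 2 * m" "var s' vCur = ?cur" "var s' vTb = var s vTb" "var s' vT = t"
      "arr s' aU = arr s aU" "arr s' aAlive = arr s aAlive"
      using same_offD(1)[OF off] same_offD(2)[OF off] M2 t by (simp_all add: s0 vote_count_def)
    have "2 ^ var s' vT * arr s' aAlive (var s' vC) \<le> Suc q * 2 ^ t"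
      using al[OF j] by (simp add: same C mult.commute[of _ "al j"] trans_le_add1)
    then have "wp \<beta> (6 + var s' vT * 20) eval_com (\<lambda>s''. var s'' vWt = pat_weight m t al h ?cur j \<and>
        var s'' vDem = pat_demand m t ?cur j) s'"
      using wp_eval[OF bdd' same(1) M2(2)] wt al(1)[OF j]
      by (simp add: same C h_def pat_weight_def pat_demand_def)
    then show ?thesis unfolding same(4)
    proof (rule wp_SeqI)
      fix s2 assume off2: "same_off (wvars eval_com) (warrs eval_com) s' s2" and bdd2: "bdd \<beta> s2"
        and R: "var s2 vWt = pat_weight m t al h ?cur j \<and> var s2 vDem = pat_demand m t ?cur j"
      have S: "arr s2 aS = arr s' aS" using same_offD(2)[OF off2] by simp
      have d: "pat_demand m t ?cur j < 3" by (rule pat_demand_less)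
      have bal: "arr s' aS (pat_demand m t ?cur j) + pat_weight m t al h ?cur j =
          ballot m t al h ?cur (Suc j) (pat_demand m t ?cur j)"
        using I d by (simp add: ballot_Suc)
      have "ballot m t al h ?cur (Suc j) v \<le> Suc j * 2 ^ t" for v
        using al(2) j by (intro ballot_le) simp
      then have less: "ballot m t al h ?cur (Suc j) v < 2 ^ \<beta>" for v
        using le[of "Suc j"] j by (meson Suc_leI le_less_trans)
      have "wp \<beta> (steps vote_count) vote_count (\<lambda>s''. ?I (Suc j) (set_var vC (Suc j) s'')) s2"
      proof (rule wp_straight)
        show "safe \<beta> vote_count s2" using R S bal less by (simp add: vote_count_def)
        show "?I (Suc j) (set_var vC (Suc j) (run vote_count s2))"
          using R S bal I by (simp add: vote_count_def ballot_Suc)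
      qed (simp_all add: bdd2 vote_count_def ok_exp_def)
      then show "wp \<beta> 1 vote_count (\<lambda>s''. ?I (Suc j) (set_var vC (Suc j) s'')) s2"
        by (simp add: vote_count_def)
    qed
  qed
  have "wp \<beta> (steps vote_init + ((2 + q * ((6 + t * 20 + 1) + 2)) + steps vote_set)) vote_com
    (\<lambda>s'. arr s' aU = (arr s aU)(var s vTb + ?cur :=
       of_bool (ballot m t al h ?cur q 0 < ballot m t al h ?cur q 1))) s"
    unfolding vote_com_def
  proof (rule wp_straight_Seq, goal_cases)
    case 1
    show ?case by (simp add: vote_init_def ok_exp_def)
  next
    case 3
    show ?case using bdd_const[OF bdd] by (simp add: vote_init_def)
  next
    case 4
    then have bdd0: "bdd \<beta> s0" by (simp add: s0_def)
    show ?case unfolding s0_def[symmetric]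
    proof (rule wp_SeqI)
      show "wp \<beta> (2 + q * ((6 + t * 20 + 1) + 2)) (For vC vQ (eval_com;; vote_count)) (?I q) s0"
      proof (rule wp_For[where I = ?I])
        have "v = 0 \<or> v = 1 \<or> v = 2" if "v < 3" for v :: nat using that by auto
        then show "?I 0 (set_var vC 0 s0)" using s0(2-4) by (auto simp: ballot_def)
      next
        fix j s' assume "j < q" "?I j s'" "var s' vC = j" "bdd \<beta> s'"
          "same_off (insert vC (wvars (eval_com;; vote_count))) (warrs (eval_com;; vote_count)) s0 s'"
        then show "wp \<beta> (6 + t * 20 + 1) (eval_com;; vote_count) (\<lambda>s''. ?I (Suc j) (set_var vC (Suc j) s'')) s'"
          by (rule count)
      next
        show "var s0 vQ = q" using q s0(1) by simp
      qed (use bdd0 in \<open>simp_all add: vote_count_def\<close>)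
    next
      fix s1 assume off: "same_off (wvars (For vC vQ (eval_com;; vote_count))) (warrs (For vC vQ (eval_com;; vote_count))) s0 s1"
        and bdd1: "bdd \<beta> s1" and I: "?I q s1"
      have same: "var s1 vCur = ?cur" "var s1 vTb = var s vTb" "arr s1 aU = arr s aU"
        using same_offD(1)[OF off] same_offD(2)[OF off] by (simp_all add: s0 vote_count_def)
      show "wp \<beta> (steps vote_set) vote_set
         (\<lambda>s'. arr s' aU = (arr s aU)(var s vTb + ?cur :=
       of_bool (ballot m t al h ?cur q 0 < ballot m t al h ?cur q 1))) s1"
      proof (rule wp_straight)
        show "straight vote_set" by (simp add: vote_set_def ok_exp_def)
        show "safe \<beta> vote_set s1" using bdd_const[OF bdd] by (simp add: vote_set_def)
        show "arr (run vote_set s1) aU = (arr s aU)(var s vTb + ?cur :=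
           of_bool (ballot m t al h ?cur q 0 < ballot m t al h ?cur q 1))"
          using I same by (simp add: vote_set_def)
      qed (rule bdd1)
    qed
  qed (rule bdd)
  then show ?thesis by (rule wp_mono) (simp add: vote_init_def vote_set_def)
qed


section \<open>Constructing one function of a family\<close>

definition cover_step :: com where
  "cover_step = Cond (Var vWt) (Write aAlive (Var vC) (Const 0)) Skip"

text \<open>The first loop ends with \<open>vCur = m\<close>, so in the second one
  \<open>eval_com\<close> yields final weights: nonzero exactly for the living patterns that the new
  function meets.\<close>

definition member_com :: com where
  "member_com = For vCur vM vote_com;; For vC vQ (eval_com;; cover_step);; vTb ::= Var vTb \<oplus> Var vM"

lemma wvars_member [simp]: "wvars member_com = {vCur, vTb, vC, vWt, vZ, vNext, vDem, vJ, vX, vB}"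
  and warrs_member [simp]: "warrs member_com = {aS, aU, aAlive}"
  by (auto simp: member_com_def cover_step_def)

text \<open>A finished function is 0 from index \<open>m\<close> on, so the next one again finds the
  blank memory that the hypothesis \<open>U\<close> of \<open>wp_member\<close> asks for.\<close>

lemma greedy_beyond: "cur \<le> x \<Longrightarrow> greedy m t al cur x = 0"
  by (induction cur) auto

lemma wp_member:
  assumes bdd: "bdd \<beta> s" and M: "var s vM = m" "var s vM2 = 2 * m" "0 < m" and t: "var s vT = t"
    and Q: "var s vQ = (2 * m) ^ t"
    and al: "\<And>c. c < (2 * m) ^ t \<Longrightarrow> arr s aAlive c = al c" "\<And>c. al c \<le> 1"
    and U: "\<And>x. arr s aU (var s vTb + x) = 0"
    and wt: "Suc ((2 * m) ^ t) * 2 ^ t < 2 ^ \<beta>" and tb: "var s vTb + m < 2 ^ \<beta>"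
  defines "h \<equiv> greedy m t al m"
  shows "wp \<beta> (5 + m * (8 + (2 * m) ^ t * (t * 20 + 9)) + (2 * m) ^ t * (t * 20 + 11)) member_com
    (\<lambda>s'. (\<forall>c < (2 * m) ^ t. arr s' aAlive c = (if pat_weight m t al h m c = 0 then al c else 0)) \<and>
      (\<forall>x. arr s' aU (var s vTb + x) = h x) \<and> (\<forall>x < var s vTb. arr s' aU x = arr s aU x) \<and>
      var s' vTb = var s vTb + m) s"
proof -
  let ?q = "(2 * m) ^ t"
  let ?I1 = "\<lambda>j s'. (\<forall>x. arr s' aU (var s vTb + x) = greedy m t al j x) \<and> (\<forall>x < var s vTb. arr s' aU x = arr s aU x)"
  let ?I2 = "\<lambda>j s'. \<forall>c < ?q. arr s' aAlive c = (if c < j \<and> pat_weight m t al h m c \<noteq> 0 then 0 else al c)"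
  have w1: "(2::nat) ^ t < 2 ^ \<beta>"
    using wt by (simp add: add_lessD1)
  have loop1: "wp \<beta> (2 + m * (6 + ?q * (t * 20 + 9) + 2)) (For vCur vM vote_com) (\<lambda>s'. ?I1 m s' \<and> var s' vCur = m) s"
  proof (rule wp_For[where I = ?I1])
    fix j s' assume I: "?I1 j s'" and cur: "var s' vCur = j" and bdd': "bdd \<beta> s'"
      and off: "same_off (insert vCur (wvars vote_com)) (warrs vote_com) s s'"
    have same: "var s' vM2 = 2 * m" "var s' vTb = var s vTb" "var s' vT = t" "var s' vQ = ?q"
      "arr s' aAlive = arr s aAlive"
      using same_offD(1)[OF off] same_offD(2)[OF off] M t Q by simp_all
    have "(\<lambda>x. arr s' aU (var s' vTb + x)) = greedy m t al j" using I same by auto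
    then have "wp \<beta> (6 + ?q * (t * 20 + 9)) vote_com
      (\<lambda>s''. arr s'' aU = (arr s' aU)(var s vTb + j := greedy m t al (Suc j) j)) s'"
      using wp_vote[OF bdd' same(1) M(3) same(3,4), of al] al wt same cur by simp
    then show "wp \<beta> (6 + ?q * (t * 20 + 9)) vote_com (\<lambda>s''. ?I1 (Suc j) (set_var vCur (Suc j) s'')) s'"
    proof (rule wp_conseq)
      fix s2 :: store assume "arr s2 aU = (arr s' aU)(var s vTb + j := greedy m t al (Suc j) j)"
      then show "?I1 (Suc j) (set_var vCur (Suc j) s2)" using I by auto
    qed simp
  qed (use bdd M U in auto)
  have loop2: "wp \<beta> (2 + ?q * ((6 + t * 20) + 3 + 2)) (For vC vQ (eval_com;; cover_step)) (?I2 ?q) s1"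
    if bdd1: "bdd \<beta> s1" and I1: "?I1 m s1" and cur: "var s1 vCur = m"
      and off1: "same_off (wvars (For vCur vM vote_com)) (warrs (For vCur vM vote_com)) s s1" for s1
  proof (rule wp_For[where I = ?I2])
    have al1: "arr s1 aAlive = arr s aAlive" using same_offD(2)[OF off1] by simp
    then show "?I2 0 (set_var vC 0 s1)" using al by simp
    show "var s1 vQ = ?q" using same_offD(1)[OF off1] Q by simp
    fix j s' assume j: "j < ?q" and I: "?I2 j s'" and C: "var s' vC = j" and bdd': "bdd \<beta> s'"
      and off: "same_off (insert vC (wvars (eval_com;; cover_step))) (warrs (eval_com;; cover_step)) s1 s'"
    have same: "var s' vM2 = 2 * m" "var s' vTb = var s vTb" "var s' vT = t" "var s' vCur = m" "arr s' aU = arr s1 aU"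
      using same_offD(1)[OF off] same_offD(2)[OF off] same_offD(1)[OF off1] M t cur by (simp_all add: cover_step_def)
    have alj: "arr s' aAlive j = al j" using I j by simp
    have h: "(\<lambda>x. arr s' aU (var s' vTb + x)) = h" using I1 same by (auto simp: h_def)
    have "2 ^ t * al j \<le> 2 ^ t" using al(2)[of j] by simp
    then have "2 ^ t * al j < 2 ^ \<beta>" using w1 by (rule le_less_trans)
    then have "wp \<beta> (6 + var s' vT * 20) eval_com (\<lambda>s''. var s'' vWt = pat_weight m t al h m j \<and> True) s'"
      using wp_eval[OF bdd' same(1) M(3)] alj
      unfolding C same(3,4) h pat_weight_def by (auto elim!: wp_conseq)
    then show "wp \<beta> ((6 + t * 20) + 3) (eval_com;; cover_step) (\<lambda>s''. ?I2 (Suc j) (set_var vC (Suc j) s'')) s'"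
      unfolding same(3)
    proof (rule wp_SeqI)
      fix s2 assume off2: "same_off (wvars eval_com) (warrs eval_com) s' s2" and bdd2: "bdd \<beta> s2"
        and R: "var s2 vWt = pat_weight m t al h m j \<and> True"
      have same2: "arr s2 aAlive = arr s' aAlive" "var s2 vC = j"
        using same_offD[OF off2] C by simp_all
      have "wp \<beta> (steps cover_step) cover_step (\<lambda>s''. ?I2 (Suc j) (set_var vC (Suc j) s'')) s2"
      proof (rule wp_straight)
        show "safe \<beta> cover_step s2" using bdd_const[OF bdd] by (simp add: cover_step_def)
        show "?I2 (Suc j) (set_var vC (Suc j) (run cover_step s2))"
          using R I same2 by (auto simp: cover_step_def less_Suc_eq)
      qed (simp_all add: bdd2 cover_step_def ok_exp_def)
      then show "wp \<beta> 3 cover_step (\<lambda>s''. ?I2 (Suc j) (set_var vC (Suc j) s'')) s2"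
        by (rule wp_mono) (simp add: cover_step_def)
    qed
  qed (use bdd1 in \<open>simp_all add: cover_step_def\<close>)
  have "wp \<beta> ((2 + m * (6 + ?q * (t * 20 + 9) + 2)) + ((2 + ?q * ((6 + t * 20) + 3 + 2)) + 1)) member_com
    (\<lambda>s'. (\<forall>c < ?q. arr s' aAlive c = (if pat_weight m t al h m c = 0 then al c else 0)) \<and>
      (\<forall>x. arr s' aU (var s vTb + x) = h x) \<and> (\<forall>x < var s vTb. arr s' aU x = arr s aU x) \<and>
      var s' vTb = var s vTb + m) s"
    unfolding member_com_def
  proof (rule wp_SeqI[OF loop1])
    fix s1 assume off1: "same_off (wvars (For vCur vM vote_com)) (warrs (For vCur vM vote_com)) s s1"
      and bdd1: "bdd \<beta> s1" and I1: "?I1 m s1 \<and> var s1 vCur = m"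
    show "wp \<beta> ((2 + ?q * ((6 + t * 20) + 3 + 2)) + 1)
      (For vC vQ (eval_com;; cover_step);; vTb ::= Var vTb \<oplus> Var vM)
      (\<lambda>s'. (\<forall>c < ?q. arr s' aAlive c = (if pat_weight m t al h m c = 0 then al c else 0)) \<and>
      (\<forall>x. arr s' aU (var s vTb + x) = h x) \<and> (\<forall>x < var s vTb. arr s' aU x = arr s aU x) \<and>
      var s' vTb = var s vTb + m) s1"
    proof (rule wp_SeqI[OF loop2[OF bdd1 conjunct1[OF I1] conjunct2[OF I1] off1]])
      fix s2 assume off2: "same_off (wvars (For vC vQ (eval_com;; cover_step)))
          (warrs (For vC vQ (eval_com;; cover_step))) s1 s2"
        and bdd2: "bdd \<beta> s2" and I2: "?I2 ?q s2"
      have same: "var s2 vTb = var s vTb" "var s2 vM = m" "arr s2 aU = arr s1 aU"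
        using same_offD(1)[OF off2] same_offD(2)[OF off2] same_offD(1)[OF off1] M by (simp_all add: cover_step_def)
      show "wp \<beta> 1 (vTb ::= Var vTb \<oplus> Var vM)
        (\<lambda>s'. (\<forall>c < ?q. arr s' aAlive c = (if pat_weight m t al h m c = 0 then al c else 0)) \<and>
        (\<forall>x. arr s' aU (var s vTb + x) = h x) \<and> (\<forall>x < var s vTb. arr s' aU x = arr s aU x) \<and>
        var s' vTb = var s vTb + m) s2"
        using I1 I2 same tb by (intro wp_Assign[OF bdd2]) (auto simp: ok_exp_def h_def)
    qed
  qed
  then show ?thesis by (rule wp_mono) (simp add: algebra_simps)
qed


section \<open>Powers and binary lengths\<close>

definition pow_com :: "nat \<Rightarrow> nat \<Rightarrow> nat \<Rightarrow> com" where
  "pow_com p b e = p ::= Const 1;; For vPi e (p ::= Var p \<otimes> Var b)"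

lemma wvars_pow [simp]: "wvars (pow_com p b e) = {p, vPi}"
  and warrs_pow [simp]: "warrs (pow_com p b e) = {}"
  by (auto simp: pow_com_def)

lemma wp_pow:
  assumes bdd: "bdd \<beta> s" and vars: "p \<noteq> b" "p \<noteq> e" "p \<noteq> vPi" "b \<noteq> vPi" "e \<noteq> vPi"
    and B: "0 < var s b" and E: "var s e = E" and less: "var s b ^ E < 2 ^ \<beta>"
  shows "wp \<beta> (3 + E * 3) (pow_com p b e) (\<lambda>s'. var s' p = var s b ^ E) s"
proof -
  let ?s = "set_var p 1 s"
  have "wp \<beta> (1 + (2 + E * (1 + 2))) (pow_com p b e) (\<lambda>s'. var s' p = var s b ^ E) s"
    unfolding pow_com_def
  proof (intro wp_Seq wp_Assign[OF bdd])
    show "ok_exp (Const 1)" by (simp add: ok_exp_def)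
    show "aval (Const 1) s < 2 ^ \<beta>" using bdd_const[OF bdd, of 1] by simp
    fix v assume v: "v = aval (Const 1) s" and bdd1: "bdd \<beta> (set_var p v s)"
    show "wp \<beta> (2 + E * (1 + 2)) (For vPi e (p ::= Var p \<otimes> Var b)) (\<lambda>s'. var s' p = var s b ^ E) (set_var p v s)"
    proof (rule wp_For[where I = "\<lambda>j s'. var s' p = var s b ^ j"])
      fix j s' assume j: "j < E" and I: "var s' p = var s b ^ j" and bdd': "bdd \<beta> s'"
        and off: "same_off (insert vPi (wvars (p ::= Var p \<otimes> Var b))) (warrs (p ::= Var p \<otimes> Var b)) (set_var p v s) s'"
      have b: "var s' b = var s b" using same_offD(1)[OF off, of b] vars by simp
      have "var s b ^ Suc j \<le> var s b ^ E" using j B by (intro power_increasing) auto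
      then have "var s b ^ j * var s b < 2 ^ \<beta>" using less by (simp add: mult.commute)
      then show "wp \<beta> 1 (p ::= Var p \<otimes> Var b) (\<lambda>s''. var (set_var vPi (Suc j) s'') p = var s b ^ Suc j) s'"
        using I b vars by (intro wp_Assign[OF bdd']) (auto simp: ok_exp_def mult.commute)
    qed (use bdd1 vars v E in auto)
  qed
  then show ?thesis by (rule wp_mono) simp
qed

text \<open>One loop yields the binary length together with the least power of two above the
  argument; thus \<open>2 ^ D\<close> and \<open>m = 2 ^ L\<close> come with \<open>D\<close> and
  \<open>L\<close>.\<close>

definition log_com :: "nat \<Rightarrow> nat \<Rightarrow> nat \<Rightarrow> com" where
  "log_com c p b = (c ::= Const 0;; p ::= Const 1);;
     While ((Var b \<prec> Var p) \<doteq> Const 0) (p ::= Const 2 \<otimes> Var p;; c ::= Var c \<oplus> Const 1)"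

lemma wvars_log [simp]: "wvars (log_com c p b) = {c, p}"
  and warrs_log [simp]: "warrs (log_com c p b) = {}"
  by (auto simp: log_com_def)

lemma less_two_power_floorlog: "x < 2 ^ floorlog 2 x"
  by (cases "x = 0") (use floorlog_bounds[of x 2] in auto)

lemma two_power_le: "j < floorlog 2 x \<Longrightarrow> 2 ^ j \<le> x"
proof -
  assume j: "j < floorlog 2 x"
  then have "x \<noteq> 0" by (cases "x = 0") (auto simp: floorlog_def)
  have "(2::nat) ^ j \<le> 2 ^ (floorlog 2 x - 1)" using j by (intro power_increasing) auto
  also have "\<dots> \<le> x" using floorlog_bounds[of x 2] \<open>x \<noteq> 0\<close> by auto
  finally show ?thesis .
qed

lemma two_power_floorlog_le: "2 ^ floorlog 2 x \<le> 2 * x + 1"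
proof (cases "floorlog 2 x")
  case (Suc j)
  then show ?thesis using two_power_le[of j x] by simp
qed simp

lemma wp_log:
  assumes bdd: "bdd \<beta> s" and vars: "c \<noteq> p" "c \<noteq> b" "p \<noteq> b" and less: "2 * var s b + 1 < 2 ^ \<beta>"
  shows "wp \<beta> (3 + floorlog 2 (var s b) * 3) (log_com c p b)
    (\<lambda>s'. var s' c = floorlog 2 (var s b) \<and> var s' p = 2 ^ floorlog 2 (var s b)) s"
proof -
  let ?N = "floorlog 2 (var s b)" and ?init = "c ::= Const 0;; p ::= Const 1"
  let ?body = "p ::= Const 2 \<otimes> Var p;; c ::= Var c \<oplus> Const 1"
  let ?I = "\<lambda>j s'. var s' c = j \<and> var s' p = 2 ^ j"
  have N: "?N < 2 ^ \<beta>"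
    using less two_power_floorlog_le[of "var s b"] less_exp[of ?N] by linarith
  have "wp \<beta> (steps ?init + (1 + ?N * (steps ?body + 1))) (log_com c p b) (?I ?N) s"
    unfolding log_com_def
  proof (rule wp_straight_Seq)
    show "straight ?init" by (simp add: ok_exp_def)
    show "safe \<beta> ?init s" using bdd_const[OF bdd] by simp
    assume bdd1: "bdd \<beta> (run ?init s)"
    show "wp \<beta> (1 + ?N * (steps ?body + 1)) (While ((Var b \<prec> Var p) \<doteq> Const 0) ?body) (?I ?N) (run ?init s)"
    proof (rule wp_While[where I = ?I])
      fix j s' assume j: "j < ?N" and I: "?I j s'" and bdd': "bdd \<beta> s'"
        and off: "same_off (wvars ?body) (warrs ?body) (run ?init s) s'"
      have b: "var s' b = var s b" using same_offD(1)[OF off, of b] vars by simp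
      have le: "2 ^ j \<le> var s b" using j by (rule two_power_le)
      show "aval ((Var b \<prec> Var p) \<doteq> Const 0) s' \<noteq> 0" using I b le by simp
      show "wp \<beta> (steps ?body) ?body (?I (Suc j)) s'"
      proof (rule wp_straight)
        show "straight ?body" by (simp add: ok_exp_def)
        show "safe \<beta> ?body s'" using I le less j N vars by simp
        show "?I (Suc j) (run ?body s')" using I vars by simp
      qed (rule bdd')
    next
      fix s' assume I: "?I ?N s'" and off: "same_off (wvars ?body) (warrs ?body) (run ?init s) s'"
      have b: "var s' b = var s b" using same_offD(1)[OF off, of b] vars by simp
      then show "aval ((Var b \<prec> Var p) \<doteq> Const 0) s' = 0"
        using I less_two_power_floorlog[of "var s b"] by simp
    qed (use bdd1 vars in \<open>simp_all add: ok_exp_def\<close>)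
  qed (rule bdd)
  then show ?thesis by (rule wp_mono) simp
qed

text \<open>The levels are processed from the deepest one upwards, because \<open>aP\<close> accumulates products over
  the deeper levels.\<close>

definition level_init :: com where
  "level_init = (vd ::= Var vD \<ominus> Const 1 \<ominus> Var vR;; vPw ::= Var vPw \<oslash> Const 2;;
     vT ::= Var vK \<oslash> (Var vPw \<otimes> Var vl) \<oplus> Const 1)"

definition level_G :: com where
  "level_G = vG ::= Var vG \<otimes> ((Var vL \<oplus> Const 1) \<otimes> Var vT \<oplus> Const 1)"

definition level_W :: com where
  "level_W = (vW ::= Var vM2 \<otimes> Var vG;; Write aW (Var vd) (Var vW))"

definition level_P :: com where
  "level_P = (Write aP (Var vd) (Var vWl \<otimes> Read aP (Var vd \<oplus> Const 1));; Write aTb (Var vd) (Var vTb))"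

definition level_com :: com where
  "level_com = level_init;;
     (pow_com vG vTwo vT;; level_G;; pow_com vQ vM2 vT;; level_W;; pow_com vWl vW vl;; level_P);;
     For vC vQ (Write aAlive (Var vC) (Const 1));; For vg vG member_com"

lemma wvars_level [simp]: "wvars level_com = {vd, vPw, vT, vG, vPi, vQ, vW, vWl, vC, vg,
    vCur, vTb, vWt, vZ, vNext, vDem, vJ, vX, vB}"
  and warrs_level [simp]: "warrs level_com = {aW, aP, aTb, aAlive, aS, aU}"
  by (auto simp: level_com_def level_init_def level_G_def level_W_def level_P_def)

definition set_params :: com where
  "set_params = vl ::= Var vL \<oplus> Const 2;; vM2 ::= Const 2 \<otimes> Var vM;; vTwo ::= Const 2;;
     Write aP (Var vD) (Const 1)"

definition setup_com :: com where
  "setup_com = log_com vNb vTmp vN;; log_com vD vPw vK;;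
     vBnd ::= Const 2 \<otimes> (Var vK \<otimes> Var vK \<otimes> Var vNb) \<oplus> Const 1;;
     log_com vL vM vBnd;; set_params;; For vR vD level_com"

lemma wp_Seq_pred:
  assumes "\<And>s. bdd \<beta> s \<Longrightarrow> J s \<Longrightarrow> wp \<beta> T1 c1 J' s" "\<And>s. bdd \<beta> s \<Longrightarrow> J' s \<Longrightarrow> wp \<beta> T2 c2 Q s"
    and "bdd \<beta> s" "J s"
  shows "wp \<beta> (T1 + T2) (Seq c1 c2) Q s"
  using assms by (blast intro: wp_SeqI)

section \<open>The parameters and the tables\<close>

locale parameters =
  fixes n k :: nat
  assumes k_ge: "1 \<le> k" and k_le: "k \<le> n"
begin

definition nb :: nat where "nb = floorlog 2 n"
definition D :: nat where "D = floorlog 2 k"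
text \<open>With \<open>b = nb\<close> the hypothesis of \<open>exists_injective_modulus\<close> on
  \<open>m\<close> says \<open>bnd < m\<close>.\<close>

definition bnd :: nat where "bnd = 2 * (k * k * nb) + 1"
definition L :: nat where "L = floorlog 2 bnd"
text \<open>As a power of two it makes \<open>(2 * m) ^ t\<close> a power of two with exponent
  \<open>(L + 1) * t\<close>.\<close>

definition m :: nat where "m = 2 ^ L"
text \<open>The exponent per position of the greedy search:
  \<open>(2 * m) ^ t * 2 ^ t = 2 ^ (l * t)\<close>.\<close>

definition l :: nat where "l = L + 2"
text \<open>Large enough for \<open>l\<close> intervals with \<open>t d\<close> colours each to hold
  the at most \<open>k div 2 ^ d + 1\<close> colours of a node.\<close>

definition t :: "nat \<Rightarrow> nat" where "t d = k div (2 ^ d * l) + 1"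
text \<open>The size \<open>2 ^ t * B\<close> from \<open>family_universal\<close>, where
  \<open>B\<close> is the least exponent with \<open>(2 * m) ^ t < 2 ^ B\<close>.\<close>

definition G :: "nat \<Rightarrow> nat" where "G d = 2 ^ t d * ((L + 1) * t d + 1)"
definition W :: "nat \<Rightarrow> nat" where "W d = 2 * m * G d"
definition U :: "nat \<Rightarrow> nat \<Rightarrow> nat \<Rightarrow> nat" where "U d g x = family m (t d) g x"

lemma G_pos: "0 < G d" by (simp add: G_def)
lemma m_gt_0: "0 < m" by (simp add: m_def)

sublocale split_nfa n k m D l W U
  by standard (use k_ge m_gt_0 in \<open>simp_all add: D_def less_two_power_floorlog W_def G_pos\<close>)

definition Q :: "nat \<Rightarrow> nat" where "Q d = (2 * m) ^ t d"

definition env :: "store \<Rightarrow> bool" where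
  "env s \<longleftrightarrow> var s vN = n \<and> var s vK = k \<and> var s vD = D \<and> var s vL = L \<and> var s vM = m \<and>
     var s vM2 = 2 * m \<and> var s vl = l \<and> var s vTwo = 2"

text \<open>The state of memory after the \<open>r\<close> deepest levels. From \<open>aTb d\<close>
  on, \<open>aU\<close> holds the functions of level \<open>d\<close> in rows of \<open>m\<close>
  cells; \<open>vTb\<close> is the first free cell, and its bound limits the length of
  addresses.\<close>

definition tables :: "nat \<Rightarrow> store \<Rightarrow> bool" where
  "tables r s \<longleftrightarrow> arr s aP D = 1 \<and> var s vTb \<le> r * (G 0 * m) \<and> (\<forall>x \<ge> var s vTb. arr s aU x = 0) \<and>
     (\<forall>d. D - r \<le> d \<and> d < D \<longrightarrow> arr s aW d = W d \<and> arr s aP d = P d \<and>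
       arr s aTb d + G d * m \<le> var s vTb \<and>
       (\<forall>g<G d. \<forall>x<m. arr s aU (arr s aTb d + g * m + x) = U d g x))"

definition level :: "nat \<Rightarrow> nat \<Rightarrow> store \<Rightarrow> bool" where
  "level r d s \<longleftrightarrow> env s \<and> var s vR = r \<and> var s vd = d \<and> var s vPw = 2 ^ d \<and> var s vT = t d \<and> tables r s"

lemma level_frame:
  assumes "level r d s" "same_off X B s s'"
    and "X \<inter> {vN, vK, vD, vL, vM, vM2, vl, vTwo, vR, vd, vPw, vT, vTb} = {}" "B \<inter> {aP, aW, aU, aTb} = {}"
  shows "level r d s'"
proof -
  have "var s' x = var s x" if "x \<in> {vN, vK, vD, vL, vM, vM2, vl, vTwo, vR, vd, vPw, vT, vTb}" for x
    using that assms(3) by (intro same_offD(1)[OF assms(2)]) blast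
  moreover have "arr s' a = arr s a" if "a \<in> {aP, aW, aU, aTb}" for a
    using that assms(4) by (intro same_offD(2)[OF assms(2)]) blast
  ultimately show ?thesis using assms(1) by (simp add: level_def env_def tables_def)
qed

text \<open>Every level is charged like level 0, where \<open>t\<close>, \<open>G\<close> and
  \<open>Q\<close> are largest.\<close>

definition level_time :: nat where
  "level_time = 50 + 6 * t 0 + 3 * l + 3 * Q 0 +
     G 0 * (7 + m * (8 + Q 0 * (t 0 * 20 + 9)) + Q 0 * (t 0 * 20 + 11))"

lemma t_mono: "t d \<le> t 0"
proof -
  have "0 < l" by (simp add: l_def)
  moreover have "l \<le> 2 ^ d * l" by simp
  ultimately have "k div (2 ^ d * l) \<le> k div l" by (intro div_le_mono2)
  then show ?thesis by (simp add: t_def)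
qed

lemma G_mono: "G d \<le> G 0"
  unfolding G_def using t_mono[of d] by (intro mult_le_mono power_increasing add_le_mono) auto

lemma Q_mono: "Q d \<le> Q 0"
  unfolding Q_def using t_mono[of d] m_gt_0 by (intro power_increasing) auto

lemma Q_pos: "0 < Q d" by (simp add: Q_def m_gt_0)

lemma P_le_A: "d \<le> D \<Longrightarrow> P d \<le> A"
  using P_dvd_A A_pos by (intro dvd_imp_le)

lemma W_le_A: "d < D \<Longrightarrow> W d ^ l \<le> A" "d < D \<Longrightarrow> W d \<le> A"
proof -
  assume d: "d < D"
  have "W d ^ l \<le> P d" using P_Suc[OF d] P_pos[of "Suc d"] by simp
  then show 1: "W d ^ l \<le> A" using P_le_A[of d] d by simp
  have "W d ^ 1 \<le> W d ^ l" using W_pos[of d] by (intro power_increasing) (auto simp: l_def)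
  then show "W d \<le> A" using 1 by simp
qed

lemma G_le_W: "G d \<le> W d" using m_gt_0 by (simp add: W_def)
lemma m2_le_W: "2 * m \<le> W d" using G_pos[of d] by (simp add: W_def)
lemma t_le_G: "t d \<le> G d"
proof -
  have "t d \<le> 2 ^ t d * 1" using less_exp[of "t d"] by simp
  also have "\<dots> \<le> G d" unfolding G_def by (intro mult_le_mono2) simp
  finally show ?thesis .
qed
lemma two_t_le_G: "2 ^ t d \<le> G d" unfolding G_def by simp

context
  fixes \<beta> :: nat
  assumes A_less: "A < 2 ^ \<beta>" and Q_less: "Suc (Q 0) * 2 ^ t 0 < 2 ^ \<beta>" and tb_less: "D * (G 0 * m) < 2 ^ \<beta>"
begin

lemma Q_less': "Suc (Q d) * 2 ^ t d < 2 ^ \<beta>"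
proof -
  have "Suc (Q d) * 2 ^ t d \<le> Suc (Q 0) * 2 ^ t 0"
    using Q_mono[of d] t_mono[of d] by (intro mult_le_mono power_increasing) auto
  then show ?thesis using Q_less by linarith
qed

lemma wp_level_init:
  assumes r: "r < D" and bdd: "bdd \<beta> s"
    and s: "env s" "tables r s" "var s vR = r" "var s vPw = 2 ^ (D - r)"
  shows "wp \<beta> 3 level_init (level r (D - Suc r)) s"
proof -
  let ?d = "D - Suc r"
  have d: "?d < D" using r by simp
  have pw: "2 ^ (D - r) div 2 = (2::nat) ^ ?d" using r by (simp add: Suc_diff_Suc[symmetric])
  have "?d < 2 ^ \<beta>" using bdd_var[OF bdd, of vD] s(1) by (simp add: env_def less_imp_diff_less)
  moreover have "(2::nat) ^ ?d < 2 ^ \<beta>"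
    using bdd_var[OF bdd, of vPw] s(4) pw by (metis div_le_dividend le_less_trans)
  moreover have "t ?d < 2 ^ \<beta>"
    using t_le_G[of ?d] G_le_W[of ?d] W_le_A(2)[OF d] A_less by linarith
  ultimately have "wp \<beta> (steps level_init) level_init (level r ?d) s"
    using s pw by (intro wp_straight[OF _ bdd])
      (simp_all add: level_init_def ok_exp_def level_def env_def tables_def t_def mult.commute)
  then show ?thesis by (rule wp_mono) (simp add: level_init_def)
qed

lemma wp_level_tables:
  assumes d: "d < D" and bdd: "bdd \<beta> s" and s: "level r d s" "D - r = Suc d"
  shows "wp \<beta> (20 + 6 * t 0 + 3 * l)
    (pow_com vG vTwo vT;; level_G;; pow_com vQ vM2 vT;; level_W;; pow_com vWl vW vl;; level_P)
    (\<lambda>s'. level r d s' \<and> var s' vG = G d \<and> var s' vQ = Q d \<and> arr s' aW d = W d \<and> arr s' aP d = P d \<and>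
      arr s' aTb d = var s' vTb) s"
proof -
  note le = t_le_G[of d] two_t_le_G[of d] G_le_W[of d] m2_le_W[of d] W_le_A[OF d] A_less
  define J1 where "J1 s \<longleftrightarrow> level r d s \<and> var s vG = 2 ^ t d" for s
  define J2 where "J2 s \<longleftrightarrow> level r d s \<and> var s vG = G d" for s
  define J3 where "J3 s \<longleftrightarrow> J2 s \<and> var s vQ = Q d" for s
  define J4 where "J4 s \<longleftrightarrow> J3 s \<and> var s vW = W d \<and> arr s aW d = W d" for s
  define J5 where "J5 s \<longleftrightarrow> J4 s \<and> var s vWl = W d ^ l" for s
  note J_defs = J1_def J2_def J3_def J4_def J5_def
  have 1: "wp \<beta> (3 + t d * 3) (pow_com vG vTwo vT) J1 s" if bdd: "bdd \<beta> s" and s: "level r d s" for s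
  proof -
    have "2 ^ t d < (2::nat) ^ \<beta>" using le by linarith
    then have "wp \<beta> (3 + t d * 3) (pow_com vG vTwo vT) (\<lambda>s'. var s' vG = var s vTwo ^ t d) s"
      using s by (intro wp_pow[OF bdd]) (simp_all add: level_def env_def)
    then show ?thesis
      by (rule wp_conseq) (use s level_frame[OF s] in \<open>auto simp: J_defs level_def env_def\<close>)
  qed
  have 2: "wp \<beta> 1 level_G J2 s" if bdd: "bdd \<beta> s" and s: "J1 s" for s
  proof -
    have "G d < 2 ^ \<beta>" using le by linarith
    then show ?thesis unfolding level_G_def using s
      by (intro wp_Assign[OF bdd]) (auto simp: ok_exp_def J_defs level_def env_def tables_def G_def)
  qed
  have 3: "wp \<beta> (3 + t d * 3) (pow_com vQ vM2 vT) J3 s" if bdd: "bdd \<beta> s" and s: "J2 s" for s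
  proof -
    have lev: "level r d s" using s by (simp add: J2_def)
    have "Q d * 1 \<le> Q d * 2 ^ t d" by (rule mult_le_mono2) simp
    then have "Q d < 2 ^ \<beta>" using Q_less'[of d] unfolding mult_Suc by linarith
    then have "wp \<beta> (3 + t d * 3) (pow_com vQ vM2 vT) (\<lambda>s'. var s' vQ = var s vM2 ^ t d) s"
      using lev m_gt_0 by (intro wp_pow[OF bdd]) (simp_all add: level_def env_def Q_def)
    then show ?thesis
    proof (rule wp_conseq)
      fix s' assume off: "same_off (wvars (pow_com vQ vM2 vT)) (warrs (pow_com vQ vM2 vT)) s s'"
        and q: "var s' vQ = var s vM2 ^ t d"
      show "J3 s'" using level_frame[OF lev off] same_offD(1)[OF off, of vG] s q lev
        by (simp add: J_defs level_def env_def Q_def)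
    qed simp
  qed
  have 4: "wp \<beta> 2 level_W J4 s" if bdd: "bdd \<beta> s" and s: "J3 s" for s
  proof -
    have "W d < 2 ^ \<beta>" using le by linarith
    then have "wp \<beta> (steps level_W) level_W J4 s" using s assms(1,4)
      by (intro wp_straight[OF _ bdd]) (auto simp: level_W_def ok_exp_def J_defs level_def env_def tables_def W_def)
    then show ?thesis by (rule wp_mono) (simp add: level_W_def)
  qed
  have 5: "wp \<beta> (3 + l * 3) (pow_com vWl vW vl) J5 s" if bdd: "bdd \<beta> s" and s: "J4 s" for s
  proof -
    have lev: "level r d s" using s by (simp add: J_defs)
    have "W d ^ l < 2 ^ \<beta>" using le by linarith
    then have "wp \<beta> (3 + l * 3) (pow_com vWl vW vl) (\<lambda>s'. var s' vWl = var s vW ^ l) s"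
      using s W_pos[of d] by (intro wp_pow[OF bdd]) (simp_all add: J_defs level_def env_def)
    then show ?thesis
    proof (rule wp_conseq)
      fix s' assume off: "same_off (wvars (pow_com vWl vW vl)) (warrs (pow_com vWl vW vl)) s s'"
        and q: "var s' vWl = var s vW ^ l"
      show "J5 s'" using level_frame[OF lev off] same_offD(1)[OF off, of vG] same_offD(1)[OF off, of vQ]
          same_offD(1)[OF off, of vW] same_offD(2)[OF off, of aW] s q
        by (simp add: J_defs)
    qed simp
  qed
  have 6: "wp \<beta> 2 level_P
    (\<lambda>s'. level r d s' \<and> var s' vG = G d \<and> var s' vQ = Q d \<and> arr s' aW d = W d \<and> arr s' aP d = P d \<and>
      arr s' aTb d = var s' vTb) s" if bdd: "bdd \<beta> s" and s: "J5 s" for s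
  proof -
    \<comment> \<open>The previous round stored this product; for the deepest level it is the empty
      product written by \<open>set_params\<close>.\<close>
    have P1: "arr s aP (Suc d) = P (Suc d)"
      using s assms(4) d by (cases "Suc d = D") (auto simp: J_defs level_def tables_def P_D)
    have P2: "W d ^ l * P (Suc d) = P d" using P_Suc[OF d] by simp
    have "P d < 2 ^ \<beta>" using P_le_A[of d] d A_less by simp
    then have "wp \<beta> (steps level_P) level_P
      (\<lambda>s'. level r d s' \<and> var s' vG = G d \<and> var s' vQ = Q d \<and> arr s' aW d = W d \<and> arr s' aP d = P d \<and>
      arr s' aTb d = var s' vTb) s" using s assms(1,4) P1 P2 bdd_var[OF bdd, of vTb]
      by (intro wp_straight[OF _ bdd]) (auto simp: level_P_def ok_exp_def J_defs level_def env_def tables_def)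
    then show ?thesis by (rule wp_mono) (simp add: level_P_def)
  qed
  show ?thesis
    by (rule wp_mono[OF wp_Seq_pred[where J = "level r d", OF 1 wp_Seq_pred[where J = J1, OF 2
        wp_Seq_pred[where J = J2, OF 3 wp_Seq_pred[where J = J3, OF 4
        wp_Seq_pred[where J = J4, OF 5 6]]]] bdd s(1)]]) (use t_mono[of d] in simp_all)
qed

lemma wp_level_members:
  assumes d: "d < D" "D - r = Suc d" and bdd: "bdd \<beta> s"
    and s: "level r d s \<and> var s vG = G d \<and> var s vQ = Q d \<and> arr s aW d = W d \<and> arr s aP d = P d \<and>
      arr s aTb d = var s vTb"
  shows "wp \<beta> (4 + 3 * Q 0 + G 0 * (7 + m * (8 + Q 0 * (t 0 * 20 + 9)) + Q 0 * (t 0 * 20 + 11)))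
    (For vC vQ (Write aAlive (Var vC) (Const 1));; For vg vG member_com)
    (\<lambda>s'. env s' \<and> tables (Suc r) s' \<and> var s' vR = r \<and> var s' vPw = 2 ^ d) s"
proof -
  let ?init = "Write aAlive (Var vC) (Const 1)"
  let ?J = "\<lambda>s'. level r d s' \<and> var s' vG = G d \<and> var s' vQ = Q d \<and> arr s' aW d = W d \<and> arr s' aP d = P d \<and>
      arr s' aTb d = var s' vTb \<and> (\<forall>c<Q d. arr s' aAlive c = 1)"
  let ?T = "5 + m * (8 + Q d * (t d * 20 + 9)) + Q d * (t d * 20 + 11)"
  have 1: "wp \<beta> (2 + Q d * (1 + 2)) (For vC vQ ?init) ?J s"
  proof (rule wp_For[where I = "\<lambda>j s'. \<forall>c<j. arr s' aAlive c = 1"])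
    fix j s' assume "\<forall>c<j. arr s' aAlive c = 1" "var s' vC = j" "bdd \<beta> s'"
    then show "wp \<beta> 1 ?init (\<lambda>s''. \<forall>c<Suc j. arr (set_var vC (Suc j) s'') aAlive c = 1) s'"
      using bdd_const[OF bdd, of 1] by (intro wp_Write) (auto simp: ok_exp_def less_Suc_eq)
  next
    fix s' assume off: "same_off (insert vC (wvars ?init)) (warrs ?init) s s'" and al: "\<forall>c<Q d. arr s' aAlive c = 1"
    show "?J s'" using level_frame[OF conjunct1[OF s] off] same_offD(1)[OF off] same_offD(2)[OF off] s al by simp
  qed (use bdd s in auto)
  have 2: "wp \<beta> (2 + G d * (?T + 2)) (For vg vG member_com)
    (\<lambda>s'. env s' \<and> tables (Suc r) s' \<and> var s' vR = r \<and> var s' vPw = 2 ^ d) s1"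
    if bdd1: "bdd \<beta> s1" and s1: "?J s1" for s1
  proof -
    define tb where "tb = var s1 vTb"
    have tb_le: "tb \<le> r * (G 0 * m)" using s1 by (simp add: level_def tables_def tb_def)
    let ?I = "\<lambda>j s'. var s' vTb = tb + j * m \<and> (\<forall>c<Q d. arr s' aAlive c = alive m (t d) j c) \<and>
      (\<forall>x<tb. arr s' aU x = arr s1 aU x) \<and> (\<forall>x\<ge>tb + j * m. arr s' aU x = 0) \<and>
      (\<forall>g<j. \<forall>x<m. arr s' aU (tb + g * m + x) = U d g x)"
    have tbm: "tb + G d * m \<le> Suc r * (G 0 * m)"
      using add_le_mono[OF tb_le mult_le_mono1[OF G_mono[of d], of m]] by (simp add: add.commute)
    have "Suc r * (G 0 * m) \<le> D * (G 0 * m)" using d by (intro mult_le_mono1) simp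
    then have tb_less': "tb + G d * m < 2 ^ \<beta>" using tbm tb_less by linarith
    show ?thesis
    proof (rule wp_For[where I = ?I])
      fix j s' assume j: "j < G d" and I: "?I j s'" and bdd': "bdd \<beta> s'"
        and off: "same_off (insert vg (wvars member_com)) (warrs member_com) s1 s'"
      have same: "var s' vM = m" "var s' vM2 = 2 * m" "var s' vT = t d" "var s' vQ = (2 * m) ^ t d"
        using same_offD(1)[OF off] s1 by (simp_all add: level_def env_def Q_def)
      have "Suc j * m \<le> G d * m" using j by (intro mult_le_mono1) simp
      then have less: "var s' vTb + m < 2 ^ \<beta>" using I tb_less' by simp
      have "wp \<beta> (5 + m * (8 + (2 * m) ^ t d * (t d * 20 + 9)) + (2 * m) ^ t d * (t d * 20 + 11)) member_com
        (\<lambda>s''. (\<forall>c < (2 * m) ^ t d. arr s'' aAlive c =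
            (if pat_weight m (t d) (alive m (t d) j) (greedy m (t d) (alive m (t d) j) m) m c = 0
             then alive m (t d) j c else 0)) \<and>
          (\<forall>x. arr s'' aU (var s' vTb + x) = greedy m (t d) (alive m (t d) j) m x) \<and>
          (\<forall>x < var s' vTb. arr s'' aU x = arr s' aU x) \<and> var s'' vTb = var s' vTb + m) s'"
        using I Q_less'[of d] by (intro wp_member[OF bdd' same(1,2) m_gt_0 same(3,4) _ alive_le _ _ less]) (auto simp: Q_def)
      then show "wp \<beta> ?T member_com (\<lambda>s''. ?I (Suc j) (set_var vg (Suc j) s'')) s'"
      proof (rule wp_conseq)
        fix s2 :: store
        assume R: "(\<forall>c < (2 * m) ^ t d. arr s2 aAlive c =
            (if pat_weight m (t d) (alive m (t d) j) (greedy m (t d) (alive m (t d) j) m) m c = 0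
             then alive m (t d) j c else 0)) \<and>
          (\<forall>x. arr s2 aU (var s' vTb + x) = greedy m (t d) (alive m (t d) j) m x) \<and>
          (\<forall>x < var s' vTb. arr s2 aU x = arr s' aU x) \<and> var s2 vTb = var s' vTb + m"
        have "arr s2 aU (tb + g * m + x) = U d g x" if g: "g < Suc j" and x: "x < m" for g x
        proof (cases "g = j")
          case True
          then show ?thesis using R I by (simp add: U_def family_def)
        next
          case False
          then have "Suc g * m \<le> j * m" using g by (intro mult_le_mono1) simp
          then have "tb + g * m + x < var s' vTb" using I x by simp
          then show ?thesis using R I g False x by simp
        qed
        moreover have "arr s2 aU x = 0" if x: "tb + Suc j * m \<le> x" for x
        proof -
          \<comment> \<open>Such a cell has index at least \<open>m\<close> relative to the new row,
            where \<open>greedy\<close> vanishes.\<close>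
          obtain y where y: "x = var s' vTb + (m + y)" using x I le_Suc_ex[OF x] by auto
          then have "arr s2 aU x = greedy m (t d) (alive m (t d) j) m (m + y)" using R by blast
          then show ?thesis by (simp add: greedy_beyond)
        qed
        ultimately show "?I (Suc j) (set_var vg (Suc j) s2)"
          using R I by (auto simp: Q_def)
      qed (simp add: Q_def)
    next
      fix s' assume I: "?I (G d) s'"
        and off: "same_off (insert vg (wvars member_com)) (warrs member_com) s1 s'"
      have env: "env s'" "var s' vR = r" "var s' vPw = 2 ^ d"
        using same_offD(1)[OF off] s1 by (simp_all add: level_def env_def)
      have arrs: "arr s' aW = arr s1 aW" "arr s' aP = arr s1 aP" "arr s' aTb = arr s1 aTb"
        using same_offD(2)[OF off] by simp_all
      have "arr s' aW e = W e \<and> arr s' aP e = P e \<and> arr s' aTb e + G e * m \<le> var s' vTb \<and>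
          (\<forall>g<G e. \<forall>x<m. arr s' aU (arr s' aTb e + g * m + x) = U e g x)"
        if e: "D - Suc r \<le> e" "e < D" for e
      proof (cases "e = d")
        case True
        then show ?thesis using s1 I by (simp add: arrs tb_def)
      next
        case False
        then have "D - r \<le> e" using e d by simp
        then have old: "arr s1 aW e = W e" "arr s1 aP e = P e" "arr s1 aTb e + G e * m \<le> tb"
          "\<And>g x. g < G e \<Longrightarrow> x < m \<Longrightarrow> arr s1 aU (arr s1 aTb e + g * m + x) = U e g x"
          using s1 e by (auto simp: level_def tables_def tb_def)
        have "arr s' aU (arr s' aTb e + g * m + x) = U e g x" if g: "g < G e" and x: "x < m" for g x
        proof -
          have "Suc g * m \<le> G e * m" using g by (intro mult_le_mono1) simp
          then have "arr s1 aTb e + g * m + x < tb" using old(3) x by simp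
          then show ?thesis using I old(4)[OF g x] by (simp add: arrs)
        qed
        then show ?thesis using old I by (simp add: arrs)
      qed
      moreover have "arr s' aP D = 1" using s1 by (simp add: arrs level_def tables_def)
      ultimately show "env s' \<and> tables (Suc r) s' \<and> var s' vR = r \<and> var s' vPw = 2 ^ d"
        using env I tbm by (simp add: tables_def)
    next
      show "?I 0 (set_var vg 0 s1)"
        using s1 by (simp add: tb_def level_def tables_def)
    qed (use bdd1 s1 in auto)
  qed
  show ?thesis
  proof (rule wp_mono[OF wp_Seq_pred[of \<beta> "(=) s", OF _ 2 bdd refl]])
    show "wp \<beta> (2 + Q d * (1 + 2)) (For vC vQ ?init) ?J s'" if "s = s'" for s' using 1 that by simp
    have "?T + 2 \<le> 7 + m * (8 + Q 0 * (t 0 * 20 + 9)) + Q 0 * (t 0 * 20 + 11)"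
    proof -
      have "?T \<le> 5 + m * (8 + Q 0 * (t 0 * 20 + 9)) + Q 0 * (t 0 * 20 + 11)"
        by (intro add_le_mono mult_le_mono order_refl t_mono Q_mono)
      then show ?thesis by simp
    qed
    then have "G d * (?T + 2) \<le> G 0 * (7 + m * (8 + Q 0 * (t 0 * 20 + 9)) + Q 0 * (t 0 * 20 + 11))"
      by (rule mult_le_mono[OF G_mono])
    then show "2 + Q d * (1 + 2) + (2 + G d * (?T + 2)) \<le>
        4 + 3 * Q 0 + G 0 * (7 + m * (8 + Q 0 * (t 0 * 20 + 9)) + Q 0 * (t 0 * 20 + 11))"
      using Q_mono[of d] by simp
  qed
qed

lemma wp_level:
  assumes r: "r < D" and bdd: "bdd \<beta> s"
    and s: "env s" "tables r s" "var s vR = r" "var s vPw = 2 ^ (D - r)"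
  shows "wp \<beta> level_time level_com
    (\<lambda>s'. env s' \<and> tables (Suc r) s' \<and> var s' vR = r \<and> var s' vPw = 2 ^ (D - Suc r)) s"
proof -
  have d: "D - Suc r < D" "D - r = Suc (D - Suc r)" using r by simp_all
  have 1: "wp \<beta> 3 level_init (level r (D - Suc r)) s'" if "s = s'" for s'
    using wp_level_init[OF r bdd s] that by simp
  have bound: "3 + (20 + 6 * a + 3 * b + (4 + 3 * c + x)) \<le> 50 + 6 * a + 3 * b + 3 * c + x" for a b c x :: nat
    by simp
  have 2: "wp \<beta> ((20 + 6 * t 0 + 3 * l) + (4 + 3 * Q 0 + G 0 * (7 + m * (8 + Q 0 * (t 0 * 20 + 9)) + Q 0 * (t 0 * 20 + 11))))
    ((pow_com vG vTwo vT;; level_G;; pow_com vQ vM2 vT;; level_W;; pow_com vWl vW vl;; level_P);;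
     For vC vQ (Write aAlive (Var vC) (Const 1));; For vg vG member_com)
    (\<lambda>s'. env s' \<and> tables (Suc r) s' \<and> var s' vR = r \<and> var s' vPw = 2 ^ (D - Suc r)) s'"
    if "bdd \<beta> s'" "level r (D - Suc r) s'" for s'
    by (rule wp_SeqI[OF wp_level_tables[OF d(1) that d(2)]]) (rule wp_level_members[OF d])
  show ?thesis unfolding level_com_def level_time_def
    by (rule wp_mono[OF wp_Seq_pred[where J = "(=) s" and J' = "level r (D - Suc r)", OF 1 2 bdd refl]])
      (assumption+, rule bound)
qed

end

lemma D_pos: "0 < D"
  using k_ge less_two_power_floorlog[of k] unfolding D_def by (intro gr0I) simp

definition setup_time :: nat where
  "setup_time = 20 + 3 * nb + 3 * D + 3 * L + D * (level_time + 2)"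

definition clean :: "store \<Rightarrow> bool" where
  "clean s \<longleftrightarrow> var s vN = n \<and> var s vK = k \<and> var s vTb = 0 \<and> (\<forall>x. arr s aU x = 0)"

lemma wp_setup:
  assumes bdd: "bdd \<beta> (input_store n k)"
    and less: "A < 2 ^ \<beta>" "Suc (Q 0) * 2 ^ t 0 < 2 ^ \<beta>" "D * (G 0 * m) < 2 ^ \<beta>"
      "2 * n + 1 < 2 ^ \<beta>" "2 * bnd + 1 < 2 ^ \<beta>"
  shows "wp \<beta> setup_time setup_com
    (\<lambda>s. env s \<and> tables D s \<and> var s vCount = 0 \<and> arr s aAcc = (\<lambda>_. 0)) (input_store n k)"
proof -
  define J1 where "J1 s \<longleftrightarrow> clean s \<and> var s vNb = nb" for s
  define J2 where "J2 s \<longleftrightarrow> clean s \<and> var s vNb = nb \<and> var s vD = D \<and> var s vPw = 2 ^ D" for s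
  define J3 where "J3 s \<longleftrightarrow> clean s \<and> var s vBnd = bnd \<and> var s vD = D \<and> var s vPw = 2 ^ D" for s
  define J4 where "J4 s \<longleftrightarrow> clean s \<and> var s vL = L \<and> var s vM = m \<and> var s vD = D \<and> var s vPw = 2 ^ D" for s
  define J5 where "J5 s \<longleftrightarrow> env s \<and> tables 0 s \<and> var s vPw = 2 ^ D" for s
  note J_defs = J1_def J2_def J3_def J4_def J5_def clean_def
  have 1: "wp \<beta> (3 + nb * 3) (log_com vNb vTmp vN) J1 s" if bdd: "bdd \<beta> s" and s: "input_store n k = s" for s
  proof -
    have v: "clean s" using s[symmetric] by (simp add: input_store_def clean_def)
    have "wp \<beta> (3 + floorlog 2 (var s vN) * 3) (log_com vNb vTmp vN)
      (\<lambda>s'. var s' vNb = floorlog 2 (var s vN) \<and> var s' vTmp = 2 ^ floorlog 2 (var s vN)) s"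
      using less v by (intro wp_log[OF bdd]) (simp_all add: clean_def)
    then show ?thesis
    proof (rule wp_conseq)
      fix s' assume off: "same_off (wvars (log_com vNb vTmp vN)) (warrs (log_com vNb vTmp vN)) s s'"
        and "var s' vNb = floorlog 2 (var s vN) \<and> var s' vTmp = 2 ^ floorlog 2 (var s vN)"
      then show "J1 s'" using same_offD[OF off] v by (simp add: J_defs nb_def)
    qed (use v in \<open>simp add: clean_def nb_def\<close>)
  qed
  have 2: "wp \<beta> (3 + D * 3) (log_com vD vPw vK) J2 s" if bdd: "bdd \<beta> s" and s: "J1 s" for s
  proof -
    have "wp \<beta> (3 + floorlog 2 (var s vK) * 3) (log_com vD vPw vK)
      (\<lambda>s'. var s' vD = floorlog 2 (var s vK) \<and> var s' vPw = 2 ^ floorlog 2 (var s vK)) s"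
      using less s k_le by (intro wp_log[OF bdd]) (simp_all add: J_defs)
    then show ?thesis
    proof (rule wp_conseq)
      fix s' assume off: "same_off (wvars (log_com vD vPw vK)) (warrs (log_com vD vPw vK)) s s'"
        and "var s' vD = floorlog 2 (var s vK) \<and> var s' vPw = 2 ^ floorlog 2 (var s vK)"
      then show "J2 s'" using same_offD[OF off] s by (simp add: J_defs D_def)
    qed (use s in \<open>simp add: J_defs D_def\<close>)
  qed
  have 3: "wp \<beta> 1 (vBnd ::= Const 2 \<otimes> (Var vK \<otimes> Var vK \<otimes> Var vNb) \<oplus> Const 1) J3 s"
    if bdd: "bdd \<beta> s" and s: "J2 s" for s
    using s less(5) by (intro wp_Assign[OF bdd]) (auto simp: ok_exp_def J_defs bnd_def)
  have 4: "wp \<beta> (3 + L * 3) (log_com vL vM vBnd) J4 s" if bdd: "bdd \<beta> s" and s: "J3 s" for s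
  proof -
    have "wp \<beta> (3 + floorlog 2 (var s vBnd) * 3) (log_com vL vM vBnd)
      (\<lambda>s'. var s' vL = floorlog 2 (var s vBnd) \<and> var s' vM = 2 ^ floorlog 2 (var s vBnd)) s"
      using less s by (intro wp_log[OF bdd]) (simp_all add: J_defs)
    then show ?thesis
    proof (rule wp_conseq)
      fix s' assume off: "same_off (wvars (log_com vL vM vBnd)) (warrs (log_com vL vM vBnd)) s s'"
        and "var s' vL = floorlog 2 (var s vBnd) \<and> var s' vM = 2 ^ floorlog 2 (var s vBnd)"
      then show "J4 s'" using same_offD[OF off] s by (simp add: J_defs L_def m_def)
    qed (use s in \<open>simp add: J_defs L_def\<close>)
  qed
  have 5: "wp \<beta> 4 set_params J5 s" if bdd: "bdd \<beta> s" and s: "J4 s" for s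
  proof -
    have "2 * m < 2 ^ \<beta>" using m2_le_W[of 0] W_le_A(2)[OF D_pos] less(1) by linarith
    moreover have "L < 2 ^ L" by (rule less_exp)
    then have "Suc L \<le> m" unfolding m_def by (rule Suc_leI)
    ultimately have "2 * m < 2 ^ \<beta>" "Suc (Suc L) < 2 ^ \<beta>" using m_gt_0 by linarith+
    then have "wp \<beta> (steps set_params) set_params J5 s"
      using s bdd_const[OF bdd] by (intro wp_straight[OF _ bdd])
        (auto simp: set_params_def ok_exp_def J_defs env_def tables_def l_def)
    then show ?thesis by (rule wp_mono) (simp add: set_params_def)
  qed
  have 6: "wp \<beta> (2 + D * (level_time + 2)) (For vR vD level_com) (\<lambda>s. env s \<and> tables D s) s"
    if bdd: "bdd \<beta> s" and s: "J5 s" for s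
  proof (rule wp_For[where I = "\<lambda>r s. env s \<and> tables r s \<and> var s vPw = 2 ^ (D - r)"])
    fix r s' assume r: "r < D" and I: "env s' \<and> tables r s' \<and> var s' vPw = 2 ^ (D - r)"
      and v: "var s' vR = r" and bdd': "bdd \<beta> s'"
    have "wp \<beta> level_time level_com
      (\<lambda>s'. env s' \<and> tables (Suc r) s' \<and> var s' vR = r \<and> var s' vPw = 2 ^ (D - Suc r)) s'"
      using I v by (intro wp_level[OF less(1-3) r bdd']) auto
    then show "wp \<beta> level_time level_com (\<lambda>s''. env (set_var vR (Suc r) s'') \<and> tables (Suc r) (set_var vR (Suc r) s'') \<and>
        var (set_var vR (Suc r) s'') vPw = 2 ^ (D - Suc r)) s'"
      by (rule wp_conseq) (auto simp: env_def tables_def)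
  qed (use bdd s in \<open>auto simp: J5_def env_def tables_def\<close>)
  have "wp \<beta> setup_time setup_com (\<lambda>s. env s \<and> tables D s) (input_store n k)"
    unfolding setup_com_def setup_time_def
    by (rule wp_mono[OF wp_Seq_pred[where J = "(=) (input_store n k)", OF 1 wp_Seq_pred[where J = J1, OF 2
        wp_Seq_pred[where J = J2, OF 3 wp_Seq_pred[where J = J3, OF 4
        wp_Seq_pred[where J = J4, OF 5 6]]]] bdd refl]]) simp_all
  then show ?thesis
  proof (rule wp_conseq)
    fix s assume off: "same_off (wvars setup_com) (warrs setup_com) (input_store n k) s"
      and s: "env s \<and> tables D s"
    have "vCount \<notin> wvars setup_com" "aAcc \<notin> warrs setup_com"
      by (simp_all add: setup_com_def set_params_def)
    then have "var s vCount = 0" "arr s aAcc = (\<lambda>_. 0)"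
      using same_offD[OF off] by (simp_all add: input_store_def)
    then show "env s \<and> tables D s \<and> var s vCount = 0 \<and> arr s aAcc = (\<lambda>_. 0)" using s by simp
  qed simp
qed

end

section \<open>Writing down the transitions\<close>

definition emit_com :: com where
  "emit_com = Write aSrc (Var vCount) (Var vq);; Write aLab (Var vCount) (Var vLab);;
     Write aDst (Var vCount) (Var vNxt);; vCount ::= Var vCount \<oplus> Const 1"

definition edges :: "store \<Rightarrow> (nat \<times> nat option \<times> nat) set" where
  "edges s = {(arr s aSrc j, if arr s aLab j = 0 then None else Some (arr s aLab j), arr s aDst j) | j.
     j < var s vCount}"

lemma edges_emit:
  "edges (run emit_com s) =
     insert (var s vq, if var s vLab = 0 then None else Some (var s vLab), var s vNxt) (edges s)"
proof -
  have "edges (run emit_com s) =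
    (\<lambda>j. (arr (run emit_com s) aSrc j, if arr (run emit_com s) aLab j = 0 then None
       else Some (arr (run emit_com s) aLab j), arr (run emit_com s) aDst j)) ` {..<Suc (var s vCount)}"
    by (auto simp: edges_def emit_com_def)
  also have "\<dots> = insert (var s vq, if var s vLab = 0 then None else Some (var s vLab), var s vNxt) (edges s)"
    unfolding lessThan_Suc image_insert
    by (intro arg_cong2[where f = insert]) (auto simp: edges_def emit_com_def image_def)
  finally show ?thesis .
qed

lemma var_emit: "var (run emit_com s) x = (if x = vCount then Suc (var s vCount) else var s x)"
  by (simp add: emit_com_def)

lemma edges_cong:
  "arr s' aSrc = arr s aSrc \<Longrightarrow> arr s' aLab = arr s aLab \<Longrightarrow> arr s' aDst = arr s aDst \<Longrightarrow>
   var s' vCount = var s vCount \<Longrightarrow> edges s' = edges s"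
  by (simp add: edges_def)

text \<open>Levels are tried from 0 on, and \<open>vBl = 0\<close> means that none has been found
  yet. This is unambiguous because blocks are positive.\<close>

definition block_body :: com where
  "block_body = Cond (Var vBl \<doteq> Const 0)
     (Cond (Var vI \<otimes> Var vPw \<odot> Var vK \<prec> Var vPw) (vBl ::= Read aP (Var vDd)) Skip) Skip;;
     vPw ::= Const 2 \<otimes> Var vPw"

definition block_com :: com where
  "block_com = (vBl ::= Const 0;; vPw ::= Const 1);; For vDd vD1 block_body"

text \<open>Digits arrive lowest first and later hits overwrite earlier ones, so the highest digit
  with a small enough threshold wins, as in \<open>lookup\<close>.\<close>

definition lookup_body :: com where
  "lookup_body = vZ ::= Var vF \<odot> Read aW (Var vDd);; vF ::= Var vF \<oslash> Read aW (Var vDd);;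
     Cond (Var vCol \<prec> Var vZ \<odot> Var vM2) Skip
       (vBit ::= Read aU (Read aTb (Var vDd) \<oplus> Var vZ \<oslash> Var vM2 \<otimes> Var vM \<oplus> Var vCol))"

definition check_body :: com where
  "check_body = (vF ::= Var vY \<oslash> Read aP (Var vDd \<oplus> Const 1);; vBit ::= Const 0);;
     For vBi vl lookup_body;;
     (vPw ::= Const 2 \<otimes> Var vPw;;
      Cond (Var vBit \<doteq> Var vI \<otimes> Var vPw \<oslash> Var vK \<odot> Const 2) Skip (vOk ::= Const 0))"

definition check_com :: com where
  "check_com = (vOk ::= Const 1;; vPw ::= Const 1);; For vDd vD check_body"

text \<open>The counter starts at 0 but letters start at 1, since label 0 encodes epsilon.\<close>

definition letter_body :: com where
  "letter_body = (va ::= Var vAi \<oplus> Const 1;; vCol ::= Var va \<odot> Var vMd);; check_com;;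
     Cond (Var vOk) (vLab ::= Var va;; emit_com) Skip"

definition state_init :: com where
  "state_init = vI ::= Var vq \<oslash> Var vA;; vY ::= Var vq \<odot> Var vA"

text \<open>\<open>vI\<close> is advanced so that the same \<open>block_com\<close> computes the
  block of the next position; \<open>state_next\<close> moves it back.\<close>

definition state_eps :: com where
  "state_eps = vNxt ::= Var vq \<oplus> Const 1;;
     Cond (Var vNxt \<odot> Var vBl) (vLab ::= Const 0;; emit_com) Skip;; vI ::= Var vI \<oplus> Const 1"

definition state_next :: com where
  "state_next = vNxt ::= Var vq \<oplus> Var vA \<ominus> Var vq \<odot> Var vBl;; vI ::= Var vI \<ominus> Const 1;;
     vMd ::= Var vY \<oslash> Var vV \<oplus> Const 1"

definition state_body :: com where
  "state_body = state_init;; block_com;; state_eps;; block_com;; state_next;; For vAi vN letter_body"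

definition main_init :: com where
  "main_init = vV ::= Read aP (Const 0);; vA ::= Var vV \<otimes> Var vM;; Write aP (Const 0) (Var vA);;
     vKA ::= Var vK \<otimes> Var vA;; vD1 ::= Var vD \<oplus> Const 1"

text \<open>Variables 0 and 1 turn from the inputs \<open>n\<close>, \<open>k\<close> into the
  number of states and the start state, hence only at the very end.\<close>

definition main_final :: com where
  "main_final = Write aAcc (Var vKA) (Const 1);; vN ::= Var vKA \<oplus> Const 1;; vK ::= Const 0"

definition program :: com where
  "program = setup_com;; main_init;; For vq vKA state_body;; main_final"

lemma wvars_block [simp]: "wvars block_com = {vBl, vPw, vDd}"
  and warrs_block [simp]: "warrs block_com = {}"
  and wvars_check [simp]: "wvars check_com = {vOk, vPw, vDd, vF, vBit, vBi, vZ}"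
  and warrs_check [simp]: "warrs check_com = {}"
  and wvars_emit [simp]: "wvars emit_com = {vCount}"
  and warrs_emit [simp]: "warrs emit_com = {aSrc, aLab, aDst}"
  by (auto simp: block_com_def block_body_def check_com_def check_body_def lookup_body_def emit_com_def)

lemma wvars_letter [simp]: "wvars letter_body = {va, vCol, vOk, vPw, vDd, vF, vBit, vBi, vZ, vLab, vCount}"
  and warrs_letter [simp]: "warrs letter_body = {aSrc, aLab, aDst}"
  by (auto simp: letter_body_def)

section \<open>Correctness of the main loop\<close>

context parameters begin

text \<open>In the main loop cell \<open>0\<close> of \<open>aP\<close> holds \<open>A\<close> instead of \<open>P 0\<close>, so that \<open>aP\<close> lists the possible
  values of \<open>block\<close>.\<close>

definition menv :: "store \<Rightarrow> bool" where
  "menv s \<longleftrightarrow> env s \<and> var s vV = P 0 \<and> var s vA = A \<and> var s vKA = k * A \<and> var s vD1 = Suc D \<and>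
     (\<forall>d\<le>D. arr s aP d = (if d = 0 then A else P d)) \<and>
     (\<forall>d<D. arr s aW d = W d \<and> (\<forall>g<G d. \<forall>x<m. arr s aU (arr s aTb d + g * m + x) = U d g x)) \<and>
     arr s aAcc = (\<lambda>_. 0)"

lemma menv_frame:
  assumes "menv s" "same_off X B s s'"
    and "X \<inter> {vN, vK, vD, vL, vM, vM2, vl, vTwo, vV, vA, vKA, vD1} = {}" "B \<inter> {aP, aW, aU, aTb, aAcc} = {}"
  shows "menv s'"
proof -
  have "var s' x = var s x" if "x \<in> {vN, vK, vD, vL, vM, vM2, vl, vTwo, vV, vA, vKA, vD1}" for x
    using that assms(3) by (intro same_offD(1)[OF assms(2)]) blast
  moreover have "arr s' a = arr s a" if "a \<in> {aP, aW, aU, aTb, aAcc}" for a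
    using that assms(4) by (intro same_offD(2)[OF assms(2)]) blast
  ultimately show ?thesis using assms(1) by (simp add: menv_def env_def)
qed

definition block_time :: nat where "block_time = 4 + Suc D * 8"
definition check_time :: nat where "check_time = 4 + D * (10 + 7 * l)"
definition state_time :: nat where "state_time = 20 + 2 * block_time + n * (11 + check_time)"

text \<open>\<open>less\<close> covers the last doubling of \<open>vPw\<close>, which happens after
  level \<open>D\<close> has been tested.\<close>

lemma wp_block:
  assumes bdd: "bdd \<beta> s" and s: "menv s" and less: "2 ^ Suc D < (2::nat) ^ \<beta>"
  shows "wp \<beta> block_time block_com (\<lambda>s'. var s' vBl = block (var s vI)) s"
proof -
  let ?i = "var s vI" and ?init = "vBl ::= Const 0;; vPw ::= Const 1"
  let ?I = "\<lambda>j s'. var s' vPw = 2 ^ j \<and> var s' vBl = (if \<exists>d<j. starts d ?i then block ?i else 0)"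
  let ?s0 = "run ?init s"
  have "wp \<beta> (steps ?init + (2 + Suc D * (steps block_body + 2))) block_com (\<lambda>s'. var s' vBl = block ?i) s"
    unfolding block_com_def
  proof (rule wp_straight_Seq)
    show "straight ?init" by (simp add: ok_exp_def)
    show "safe \<beta> ?init s" using bdd_const[OF bdd, of 0] bdd_const[OF bdd, of 1] by simp
    assume bdd0: "bdd \<beta> ?s0"
    show "wp \<beta> (2 + Suc D * (steps block_body + 2)) (For vDd vD1 block_body) (\<lambda>s'. var s' vBl = block ?i) ?s0"
    proof (rule wp_For[where I = ?I])
      fix j s' assume j: "j < Suc D" and I: "?I j s'" and dd: "var s' vDd = j" and bdd': "bdd \<beta> s'"
        and off: "same_off (insert vDd (wvars block_body)) (warrs block_body) ?s0 s'"
      have same: "var s' vK = k" "var s' vI = ?i" "arr s' aP j = (if j = 0 then A else P j)"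
        using same_offD(1)[OF off] same_offD(2)[OF off] s j by (simp_all add: block_body_def menv_def env_def)
      have K: "var s' (Suc 0) = k" using same(1) by simp
      have "(2::nat) ^ Suc j \<le> 2 ^ Suc D" using j by (intro power_increasing) auto
      then have pw: "2 * 2 ^ j < (2::nat) ^ \<beta>" using less unfolding power_Suc by linarith
      have blk: "arr s' aP j = block ?i" if "\<not> (\<exists>d<j. starts d ?i)" "starts j ?i"
      proof -
        have "(LEAST d. starts d ?i) = j"
          using that by (intro Least_equality) (auto simp: not_less[symmetric])
        then show ?thesis by (simp add: block_def same)
      qed
      have st: "starts j ?i \<longleftrightarrow> ?i * 2 ^ j mod k < 2 ^ j" by (simp add: starts_def)
      have ap: "arr s' aP j < 2 ^ \<beta>" by (rule bdd_arr[OF bdd'])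
      have ex: "(\<exists>d<Suc j. starts d ?i) \<longleftrightarrow> (\<exists>d<j. starts d ?i) \<or> starts j ?i" by (auto simp: less_Suc_eq)
      have bp: "0 < block ?i" by (rule block_pos)
      show "wp \<beta> (steps block_body) block_body (\<lambda>s''. ?I (Suc j) (set_var vDd (Suc j) s'')) s'"
      proof (rule wp_straight)
        show "straight block_body" by (simp add: block_body_def ok_exp_def)
        show "safe \<beta> block_body s'"
          using I dd pw ap K by (simp add: block_body_def same(2))
        show "?I (Suc j) (set_var vDd (Suc j) (run block_body s'))"
        proof (cases "\<exists>d<j. starts d ?i")
          case True
          then show ?thesis using I bp ex by (simp add: block_body_def)
        next
          case False
          show ?thesis
          proof (cases "starts j ?i")
            case True
            then have "?i * 2 ^ j mod k < 2 ^ j" using st by simp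
            then show ?thesis using I dd False True blk ex K by (simp add: block_body_def same(2))
          next
            case not_starts: False
            then have "\<not> ?i * 2 ^ j mod k < 2 ^ j" using st by simp
            moreover have "\<not> (\<exists>d<Suc j. starts d ?i)" using ex False not_starts by blast
            ultimately show ?thesis using I dd False K by (auto simp: block_body_def same(2))
          qed
        qed
      qed (rule bdd')
    next
      fix s' assume "?I (Suc D) s'"
      then show "var s' vBl = block ?i" using starts_D[of ?i] by auto
    qed (use bdd0 s in \<open>simp_all add: block_body_def menv_def\<close>)
  qed (rule bdd)
  then show ?thesis by (rule wp_mono) (simp add: block_body_def block_time_def)
qed

lemma wp_lookup:
  assumes bdd: "bdd \<beta> s" and s: "menv s" and d: "var s vDd = d" "d < D"
    and x: "var s vCol = x" "x < m" and bit: "var s vBit = 0" and f: "var s vF = f"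
  shows "wp \<beta> (2 + l * 7) (For vBi vl lookup_body) (\<lambda>s'. var s' vBit = lookup d f x l) s"
proof -
  let ?I = "\<lambda>b s'. var s' vF = f div W d ^ b \<and> var s' vBit = lookup d f x b"
  have "wp \<beta> (2 + l * (steps lookup_body + 2)) (For vBi vl lookup_body) (\<lambda>s'. var s' vBit = lookup d f x l) s"
  proof (rule wp_For[where I = ?I])
    fix b s' assume b: "b < l" and I: "?I b s'" and bdd': "bdd \<beta> s'"
      and off: "same_off (insert vBi (wvars lookup_body)) (warrs lookup_body) s s'"
    have menv: "menv s'" using s off by (rule menv_frame) (simp_all add: lookup_body_def)
    have same: "var s' vDd = d" "var s' vCol = x"
      using same_offD(1)[OF off] d x by (simp_all add: lookup_body_def)
    have env: "arr s' aW d = W d" "var s' vM = m" "var s' vM2 = 2 * m"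
      "\<And>g. g < G d \<Longrightarrow> arr s' aU (arr s' aTb d + g * m + x) = U d g x"
      using menv d x by (auto simp: menv_def env_def)
    let ?z = "f div W d ^ b mod W d"
    have "?z < W d" using W_pos[of d] by simp
    then have "?z < G d * (2 * m)" by (simp add: W_def mult.commute)
    \<comment> \<open>The function index read from any digit is in range, so the access hits a
      filled row.\<close>
    then have "?z div (2 * m) < G d" by (rule less_mult_imp_div_less)
    then have u: "arr s' aU (arr s' aTb d + ?z div (2 * m) * m + x) = U d (?z div (2 * m)) x"
      by (rule env(4))
    have f': "f div W d ^ b div W d = f div W d ^ Suc b"
      by (simp add: div_mult2_eq[symmetric] mult.commute)
    have F: "var s' vF = f div W d ^ b" "var s' vBit = lookup d f x b" using I by auto
    have z_less: "?z < 2 ^ \<beta>" "f div W d ^ b div W d < 2 ^ \<beta>"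
      using bdd_var[OF bdd', of vF] F(1) le_less_trans[OF mod_less_eq_dividend] le_less_trans[OF div_le_dividend]
      by metis+
    have u_less: "U d (?z div (2 * m)) x < 2 ^ \<beta>"
      unfolding u[symmetric] by (rule bdd_arr[OF bdd'])
    show "wp \<beta> (steps lookup_body) lookup_body (\<lambda>s''. ?I (Suc b) (set_var vBi (Suc b) s'')) s'"
    proof (rule wp_straight)
      show "straight lookup_body" by (simp add: lookup_body_def ok_exp_def)
      show "safe \<beta> lookup_body s'"
        by (simp add: lookup_body_def same env(1-3) F z_less u u_less)
      show "?I (Suc b) (set_var vBi (Suc b) (run lookup_body s'))"
        by (simp add: lookup_body_def same env(1-3) F u f'[symmetric] Let_def not_less del: power_Suc)
    qed (rule bdd')
  qed (use bdd s bit f in \<open>simp_all add: lookup_body_def menv_def env_def\<close>)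
  then show ?thesis by (rule wp_mono) (simp add: lookup_body_def)
qed

lemma wp_check:
  assumes bdd: "bdd \<beta> s" and s: "menv s" and less: "2 ^ Suc D < (2::nat) ^ \<beta>"
    and x: "var s vCol = x" "x < m"
  shows "wp \<beta> check_time check_com
    (\<lambda>s'. var s' vOk = of_bool (\<forall>d<D. lookup d (var s vY div P (Suc d)) x l = half d (var s vI))) s"
proof -
  let ?y = "var s vY" and ?i = "var s vI" and ?init = "vOk ::= Const 1;; vPw ::= Const 1"
  let ?s0 = "run ?init s"
  let ?good = "\<lambda>d. lookup d (?y div P (Suc d)) x l = half d ?i"
  let ?I = "\<lambda>j s'. var s' vPw = 2 ^ j \<and> var s' vOk = of_bool (\<forall>d<j. ?good d)"
  let ?fst = "vF ::= Var vY \<oslash> Read aP (Var vDd \<oplus> Const 1);; vBit ::= Const 0"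
  let ?snd = "vPw ::= Const 2 \<otimes> Var vPw;;
      Cond (Var vBit \<doteq> Var vI \<otimes> Var vPw \<oslash> Var vK \<odot> Const 2) Skip (vOk ::= Const 0)"
  have "wp \<beta> (steps ?init + (2 + D * ((steps ?fst + ((2 + l * 7) + steps ?snd)) + 2))) check_com
    (\<lambda>s'. var s' vOk = of_bool (\<forall>d<D. ?good d)) s"
    unfolding check_com_def
  proof (rule wp_straight_Seq)
    show "straight ?init" by (simp add: ok_exp_def)
    show "safe \<beta> ?init s" using bdd_const[OF bdd, of 1] by simp
    assume bdd0: "bdd \<beta> ?s0"
    show "wp \<beta> (2 + D * ((steps ?fst + ((2 + l * 7) + steps ?snd)) + 2)) (For vDd vD check_body)
      (\<lambda>s'. var s' vOk = of_bool (\<forall>d<D. ?good d)) ?s0"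
    proof (rule wp_For[where I = ?I])
      fix d s' assume d: "d < D" and I: "?I d s'" and dd: "var s' vDd = d" and bdd': "bdd \<beta> s'"
        and off: "same_off (insert vDd (wvars check_body)) (warrs check_body) ?s0 s'"
      have "same_off (insert vDd (wvars check_com)) (warrs check_com) s s'"
        using off by (auto simp: same_off_def check_body_def lookup_body_def)
      from menv_frame[OF s this] have menv: "menv s'" by simp
      have same: "var s' vY = ?y" "var s' vI = ?i" "var s' vCol = x"
        using same_offD(1)[OF off] x by (simp_all add: check_body_def lookup_body_def)
      have p: "arr s' aP (Suc d) = P (Suc d)" using menv d by (simp add: menv_def)
      have pw: "2 * 2 ^ d < (2::nat) ^ \<beta>"
      proof -
        have "(2::nat) ^ Suc d \<le> 2 ^ Suc D" using d by (intro power_increasing) auto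
        then show ?thesis using less unfolding power_Suc by linarith
      qed
      have y: "?y div P (Suc d) < 2 ^ \<beta>"
        using bdd_var[OF bdd, of vY] by (rule le_less_trans[OF div_le_dividend])
      show "wp \<beta> (steps ?fst + ((2 + l * 7) + steps ?snd)) check_body
        (\<lambda>s''. ?I (Suc d) (set_var vDd (Suc d) s'')) s'"
        unfolding check_body_def
      proof (rule wp_straight_Seq)
        show "straight ?fst" by (simp add: ok_exp_def)
        show "safe \<beta> ?fst s'" using bdd_const[OF bdd, of 0] y by (simp add: dd same p)
        assume bdd1: "bdd \<beta> (run ?fst s')"
        have "same_off {vF, vBit} {} s' (run ?fst s')" by (simp add: same_off_def)
        from menv_frame[OF menv this] have menv1: "menv (run ?fst s')" by simp
        have "wp \<beta> (2 + l * 7) (For vBi vl lookup_body) (\<lambda>s'. var s' vBit = lookup d (?y div P (Suc d)) x l) (run ?fst s')"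
          by (rule wp_lookup[OF bdd1 menv1 _ d _ x(2)]) (simp_all add: dd same p)
        then show "wp \<beta> ((2 + l * 7) + steps ?snd) (For vBi vl lookup_body;; ?snd)
          (\<lambda>s''. ?I (Suc d) (set_var vDd (Suc d) s'')) (run ?fst s')"
        proof (rule wp_SeqI)
          fix s2 assume off2: "same_off (wvars (For vBi vl lookup_body)) (warrs (For vBi vl lookup_body)) (run ?fst s') s2"
            and bdd2: "bdd \<beta> s2" and bit: "var s2 vBit = lookup d (?y div P (Suc d)) x l"
          have same2: "var s2 vPw = 2 ^ d" "var s2 vOk = of_bool (\<forall>d'<d. ?good d')" "var s2 vI = ?i" "var s2 vK = k"
            using same_offD(1)[OF off2] I same menv by (simp_all add: lookup_body_def menv_def env_def)
          have half: "?i * (2 * 2 ^ d) div k mod 2 = half d ?i" by (simp add: half_def)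
          have all: "(\<forall>d'<Suc d. ?good d') \<longleftrightarrow> (\<forall>d'<d. ?good d') \<and> ?good d" by (auto simp: less_Suc_eq)
          show "wp \<beta> (steps ?snd) ?snd (\<lambda>s''. ?I (Suc d) (set_var vDd (Suc d) s'')) s2"
          proof (rule wp_straight)
            show "straight ?snd" by (simp add: ok_exp_def)
            show "safe \<beta> ?snd s2" using bdd_const[OF bdd, of 0] pw by (simp add: same2)
            show "?I (Suc d) (set_var vDd (Suc d) (run ?snd s2))"
              unfolding all using same2(4) by (simp add: same2(1-3) bit half)
          qed (rule bdd2)
        qed
      qed (rule bdd')
    qed (use bdd0 s in \<open>simp_all add: check_body_def lookup_body_def menv_def env_def\<close>)
  qed (rule bdd)
  then show ?thesis by (rule wp_mono) (simp add: check_time_def algebra_simps)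
qed


lemma wp_emit:
  assumes "bdd \<beta> s" "Suc (var s vCount) < 2 ^ \<beta>"
    and "R (run emit_com s)"
  shows "wp \<beta> 4 emit_com R s"
proof -
  have "wp \<beta> (steps emit_com) emit_com R s"
    using assms bdd_var[OF assms(1)] by (intro wp_straight) (simp_all add: emit_com_def ok_exp_def)
  then show ?thesis by (rule wp_mono) (simp add: emit_com_def)
qed

lemma wp_letters:
  assumes bdd: "bdd \<beta> s" and s: "menv s" and less: "2 ^ Suc D < (2::nat) ^ \<beta>" "Suc (var s vCount + n) < 2 ^ \<beta>"
    and y: "var s vY = y" "y < A" and Md: "var s vMd = y div P 0 + 1"
  shows "wp \<beta> (2 + n * (11 + check_time)) (For vAi vN letter_body)
    (\<lambda>s'. edges s' = edges s \<union> {(var s vq, Some a, var s vNxt) | a. a \<in> {1..n} \<and> allowed (var s vI) y a} \<and>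
       var s' vCount \<le> var s vCount + n) s"
proof -
  let ?q = "var s vq" and ?nx = "var s vNxt" and ?i = "var s vI" and ?c = "var s vCount"
  let ?I = "\<lambda>j s'. edges s' = edges s \<union> {(?q, Some a, ?nx) | a. a \<in> {1..j} \<and> allowed ?i y a} \<and>
       var s' vCount \<le> ?c + j"
  let ?fst = "va ::= Var vAi \<oplus> Const 1;; vCol ::= Var va \<odot> Var vMd"
  let ?snd = "Cond (Var vOk) (vLab ::= Var va;; emit_com) Skip"
  have "wp \<beta> (2 + n * ((steps ?fst + (check_time + 7)) + 2)) (For vAi vN letter_body)
    (\<lambda>s'. edges s' = edges s \<union> {(?q, Some a, ?nx) | a. a \<in> {1..n} \<and> allowed ?i y a} \<and>
       var s' vCount \<le> ?c + n) s"
  proof (rule wp_For[where I = ?I])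
    fix j s' assume j: "j < n" and I: "?I j s'" and Ai: "var s' vAi = j" and bdd': "bdd \<beta> s'"
      and off: "same_off (insert vAi (wvars letter_body)) (warrs letter_body) s s'"
    have menv: "menv s'" using menv_frame[OF s off] by simp
    have same: "var s' vq = ?q" "var s' vNxt = ?nx" "var s' vI = ?i" "var s' vY = y" "var s' vMd = y div P 0 + 1"
      using same_offD(1)[OF off] y Md by simp_all
    define x where "x = colour y (Suc j)"
    have x: "Suc j mod (y div P 0 + 1) = x" by (simp add: x_def colour_def)
    \<comment> \<open>The modulus is at most \<open>m\<close>, so the colour stays within one row of
      the table.\<close>
    have "y div P 0 < m" using y(2) P_pos[of 0] by (simp add: A_def div_less_iff_less_mult mult.commute)
    moreover have "x < y div P 0 + 1" unfolding x[symmetric] by (rule mod_less_divisor) simp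
    ultimately have x_less: "x < m" by linarith
    have n: "n < 2 ^ \<beta>" using less(2) by simp
    have x_less': "x < 2 ^ \<beta>"
      using mod_less_eq_dividend[of "Suc j" "y div P 0 + 1"] j n unfolding x by linarith
    show "wp \<beta> (steps ?fst + (check_time + 7)) letter_body (\<lambda>s''. ?I (Suc j) (set_var vAi (Suc j) s'')) s'"
      unfolding letter_body_def
    proof (rule wp_straight_Seq)
      show "straight ?fst" by (simp add: ok_exp_def)
      show "safe \<beta> ?fst s'" using j n x x_less' by (simp add: Ai same)
      assume bdd1: "bdd \<beta> (run ?fst s')"
      let ?s1 = "run ?fst s'"
      have "same_off {va, vCol} {} s' ?s1" by (simp add: same_off_def)
      from menv_frame[OF menv this] have menv1: "menv ?s1" by simp
      have s1: "var ?s1 vCol = x" "var ?s1 vY = y" "var ?s1 vI = ?i" "var ?s1 va = Suc j" "var ?s1 vq = ?q"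
        "var ?s1 vNxt = ?nx" "edges ?s1 = edges s'" "var ?s1 vCount = var s' vCount"
        using x by (simp_all add: Ai same edges_def)
      have "wp \<beta> check_time check_com (\<lambda>s2. var s2 vOk = of_bool (allowed ?i y (Suc j))) ?s1"
        using wp_check[OF bdd1 menv1 less(1) s1(1) x_less] unfolding s1(2,3) allowed_def x_def by simp
      then show "wp \<beta> (check_time + 7) (check_com;; ?snd) (\<lambda>s''. ?I (Suc j) (set_var vAi (Suc j) s'')) ?s1"
      proof (rule wp_SeqI)
        fix s2 assume off2: "same_off (wvars check_com) (warrs check_com) ?s1 s2" and bdd2: "bdd \<beta> s2"
          and ok: "var s2 vOk = of_bool (allowed ?i y (Suc j))"
        have s2: "var s2 va = Suc j" "var s2 vq = ?q" "var s2 vNxt = ?nx" "var s2 vCount = var s' vCount"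
          using same_offD(1)[OF off2] s1 by simp_all
        have e2: "edges s2 = edges s'" using same_offD[OF off2] s1(7) by (simp add: edges_def)
        have split: "{(?q, Some a, ?nx) | a. a \<in> {1..Suc j} \<and> allowed ?i y a} =
            (if allowed ?i y (Suc j) then {(?q, Some (Suc j), ?nx)} else {}) \<union>
            {(?q, Some a, ?nx) | a. a \<in> {1..j} \<and> allowed ?i y a}"
          by (auto simp: le_Suc_eq)
        have "wp \<beta> ((1 + 4) + 1 + 1) ?snd (\<lambda>s''. ?I (Suc j) (set_var vAi (Suc j) s'')) s2"
        proof (rule wp_Cond)
          assume "aval (Var vOk) s2 \<noteq> 0"
          then have al: "allowed ?i y (Suc j)" using ok by simp
          show "wp \<beta> (1 + 4) (vLab ::= Var va;; emit_com) (\<lambda>s''. ?I (Suc j) (set_var vAi (Suc j) s'')) s2"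
          proof (intro wp_Seq wp_Assign[OF bdd2] wp_emit)
            fix v assume v: "v = aval (Var va) s2"
            have "edges (set_var vAi (Suc j) (run emit_com (set_var vLab v s2))) =
                insert (?q, Some (Suc j), ?nx) (edges s')"
              using edges_emit[of "set_var vLab v s2"] edges_cong[of "set_var vLab v s2" s2]
                edges_cong[of "set_var vAi (Suc j) (run emit_com (set_var vLab v s2))" "run emit_com (set_var vLab v s2)"]
              by (simp add: v s2 e2 var_emit)
            then show "?I (Suc j) (set_var vAi (Suc j) (run emit_com (set_var vLab v s2)))"
              using I al unfolding split by (simp add: var_emit s2)
            show "Suc (var (set_var vLab v s2) vCount) < 2 ^ \<beta>" using I j less(2) s2(4) by simp
          qed (use bdd_var[OF bdd2] in \<open>simp_all add: ok_exp_def\<close>)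
        next
          assume "aval (Var vOk) s2 = 0"
          then have "\<not> allowed ?i y (Suc j)" using ok by simp
          then show "wp \<beta> 1 Skip (\<lambda>s''. ?I (Suc j) (set_var vAi (Suc j) s'')) s2"
            using I e2 s2 edges_cong[of "set_var vAi (Suc j) s2" s2] unfolding split
            by (intro wp_Skip[OF bdd2]) simp
        qed (use bdd2 in \<open>simp_all add: ok_exp_def\<close>)
        then show "wp \<beta> 7 ?snd (\<lambda>s''. ?I (Suc j) (set_var vAi (Suc j) s'')) s2"
          by (rule wp_mono) simp
      qed
    qed (rule bdd')
  next
    show "?I 0 (set_var vAi 0 s)" using edges_cong[of "set_var vAi 0 s" s] by simp
  qed (use bdd s in \<open>simp_all add: menv_def env_def\<close>)
  then show ?thesis by (rule wp_mono) simp
qed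


text \<open>Sources are visited in increasing order, so the progress is a filter on
  \<open>trans\<close>. The count allows one epsilon edge and \<open>n\<close> letters per
  source.\<close>

definition reached :: "nat \<Rightarrow> store \<Rightarrow> bool" where
  "reached q s \<longleftrightarrow> menv s \<and> edges s = {e \<in> trans. fst e < q} \<and> var s vCount \<le> q * (n + 1)"

lemma trans_Suc:
  assumes "q < k * A"
  shows "{e \<in> trans. fst e < Suc q} = {e \<in> trans. fst e < q} \<union>
    (if Suc q mod block (q div A) = 0 then {} else {(q, None, Suc q)}) \<union>
    {(q, Some a, next_state q) | a. a \<in> {1..n} \<and> allowed (q div A) (q mod A) a}"
  using assms by (auto simp: trans_def less_Suc_eq)

lemma wp_state:
  assumes bdd: "bdd \<beta> s" and s: "reached q s" "var s vq = q" and q: "q < k * A"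
    and less: "2 ^ Suc D < (2::nat) ^ \<beta>" "(k * A + 1) * (n + 1) + 1 < 2 ^ \<beta>"
  shows "wp \<beta> state_time state_body (\<lambda>s'. reached (Suc q) (set_var vq (Suc q) s')) s"
proof -
  let ?i = "q div A" and ?y = "q mod A" and ?c = "var s vCount"
  have menv: "menv s" and edges: "edges s = {e \<in> trans. fst e < q}" and c: "?c \<le> q * (n + 1)"
    using s(1) by (simp_all add: reached_def)
  have i: "?i < k" using q A_pos by (simp add: less_mult_imp_div_less)
  have y: "?y < A" using A_pos by simp
  have "Suc q * (n + 1) \<le> k * A * (n + 1)" using q by (intro mult_le_mono1) simp
  then have cn: "?c + n + 1 \<le> k * A * (n + 1)" using c by simp
  have c_less: "Suc (Suc (?c + n)) < 2 ^ \<beta>" using cn less(2) by simp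
  have kA_less: "k * A + 1 < 2 ^ \<beta>" using less(2) by simp
  have k_less': "k < 2 ^ \<beta>" using bdd_var[OF bdd, of vK] menv by (simp add: menv_def env_def)
  have nx: "next_state q \<le> k * A" using q by (rule next_state_le)
  define E where "E = (if Suc q mod block ?i = 0 then {} else {(q, None :: nat option, Suc q)})"
  define J1 where "J1 s' \<longleftrightarrow> menv s' \<and> var s' vq = q \<and> var s' vI = ?i \<and> var s' vY = ?y \<and>
    edges s' = edges s \<and> var s' vCount = ?c" for s'
  define J2 where "J2 s' \<longleftrightarrow> J1 s' \<and> var s' vBl = block ?i" for s'
  define J3 where "J3 s' \<longleftrightarrow> menv s' \<and> var s' vq = q \<and> var s' vI = Suc ?i \<and> var s' vY = ?y \<and>
    edges s' = edges s \<union> E \<and> var s' vCount \<le> Suc ?c" for s'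
  define J4 where "J4 s' \<longleftrightarrow> J3 s' \<and> var s' vBl = block (Suc ?i)" for s'
  define J5 where "J5 s' \<longleftrightarrow> menv s' \<and> var s' vq = q \<and> var s' vI = ?i \<and> var s' vY = ?y \<and>
    edges s' = edges s \<union> E \<and> var s' vCount \<le> Suc ?c \<and> var s' vNxt = next_state q \<and>
    var s' vMd = ?y div P 0 + 1" for s'
  have 1: "wp \<beta> 2 state_init J1 s'" if bdd': "bdd \<beta> s'" and "s = s'" for s'
  proof -
    have [simp]: "s' = s" using that by simp
    have v: "var s vA = A" using menv by (simp add: menv_def)
    have "same_off {vI, vY} {} s (run state_init s)" by (simp add: same_off_def state_init_def)
    from menv_frame[OF menv this] have m1: "menv (run state_init s)" by simp
    have "wp \<beta> (steps state_init) state_init J1 s"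
    proof (rule wp_straight[OF _ bdd])
      show "straight state_init" by (simp add: state_init_def ok_exp_def)
      have "?i < 2 ^ \<beta>" "?y < 2 ^ \<beta>"
        using le_less_trans[OF div_le_dividend bdd_var[OF bdd, of vq]]
          le_less_trans[OF mod_less_eq_dividend bdd_var[OF bdd, of vq]] s(2) by auto
      then show "safe \<beta> state_init s" using s(2) by (simp add: state_init_def v)
      show "J1 (run state_init s)"
        using m1 s(2) by (simp add: J1_def state_init_def v edges_def)
    qed
    then show ?thesis by (simp add: state_init_def numeral_2_eq_2)
  qed
  have 2: "wp \<beta> block_time block_com J2 s'" if bdd': "bdd \<beta> s'" and J: "J1 s'" for s'
  proof -
    have m: "menv s'" using J by (simp add: J1_def)
    show ?thesis
    proof (rule wp_conseq[OF wp_block[OF bdd' m less(1)] order_refl])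
      fix s2 assume off: "same_off (wvars block_com) (warrs block_com) s' s2" and b: "var s2 vBl = block (var s' vI)"
      have "edges s2 = edges s'" by (rule edges_cong) (use same_offD[OF off] in simp_all)
      then show "J2 s2" using menv_frame[OF m off] same_offD(1)[OF off] J b by (simp add: J2_def J1_def)
    qed
  qed
  have 3: "wp \<beta> 9 state_eps J3 s'" if bdd': "bdd \<beta> s'" and J: "J2 s'" for s'
  proof -
    have m: "menv s'" using J by (simp add: J1_def J2_def)
    let ?s1 = "set_var vNxt (Suc q) s'"
    let ?s2 = "if Suc q mod block ?i \<noteq> 0 then run emit_com (set_var vLab 0 ?s1) else ?s1"
    have r: "run state_eps s' = set_var vI (Suc ?i) ?s2"
      using J by (simp add: state_eps_def J2_def J1_def var_emit)
    have "same_off {vNxt, vLab, vCount, vI} {aSrc, aLab, aDst} s' (run state_eps s')"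
      unfolding r by (auto simp: same_off_def emit_com_def)
    from menv_frame[OF m this] have m1: "menv (run state_eps s')" by simp
    have ed: "edges (run state_eps s') = edges s \<union> E"
    proof -
      have "edges (run state_eps s') = edges ?s2" unfolding r by (rule edges_cong) simp_all
      also have "\<dots> = edges s \<union> E"
        using J edges_emit[of "set_var vLab 0 ?s1"] edges_cong[of "set_var vLab 0 ?s1" s'] edges_cong[of ?s1 s']
        by (auto simp: E_def J2_def J1_def)
      finally show ?thesis .
    qed
    have "wp \<beta> (steps state_eps) state_eps J3 s'"
    proof (rule wp_straight[OF _ bdd'])
      show "straight state_eps" by (simp add: state_eps_def emit_com_def ok_exp_def)
      have "Suc q < 2 ^ \<beta>" "Suc ?i < 2 ^ \<beta>" "Suc ?c < 2 ^ \<beta>" "q < 2 ^ \<beta>"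
        using q kA_less i k_less' c_less by linarith+
      then show "safe \<beta> state_eps s'"
        using J bdd_const[OF bdd', of 0] by (simp add: state_eps_def emit_com_def J2_def J1_def)
      show "J3 (run state_eps s')"
        using m1 ed J unfolding J3_def by (simp add: r J2_def J1_def var_emit)
    qed
    then show ?thesis by (rule wp_mono) (simp add: state_eps_def emit_com_def)
  qed
  have 4: "wp \<beta> block_time block_com J4 s'" if bdd': "bdd \<beta> s'" and J: "J3 s'" for s'
  proof -
    have m: "menv s'" using J by (simp add: J3_def)
    show ?thesis
    proof (rule wp_conseq[OF wp_block[OF bdd' m less(1)] order_refl])
      fix s2 assume off: "same_off (wvars block_com) (warrs block_com) s' s2" and b: "var s2 vBl = block (var s' vI)"
      have "edges s2 = edges s'" by (rule edges_cong) (use same_offD[OF off] in simp_all)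
      then show "J4 s2" using menv_frame[OF m off] same_offD(1)[OF off] J b by (simp add: J4_def J3_def)
    qed
  qed
  have 5: "wp \<beta> 3 state_next J5 s'" if bdd': "bdd \<beta> s'" and J: "J4 s'" for s'
  proof -
    have m: "menv s'" using J by (simp add: J3_def J4_def)
    have v: "var s' vA = A" "var s' vV = P 0" "var s' vq = q" "var s' vBl = block (Suc ?i)"
      "var s' vI = Suc ?i" "var s' vY = ?y"
      using m J by (simp_all add: menv_def J4_def J3_def)
    have "same_off {vNxt, vI, vMd} {} s' (run state_next s')" by (simp add: same_off_def state_next_def)
    from menv_frame[OF m this] have m1: "menv (run state_next s')" by simp
    have "wp \<beta> (steps state_next) state_next J5 s'"
    proof (rule wp_straight[OF _ bdd'])
      show "straight state_next" by (simp add: state_next_def ok_exp_def)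
      have "Suc (?y div P 0) < 2 ^ \<beta>"
        using y kA_less k_ge mult_le_mono1[of 1 k A] div_le_dividend[of ?y "P 0"] by linarith
      moreover have "q + A - q mod block (Suc ?i) < 2 ^ \<beta>"
        using nx kA_less by (simp add: next_state_def)
      moreover have "?i < 2 ^ \<beta>" using i k_less' by linarith
      ultimately show "safe \<beta> state_next s'" by (simp add: state_next_def v)
      have "edges (run state_next s') = edges s'" by (rule edges_cong) (simp_all add: state_next_def)
      then show "J5 (run state_next s')"
        using m1 J unfolding J5_def by (simp add: J4_def J3_def state_next_def v next_state_def)
    qed
    then show ?thesis by (rule wp_mono) (simp add: state_next_def)
  qed
  have 6: "wp \<beta> (2 + n * (11 + check_time)) (For vAi vN letter_body) (\<lambda>s'. reached (Suc q) (set_var vq (Suc q) s')) s'"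
    if bdd': "bdd \<beta> s'" and J: "J5 s'" for s'
  proof -
    have m: "menv s'" and v: "var s' vY = ?y" "var s' vMd = ?y div P 0 + 1" "var s' vCount \<le> Suc ?c"
      using J by (simp_all add: J5_def)
    have cl: "Suc (var s' vCount + n) < 2 ^ \<beta>" using v(3) c_less by linarith
    show ?thesis
    proof (rule wp_conseq[OF wp_letters[OF bdd' m less(1) cl v(1) y v(2)] order_refl])
      fix s2 assume off: "same_off (wvars (For vAi vN letter_body)) (warrs (For vAi vN letter_body)) s' s2"
        and R: "edges s2 = edges s' \<union> {(var s' vq, Some a, var s' vNxt) | a. a \<in> {1..n} \<and> allowed (var s' vI) ?y a} \<and>
          var s2 vCount \<le> var s' vCount + n"
      from menv_frame[OF m off] have "menv s2" by simp
      then have m2: "menv (set_var vq (Suc q) s2)" by (simp add: menv_def env_def)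
      have "edges (set_var vq (Suc q) s2) = edges s2" by (rule edges_cong) simp_all
      also have "\<dots> = {e \<in> trans. fst e < Suc q}"
        using R J unfolding trans_Suc[OF q] by (simp add: J5_def E_def edges)
      finally show "reached (Suc q) (set_var vq (Suc q) s2)"
        using m2 R v(3) c by (simp add: reached_def)
    qed
  qed
  show ?thesis unfolding state_body_def state_time_def
    by (rule wp_mono[OF wp_Seq_pred[where J = "(=) s", OF 1 wp_Seq_pred[where J = J1, OF 2
        wp_Seq_pred[where J = J2, OF 3 wp_Seq_pred[where J = J3, OF 4
        wp_Seq_pred[where J = J4, OF 5 6]]]] bdd refl]]) simp_all
qed

definition total_time :: nat where
  "total_time = setup_time + 10 + k * A * (state_time + 2)"

lemma wp_program:
  assumes bdd: "bdd \<beta> (input_store n k)"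
    and less: "Suc (Q 0) * 2 ^ t 0 < 2 ^ \<beta>" "D * (G 0 * m) < 2 ^ \<beta>" "2 * bnd + 1 < 2 ^ \<beta>"
      "2 ^ Suc D < (2::nat) ^ \<beta>" "(k * A + 1) * (n + 1) + 1 < 2 ^ \<beta>"
  shows "wp \<beta> total_time program
    (\<lambda>s. output_nfa s = machine \<and> var s vCount \<le> k * A * (n + 1)) (input_store n k)"
proof -
  have A_less: "A < 2 ^ \<beta>" and n_less: "2 * n + 1 < 2 ^ \<beta>" and kA_less: "k * A + 1 < 2 ^ \<beta>"
    and vA: "k * A < 2 ^ \<beta>"
  proof -
    have "1 * A \<le> k * A" using k_ge by (rule mult_le_mono1)
    moreover have "k * A \<le> k * A * (n + 1)" by simp
    moreover have "1 * n \<le> k * A * n" using k_ge A_pos by (intro mult_le_mono1) simp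
    moreover have "(k * A + 1) * (n + 1) + 1 = k * A * n + k * A + n + 2" by (simp add: algebra_simps)
    ultimately show "A < 2 ^ \<beta>" "2 * n + 1 < 2 ^ \<beta>" "k * A + 1 < 2 ^ \<beta>" "k * A < 2 ^ \<beta>"
      using less(5) by linarith+
  qed
  have D_less: "Suc D < 2 ^ \<beta>"
  proof -
    have "Suc D < 2 ^ Suc D" by (rule less_exp)
    then show ?thesis using less(4) by linarith
  qed
  let ?J0 = "\<lambda>s. env s \<and> tables D s \<and> var s vCount = 0 \<and> arr s aAcc = (\<lambda>_. 0)"
  have 1: "wp \<beta> setup_time setup_com ?J0 s" if "bdd \<beta> s" "input_store n k = s" for s
    using wp_setup[OF bdd A_less less(1,2) n_less less(3)] that by simp
  have 2: "wp \<beta> 5 main_init (reached 0) s" if bdd': "bdd \<beta> s" and J: "?J0 s" for s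
  proof -
    have v: "var s vK = k" "var s vM = m" "var s vD = D" "arr s aP 0 = P 0"
      using J D_pos by (auto simp: env_def tables_def)
    have ap: "arr s aP d = P d" if "d \<le> D" for d
      using J that by (cases "d = D") (auto simp: tables_def P_D)
    have "wp \<beta> (steps main_init) main_init (reached 0) s"
    proof (rule wp_straight[OF _ bdd'])
      show "straight main_init" by (simp add: main_init_def ok_exp_def)
      have "P 0 < 2 ^ \<beta>" using P_le_A[of 0] A_less by simp
      then show "safe \<beta> main_init s"
        using v A_less vA D_less by (simp add: main_init_def A_def[symmetric])
      show "reached 0 (run main_init s)"
        using J v ap by (auto simp: reached_def menv_def env_def tables_def main_init_def A_def edges_def)
    qed
    then show ?thesis by (rule wp_mono) (simp add: main_init_def)
  qed
  have 3: "wp \<beta> (2 + k * A * (state_time + 2)) (For vq vKA state_body) (reached (k * A)) s"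
    if bdd': "bdd \<beta> s" and J: "reached 0 s" for s
  proof (rule wp_For[where I = reached])
    fix q s' assume "q < k * A" "reached q s'" "var s' vq = q" "bdd \<beta> s'"
    then show "wp \<beta> state_time state_body (\<lambda>s''. reached (Suc q) (set_var vq (Suc q) s'')) s'"
      by (intro wp_state less)
  next
    show "reached 0 (set_var vq 0 s)"
      using J edges_cong[of "set_var vq 0 s" s] by (simp add: reached_def menv_def env_def)
  qed (use bdd' J in \<open>auto simp: reached_def menv_def state_body_def state_init_def state_eps_def state_next_def\<close>)
  have 4: "wp \<beta> 3 main_final (\<lambda>s. output_nfa s = machine \<and> var s vCount \<le> k * A * (n + 1)) s"
    if bdd': "bdd \<beta> s" and J: "reached (k * A) s" for s
  proof -
    have v: "var s vKA = k * A" "arr s aAcc = (\<lambda>_. 0)" "edges s = trans" "var s vCount \<le> k * A * (n + 1)"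
      using J by (auto simp: reached_def menv_def trans_def)
    have "wp \<beta> (steps main_final) main_final
      (\<lambda>s. output_nfa s = machine \<and> var s vCount \<le> k * A * (n + 1)) s"
    proof (rule wp_straight[OF _ bdd'])
      show "straight main_final" by (simp add: main_final_def ok_exp_def)
      show "safe \<beta> main_final s"
        using bdd_const[OF bdd', of 1] kA_less by (simp add: main_final_def v)
      have "transitions (output_nfa (run main_final s)) = edges s"
        by (simp add: output_nfa_def edges_def main_final_def)
      moreover have "accepting (output_nfa (run main_final s)) = {k * A}"
        by (auto simp: output_nfa_def main_final_def v)
      moreover have "states (output_nfa (run main_final s)) = {..<k * A + 1}" "start_state (output_nfa (run main_final s)) = 0"
        by (simp_all add: output_nfa_def main_final_def v)
      ultimately have "output_nfa (run main_final s) = machine"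
        unfolding machine_def using v(3) by (intro nfa.equality) simp_all
      then show "output_nfa (run main_final s) = machine \<and> var (run main_final s) vCount \<le> k * A * (n + 1)"
        using v(4) by (simp add: main_final_def)
    qed
    then show ?thesis by (rule wp_mono) (simp add: main_final_def)
  qed
  show ?thesis unfolding program_def total_time_def
    by (rule wp_mono[OF wp_Seq_pred[where J = "(=) (input_store n k)", OF 1 wp_Seq_pred[where J = ?J0, OF 2
        wp_Seq_pred[where J = "reached 0", OF 3 4]] bdd refl]]) simp_all
qed

end

section \<open>Size and time\<close>

context parameters begin

lemma bnd_less: "2 * (k * k * nb + 1) \<le> m"
  using less_two_power_floorlog[of bnd] by (simp add: m_def L_def bnd_def)

lemma nb_pos: "1 \<le> nb"
  using k_ge k_le less_two_power_floorlog[of n] unfolding nb_def by (cases "floorlog 2 n") auto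

lemma k_less_m: "k + 1 \<le> m"
proof -
  have "1 * 1 \<le> k * nb" using k_ge nb_pos by (rule mult_le_mono)
  then have "k * 1 \<le> k * (k * nb)" by (intro mult_le_mono2) simp
  moreover define x where "x = k * (k * nb)"
  ultimately show ?thesis using bnd_less unfolding mult.assoc x_def[symmetric] by simp
qed

lemma t_le_m: "t d \<le> m"
proof -
  have "t d \<le> k + 1" by (simp add: t_def)
  then show ?thesis using k_less_m by simp
qed

lemma node_fits: "k div 2 ^ d + 1 \<le> l * t d"
proof -
  have "k div 2 ^ d < l * (k div 2 ^ d div l + 1)"
    using dividend_less_times_div[of l "k div 2 ^ d"] by (simp add: l_def)
  then show ?thesis by (simp add: t_def div_mult2_eq)
qed

lemma machine_lang: "nfa_lang machine = distinct_words k n"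
proof (intro equalityI machine_sound machine_complete)
  show "n < 2 ^ nb" by (simp add: nb_def less_two_power_floorlog)
  show "2 * (k * k * nb + 1) \<le> m" by (rule bnd_less)
  fix d Z and \<pi> :: "nat \<Rightarrow> nat"
  assume Z: "Z \<subseteq> {..<m}" "card Z \<le> k div 2 ^ d + 1" and \<pi>: "\<And>x. \<pi> x < 2"
  have "(2 * m) ^ t d = 2 ^ ((L + 1) * t d)" by (simp add: m_def power_mult[symmetric] flip: power_Suc)
  then have less: "(2 * m) ^ t d < 2 ^ ((L + 1) * t d + 1)" by simp
  show "\<exists>f < W d ^ l. \<forall>x\<in>Z. lookup d f x l = \<pi> x"
  proof (rule exists_splitting[where t = "t d"])
    show "W d = 2 * m * G d" by (simp add: W_def)
    show "card Z \<le> l * t d" using Z(2) node_fits[of d] by simp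
    show "\<exists>g<G d. \<forall>x\<in>Y. U d g x = \<rho> x"
      if "Y \<subseteq> {..<m}" "card Y \<le> t d" "\<And>x. \<rho> x < 2" for Y and \<rho> :: "nat \<Rightarrow> nat"
      unfolding U_def G_def by (rule family_universal[OF m_gt_0 less t_le_m that])
  qed (use Z \<pi> in auto)
qed

lemma L_ge: "2 \<le> L"
proof -
  have "1 * 1 * 1 \<le> k * k * nb" using k_ge nb_pos by (intro mult_le_mono) auto
  then have "3 \<le> bnd" by (simp add: bnd_def)
  then have "3 < (2::nat) ^ L" using less_two_power_floorlog[of bnd] by (simp add: L_def)
  then show ?thesis by (cases "L = 0 \<or> L = 1") auto
qed

lemma L_less_m: "L < m"
  unfolding m_def by (rule less_exp)

lemma t0_bound: "l * t d \<le> k div 2 ^ d + l"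
  by (simp add: t_def div_mult2_eq)

definition B :: "nat \<Rightarrow> nat" where "B d = (L + 1) * t d + 1"

lemma B_le: "B d \<le> 2 ^ (2 * L + 1)"
proof -
  have "(L + 1) * t d \<le> m * m" using L_less_m t_le_m[of d] by (intro mult_le_mono) auto
  moreover have "1 * 1 \<le> m * m" using m_gt_0 by (intro mult_le_mono) auto
  ultimately have "B d \<le> 2 * (m * m)" unfolding B_def by linarith
  also have "\<dots> = 2 ^ (2 * L + 1)" by (simp add: m_def power_add mult_2)
  finally show ?thesis .
qed

text \<open>The main term is \<open>l * t d\<close>, about the node size. Each of the
  \<open>l = L + 2\<close> digits adds O(L) bits for the threshold and for the factor
  \<open>B\<close> of the family size.\<close>

lemma W_power_le: "W d ^ l \<le> 2 ^ (10 * (L * L) + k div 2 ^ d)"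
proof -
  have "W d = 2 ^ (L + 1) * (2 ^ t d * B d)" by (simp add: W_def G_def B_def m_def)
  also have "\<dots> \<le> 2 ^ (L + 1) * (2 ^ t d * 2 ^ (2 * L + 1))" using B_le by (intro mult_le_mono2)
  also have "\<dots> = 2 ^ (3 * L + 2 + t d)" by (simp add: power_add[symmetric])
  finally have "W d ^ l \<le> (2 ^ (3 * L + 2 + t d)) ^ l" by (rule power_mono) simp
  also have "\<dots> = 2 ^ ((3 * L + 2) * l + l * t d)"
    by (simp only: power_mult[symmetric] add_mult_distrib mult.commute[of "t d" l])
  also have "\<dots> \<le> 2 ^ (10 * (L * L) + k div 2 ^ d)"
  proof (rule power_increasing)
    have "(3 * L + 2) * l + l \<le> (4 * L) * (2 * L) + 2 * L * 1"
      using L_ge by (intro add_le_mono mult_le_mono) (auto simp: l_def)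
    also have "\<dots> \<le> 8 * (L * L) + 2 * (L * L)" using L_ge by simp
    finally show "(3 * L + 2) * l + l * t d \<le> 10 * (L * L) + k div 2 ^ d"
      using t0_bound[of d] by linarith
  qed simp
  finally show ?thesis .
qed

lemma sum_div_le: "(\<Sum>d<r. k div 2 ^ d) \<le> 2 * k"
proof -
  \<comment> \<open>The added term bounds the rest of the series and makes the induction
    work.\<close>
  have "(\<Sum>d<r. k div 2 ^ d) + 2 * (k div 2 ^ r) \<le> 2 * k"
  proof (induction r)
    case (Suc r)
    have "k div 2 ^ Suc r = k div 2 ^ r div 2" by (simp add: div_mult2_eq[symmetric] mult.commute)
    then have "2 * (k div 2 ^ Suc r) \<le> k div 2 ^ r" by simp
    then show ?case using Suc by simp
  qed simp
  then show ?thesis by simp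
qed

text \<open>\<open>4 ^ k\<close> comes from the node sizes summed over all levels, 10 from
  \<open>W_power_le\<close> on each of \<open>D\<close> levels, and one more for the
  modulus.\<close>

definition E :: nat where "E = 4 ^ k * 2 ^ (11 * (L * L * D))"

lemma LLD: "L \<le> L * L * D" "D \<le> L * L * D" "1 \<le> L * L * D" "L * L \<le> L * L * D"
proof -
  have D: "1 \<le> D" using D_pos by simp
  have L: "1 \<le> L" using L_ge by simp
  show LL: "L * L \<le> L * L * D" using mult_le_mono2[OF D, of "L * L"] by simp
  show "L \<le> L * L * D" using mult_le_mono2[OF L, of L] LL by linarith
  have LL1: "1 \<le> L * L" using mult_le_mono[OF L L] by simp
  then show "D \<le> L * L * D" using mult_le_mono1[of 1 "L * L" D] by simp
  then show "1 \<le> L * L * D" using D by linarith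
qed

lemma A_le: "A \<le> E"
proof -
  have "P 0 \<le> (\<Prod>d<D. 2 ^ (10 * (L * L) + k div 2 ^ d))"
    unfolding P_def using W_power_le by (auto simp: atLeast0LessThan intro!: prod_mono)
  also have "\<dots> = 2 ^ (\<Sum>d<D. 10 * (L * L) + k div 2 ^ d)" by (rule power_sum[symmetric])
  also have "\<dots> \<le> 2 ^ (10 * (L * L * D) + 2 * k)"
  proof (rule power_increasing)
    show "(\<Sum>d<D. 10 * (L * L) + k div 2 ^ d) \<le> 10 * (L * L * D) + 2 * k"
      using sum_div_le[of D] by (simp add: sum.distrib mult_ac)
  qed simp
  finally have "A \<le> 2 ^ (10 * (L * L * D) + 2 * k) * m"
    unfolding A_def by (rule mult_le_mono1)
  also have "\<dots> = 2 ^ (10 * (L * L * D) + 2 * k) * 2 ^ L" by (simp only: m_def)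
  also have "\<dots> = 2 ^ (10 * (L * L * D) + 2 * k + L)" by (simp only: power_add)
  also have "\<dots> \<le> 2 ^ (2 * k + 11 * (L * L * D))" using LLD(1) by (intro power_increasing) linarith+
  also have "\<dots> = E" by (simp add: E_def power_add power_mult)
  finally show ?thesis .
qed

lemma m_power_le: "m ^ j \<le> 2 ^ (j * (L * L * D))"
  unfolding m_def power_mult[symmetric] using LLD(1)
  by (intro power_increasing) (auto simp: mult.commute[of _ j])

text \<open>Functions times patterns, the cost of the greedy search up to powers of
  \<open>m\<close>. The choice of \<open>l\<close> makes the exponent \<open>l * t 0\<close>, which
  exceeds \<open>k\<close> by at most \<open>l\<close>.\<close>

lemma greedy_le: "2 ^ t 0 * Q 0 \<le> 2 ^ k * m ^ 2"
proof -
  have "2 ^ t 0 * Q 0 = 2 ^ (l * t 0)"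
    by (simp add: Q_def m_def l_def power_mult power_mult_distrib power_add)
  also have "\<dots> \<le> 2 ^ (k + 2 * L)"
    using t0_bound[of 0] L_ge by (intro power_increasing) (auto simp: l_def)
  also have "\<dots> = 2 ^ k * m ^ 2" by (simp only: power_add m_def power_mult mult.commute[of 2 L])
  finally show ?thesis .
qed

text \<open>The six powers of \<open>m\<close>: two from \<open>greedy_le\<close>, two from the
  factor \<open>B 0\<close> of \<open>G 0\<close>, one for the bits of a function and one for the
  positions of a pattern.\<close>

lemma level_time_le: "level_time \<le> 200 * (2 ^ k * m ^ 6)"
proof -
  have m4: "4 \<le> m" using power_increasing[OF L_ge, of "2::nat"] by (simp add: m_def)
  then have mm: "4 * m \<le> m * m" "16 \<le> m * m" using mult_le_mono[OF m4 m4] by auto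
  have Q1: "1 \<le> Q 0" using Q_pos[of 0] by simp
  have t: "t 0 \<le> m" "l \<le> 2 * m" using t_le_m[of 0] L_less_m m4 by (auto simp: l_def)
  have 1: "Q 0 * (t 0 * 20 + 9) \<le> Q 0 * (m * 20 + 9)" "Q 0 * (t 0 * 20 + 11) \<le> Q 0 * (m * 20 + 11)"
    using t by (intro mult_le_mono2; simp)+
  have "7 + m * (8 + Q 0 * (t 0 * 20 + 9)) + Q 0 * (t 0 * 20 + 11)
      \<le> Q 0 * 7 + m * (Q 0 * 8 + Q 0 * (m * 20 + 9)) + Q 0 * (m * 20 + 11)"
    using 1 Q1 by (intro add_le_mono mult_le_mono) auto
  also have "\<dots> = Q 0 * (20 * (m * m) + 37 * m + 18)" by (simp add: algebra_simps)
  also have "\<dots> \<le> Q 0 * (32 * (m * m))" using mm by (intro mult_le_mono2) linarith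
  finally have br: "7 + m * (8 + Q 0 * (t 0 * 20 + 9)) + Q 0 * (t 0 * 20 + 11) \<le> Q 0 * (32 * (m * m))" .
  have "B 0 \<le> 2 * (m * m)" using B_le[of 0] by (simp add: m_def power_add mult_2)
  then have "G 0 \<le> 2 ^ t 0 * (2 * (m * m))" unfolding G_def B_def by (rule mult_le_mono2)
  then have "G 0 * (7 + m * (8 + Q 0 * (t 0 * 20 + 9)) + Q 0 * (t 0 * 20 + 11))
      \<le> (2 ^ t 0 * (2 * (m * m))) * (Q 0 * (32 * (m * m)))" using br by (rule mult_le_mono)
  also have "\<dots> = (2 ^ t 0 * Q 0) * (64 * m ^ 4)" by (simp add: power4_eq_xxxx)
  also have "\<dots> \<le> (2 ^ k * m ^ 2) * (64 * m ^ 4)" using greedy_le by (rule mult_le_mono1)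
  also have "\<dots> = 64 * (2 ^ k * m ^ 6)" by (simp add: power_add[symmetric])
  finally have 2: "G 0 * (7 + m * (8 + Q 0 * (t 0 * 20 + 9)) + Q 0 * (t 0 * 20 + 11)) \<le> 64 * (2 ^ k * m ^ 6)" .
  have p1: "1 \<le> 2 ^ k * m ^ 6" using m_gt_0 by simp
  have pm: "m \<le> 2 ^ k * m ^ 6"
    using mult_le_mono[of 1 "2 ^ k" m "m ^ 6"] self_le_power[of m 6] m4 by simp
  have pq: "Q 0 \<le> 2 ^ k * m ^ 6"
  proof -
    have "1 * Q 0 \<le> 2 ^ t 0 * Q 0" by (rule mult_le_mono1) simp
    also have "\<dots> \<le> 2 ^ k * m ^ 2" by (rule greedy_le)
    also have "\<dots> \<le> 2 ^ k * m ^ 6" using m4 by (intro mult_le_mono2 power_increasing) auto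
    finally show ?thesis by simp
  qed
  show ?thesis unfolding level_time_def using 2 p1 pm pq t by linarith
qed

lemma pieces_le:
  "2 ^ k * m ^ 6 \<le> E" "1 \<le> E" "m \<le> E" "n * 1 \<le> n * E"
proof -
  have "(2::nat) ^ k * m ^ 6 \<le> 4 ^ k * 2 ^ (6 * (L * L * D))"
    using m_power_le[of 6] by (intro mult_le_mono power_mono) auto
  also have "\<dots> \<le> E" unfolding E_def by (intro mult_le_mono2 power_increasing) auto
  finally show "2 ^ k * m ^ 6 \<le> E" .
  have "m ^ 1 \<le> 2 ^ (1 * (L * L * D))" by (rule m_power_le)
  also have "\<dots> \<le> 1 * 2 ^ (11 * (L * L * D))" by (simp add: power_increasing)
  also have "\<dots> \<le> E" unfolding E_def by (rule mult_le_mono1) simp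
  finally show mE: "m \<le> E" by simp
  then show 1: "1 \<le> E" using m_gt_0 by simp
  show "n * 1 \<le> n * E" using 1 by (rule mult_le_mono2)
qed

lemma D_le_k: "D \<le> k"
proof -
  have "D - 1 < 2 ^ (D - 1)" by (rule less_exp)
  also have "\<dots> \<le> k" using two_power_le[of "D - 1" k] D_pos by (simp add: D_def)
  finally show ?thesis by simp
qed

lemma nb_le_n: "nb \<le> n"
proof -
  have "nb - 1 < 2 ^ (nb - 1)" by (rule less_exp)
  also have "\<dots> \<le> n" using two_power_le[of "nb - 1" n] nb_pos by (simp add: nb_def)
  finally show ?thesis by simp
qed

lemma setup_time_le: "setup_time \<le> 300 * (n * E)"
proof -
  have "level_time \<le> 200 * E" using level_time_le pieces_le(1) by linarith
  then have "level_time + 2 \<le> 202 * E" using pieces_le(2) by linarith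
  moreover have "D \<le> n" using D_le_k k_le by simp
  ultimately have "D * (level_time + 2) \<le> n * (202 * E)" by (intro mult_le_mono)
  moreover have "1 * E \<le> n * E" using k_ge k_le by (intro mult_le_mono1) simp
  moreover note pieces_le(2-4) L_less_m nb_le_n \<open>D \<le> n\<close>
  ultimately show ?thesis unfolding setup_time_def by linarith
qed

lemma state_time_le: "state_time + 2 \<le> 200 * (n * m ^ 2)"
proof -
  have m4: "4 \<le> m" using power_increasing[OF L_ge, of "2::nat"] by (simp add: m_def)
  have mm: "4 * m \<le> m ^ 2" "16 \<le> m ^ 2"
    using mult_le_mono[OF m4 m4] m4 by (auto simp: power2_eq_square)
  have n: "1 \<le> n" using k_ge k_le by simp
  have D: "D \<le> m" using D_le_k k_less_m by simp
  have "l \<le> 2 * m" using L_less_m m4 by (simp add: l_def)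
  then have "10 + 7 * l \<le> 10 + 14 * m" by simp
  then have "D * (10 + 7 * l) \<le> m * (10 + 14 * m)" using D by (intro mult_le_mono)
  also have "\<dots> = 14 * m ^ 2 + 10 * m" by (simp add: algebra_simps power2_eq_square)
  finally have "11 + check_time \<le> 20 * m ^ 2" unfolding check_time_def using mm by linarith
  then have "n * (11 + check_time) \<le> n * (20 * m ^ 2)" by (rule mult_le_mono2)
  moreover have "1 * m ^ 2 \<le> n * m ^ 2" using n by (rule mult_le_mono1)
  moreover define x y where "x = n * m ^ 2" and "y = n * (11 + check_time)"
  ultimately have "y \<le> 20 * x" "m ^ 2 \<le> x" by simp_all
  then show ?thesis unfolding state_time_def block_time_def x_def[symmetric] y_def[symmetric]
    using mm D by simp
qed

lemma kA_le: "k * A \<le> n * E"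
  using k_le A_le by (rule mult_le_mono)

lemma total_time_le: "total_time \<le> 1000 * (n ^ 2 * (E * m ^ 2))"
proof -
  have n: "1 \<le> n" using k_ge k_le by simp
  have "k * A * (state_time + 2) \<le> n * E * (200 * (n * m ^ 2))"
    using kA_le state_time_le by (rule mult_le_mono)
  also have "\<dots> = 200 * (n ^ 2 * (E * m ^ 2))" by (simp add: power2_eq_square)
  finally have 1: "k * A * (state_time + 2) \<le> 200 * (n ^ 2 * (E * m ^ 2))" .
  have "n * E \<le> n ^ 2 * (E * m ^ 2)"
    using n m_gt_0 by (intro mult_le_mono) (auto simp: power2_eq_square)
  moreover have "1 * 1 \<le> n * E" using n pieces_le(2) by (rule mult_le_mono)
  ultimately show ?thesis unfolding total_time_def using 1 setup_time_le by linarith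
qed


section \<open>The length of values and the total cost\<close>

definition value_bound :: nat where
  "value_bound = Suc (Q 0) * 2 ^ t 0 + D * (G 0 * m) + (2 * bnd + 1) + 2 ^ Suc D + ((k * A + 1) * (n + 1) + 1)"

text \<open>\<open>value_bound\<close> adds up all numbers that \<open>wp_program\<close> requires
  to be below \<open>2 ^ \<beta>\<close>; the \<open>+ 2\<close> meets the demand
  \<open>2 \<le> \<beta>\<close> of \<open>bdd\<close>.\<close>

definition \<beta> :: nat where "\<beta> = floorlog 2 value_bound + 2"

lemma less_\<beta>: "x \<le> value_bound \<Longrightarrow> x < 2 ^ \<beta>"
proof -
  assume "x \<le> value_bound"
  also have "\<dots> < 2 ^ floorlog 2 value_bound" by (rule less_two_power_floorlog)
  also have "\<dots> \<le> 2 ^ \<beta>" unfolding \<beta>_def by (intro power_increasing) auto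
  finally show ?thesis .
qed

lemma n_le_value_bound: "n \<le> value_bound"
proof -
  have "1 * n \<le> (k * A + 1) * (n + 1)" by (intro mult_le_mono) auto
  then show ?thesis unfolding value_bound_def by linarith
qed

lemma program_correct:
  "wp \<beta> total_time program (\<lambda>s. output_nfa s = machine \<and> var s vCount \<le> k * A * (n + 1)) (input_store n k)"
proof (rule wp_program)
  have "n < 2 ^ \<beta>" "k < 2 ^ \<beta>" using n_le_value_bound k_le by (auto intro: less_\<beta>)
  then show "bdd \<beta> (input_store n k)" by (auto simp: bdd_def input_store_def \<beta>_def)
qed (rule less_\<beta>, simp add: value_bound_def)+

text \<open>The common unit of all overhead: \<open>m\<close>, \<open>E\<close> up to
  \<open>4 ^ k\<close>, and the length of values up to \<open>n\<close> are bounded by powers of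
  \<open>H\<close>.\<close>

definition H :: nat where "H = 2 ^ (L * L * D)"

lemma E_eq: "E = 4 ^ k * H ^ 11"
  by (simp add: E_def H_def power_mult[symmetric] mult.commute)

lemma value_bound_le: "value_bound \<le> 32 * (n ^ 2 * E)"
proof -
  have n: "1 \<le> n" using k_ge k_le by simp
  have m1: "1 \<le> m" using m_gt_0 by simp
  have "Suc (Q 0) * 2 ^ t 0 \<le> 2 * (2 ^ t 0 * Q 0)"
    using mult_le_mono2[of 1 "Q 0" "2 ^ t 0"] Q_pos[of 0] by (simp add: mult.commute)
  also have "\<dots> \<le> 2 * (2 ^ k * m ^ 2)" using greedy_le by (rule mult_le_mono2)
  also have "\<dots> \<le> 2 * (2 ^ k * m ^ 6)" using m1 by (intro mult_le_mono2 power_increasing) auto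
  finally have 1: "Suc (Q 0) * 2 ^ t 0 \<le> 2 * E" using pieces_le(1) by linarith
  have "G 0 \<le> 2 ^ t 0 * 2 ^ (2 * L + 1)"
    using B_le[of 0] unfolding G_def B_def by (rule mult_le_mono2)
  also have "\<dots> = 2 ^ t 0 * 1 * (2 * m ^ 2)" by (simp add: m_def power_add power_mult mult.commute power2_eq_square mult_2)
  also have "\<dots> \<le> 2 ^ t 0 * Q 0 * (2 * m ^ 2)" using Q_pos[of 0] by (intro mult_le_mono) auto
  also have "\<dots> \<le> 2 ^ k * m ^ 2 * (2 * m ^ 2)" using greedy_le by (rule mult_le_mono1)
  finally have "G 0 * m \<le> 2 ^ k * m ^ 2 * (2 * m ^ 2) * m" by (rule mult_le_mono1)
  also have "\<dots> = 2 * (2 ^ k * m ^ 5)" by (simp add: power_numeral_reduce)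
  also have "\<dots> \<le> 2 * (2 ^ k * m ^ 6)" using m1 by (intro mult_le_mono2 power_increasing) auto
  finally have "G 0 * m \<le> 2 * E" using pieces_le(1) by linarith
  then have 2: "D * (G 0 * m) \<le> n * (2 * E)" using D_le_k k_le by (intro mult_le_mono[of D n]) auto
  have "bnd < m" unfolding m_def L_def by (rule less_two_power_floorlog)
  then have 3: "2 * bnd + 1 \<le> 2 * E" using pieces_le(3) by linarith
  have "2 ^ D \<le> 2 * k + 1" unfolding D_def by (rule two_power_floorlog_le)
  then have 4: "2 ^ Suc D \<le> 6 * n" using k_le n by simp
  have nn: "n \<le> n ^ 2" using n by (simp add: power2_eq_square)
  have "n * E \<le> n ^ 2 * E" using nn by (rule mult_le_mono1)
  moreover have "1 * E \<le> n * E" using n by (rule mult_le_mono1)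
  moreover have "(k * A + 1) * (n + 1) \<le> (2 * (n * E)) * (2 * n)"
  proof (rule mult_le_mono)
    have "1 * 1 \<le> n * E" using n pieces_le(2) by (rule mult_le_mono)
    then show "k * A + 1 \<le> 2 * (n * E)" using kA_le by linarith
  qed (use n in simp)
  moreover have "(2 * (n * E)) * (2 * n) = 4 * (n ^ 2 * E)" by (simp add: power2_eq_square)
  ultimately show ?thesis
    unfolding value_bound_def using 1 2 3 4 pieces_le(2,4) by linarith
qed

text \<open>A step costs O(\<beta>), and \<beta> is only a logarithm: of order n + L * L * D, which
  is at most a multiple of \<open>n * H\<close>.\<close>

lemma step_cost_le: "step_cost \<beta> \<le> 20000 * (n * H)"
proof -
  have n: "1 \<le> n" using k_ge k_le by simp
  have "value_bound \<le> 2 ^ 5 * ((2 ^ n) ^ 2 * (2 ^ (2 * k) * 2 ^ (11 * (L * L * D))))"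
    using value_bound_le power_mono[of n "2 ^ n" 2] less_exp[of n]
    unfolding E_def by (elim order_trans, intro mult_le_mono) (auto simp: power_mult)
  also have "\<dots> = 2 ^ (5 + (2 * n + (2 * k + 11 * (L * L * D))))"
    by (simp only: power_add power_mult[symmetric] mult.commute[of n 2])
  also have "\<dots> < 2 ^ (6 + (2 * n + (2 * k + 11 * (L * L * D))))" by (rule power_strict_increasing) auto
  finally have "floorlog 2 value_bound \<le> 6 + (2 * n + (2 * k + 11 * (L * L * D)))" by (intro floorlog_leI) auto
  then have b: "\<beta> + 1 \<le> 9 + (4 * n + 11 * (L * L * D))" using k_le unfolding \<beta>_def by linarith
  have LLD: "L * L * D < H" unfolding H_def by (rule less_exp)
  then have "1 \<le> H" by linarith
  then have "n * 1 \<le> n * H" "1 * H \<le> n * H" using n by (intro mult_le_mono; simp)+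
  moreover define x where "x = n * H"
  ultimately have "\<beta> + 1 \<le> 24 * x" "1 \<le> x" using b LLD n by linarith+
  then show ?thesis unfolding step_cost_def x_def[symmetric] by simp
qed

text \<open>The exponent 14 is 11 from \<open>E\<close>, 2 from the \<open>m ^ 2\<close> in
  \<open>total_time_le\<close> and 1 from the price of a step, which also adds the third factor
  \<open>n\<close>.\<close>

lemma time_le: "total_time * step_cost \<beta> \<le> 20000000 * n ^ 3 * (4 ^ k * H ^ 14)"
proof -
  have "m ^ 2 \<le> H ^ 2" using m_power_le[of 1] unfolding H_def by (intro power_mono) auto
  then have "total_time \<le> 1000 * (n ^ 2 * (4 ^ k * H ^ 11 * H ^ 2))"
    using total_time_le unfolding E_eq by (elim order_trans, intro mult_le_mono2)
  then have "total_time * step_cost \<beta> \<le> 1000 * (n ^ 2 * (4 ^ k * H ^ 11 * H ^ 2)) * (20000 * (n * H))"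
    using step_cost_le by (rule mult_le_mono)
  also have "\<dots> = 20000000 * n ^ 3 * (4 ^ k * H ^ 14)"
    by (simp add: power_numeral_reduce)
  finally show ?thesis .
qed

lemma size_le: "k * A + 1 + k * A * (n + 1) \<le> 20000000 * n ^ 3 * (4 ^ k * H ^ 14)"
proof -
  have n: "1 \<le> n" using k_ge k_le by simp
  have "k * A + 1 + k * A * (n + 1) \<le> value_bound + k * A"
    unfolding value_bound_def by (simp add: algebra_simps)
  also have "\<dots> \<le> 33 * (n ^ 2 * E)"
  proof -
    have "n * E \<le> n ^ 2 * E" using n by (intro mult_le_mono1) (simp add: power2_eq_square)
    then show ?thesis using value_bound_le kA_le by linarith
  qed
  also have "\<dots> \<le> 20000000 * (n ^ 3 * (4 ^ k * H ^ 14))"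
  proof (intro mult_le_mono)
    show "n ^ 2 \<le> n ^ 3" using n by (intro power_increasing) auto
    show "E \<le> 4 ^ k * H ^ 14" unfolding E_eq by (intro mult_le_mono2 power_increasing) (auto simp: H_def)
  qed simp
  finally show ?thesis by (simp add: mult.assoc)
qed

end


section \<open>From the cubic exponent to the target class\<close>

lemma cube_log_le:
  fixes x :: real
  assumes "1 \<le> x"
  shows "log 2 x ^ 3 \<le> 216 * x"
proof -
  \<comment> \<open>The cube root of \<open>x\<close>. From ln x / 3 \<le> y and ln 2 \<ge> 1/2
    follows log 2 x \<le> 6 y, and 216 = 6^3.\<close>
  define y where "y = exp (ln x / 3)"
  have "y ^ 3 = exp (3 * (ln x / 3))" unfolding y_def by (simp add: exp_of_nat_mult[symmetric])
  then have y: "y ^ 3 = x" using assms by simp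
  have ln2: "1 / 2 \<le> ln (2::real)" using ln_le_minus_one[of "1 / 2"] by (simp add: ln_div)
  have "ln x / 3 \<le> y" unfolding y_def using exp_ge_add_one_self[of "ln x / 3"] by linarith
  moreover have "6 * y * (1 / 2) \<le> 6 * y * ln 2" using ln2 by (rule mult_left_mono) (simp add: y_def)
  ultimately have "ln x \<le> 6 * y * ln 2" by simp
  then have "log 2 x \<le> 6 * y" by (simp add: log_def divide_le_eq)
  moreover have "0 \<le> log 2 x" using assms by simp
  ultimately have "log 2 x ^ 3 \<le> (6 * y) ^ 3" by (rule power_mono)
  then show ?thesis using y by (simp add: power_mult_distrib)
qed

lemma cube_sum_le:
  fixes a b c :: real
  assumes "0 \<le> a" "0 \<le> b" "0 \<le> c"
  shows "(a + b + c) ^ 3 \<le> 27 * (a ^ 3 + b ^ 3 + c ^ 3)"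
proof -
  define x where "x = max a (max b c)"
  have x: "a \<le> x" "b \<le> x" "c \<le> x" by (auto simp: x_def)
  have "(a + b + c) ^ 3 \<le> (3 * x) ^ 3" using assms x by (intro power_mono) linarith+
  also have "\<dots> = 27 * x ^ 3" by (simp add: power_mult_distrib)
  also have "x ^ 3 \<le> a ^ 3 + b ^ 3 + c ^ 3"
    using assms by (auto simp: x_def max_def)
  finally show ?thesis by simp
qed

context parameters begin

text \<open>All three factors are below the same sum of log k, log nb and a constant, so the product
  is below a cube, which splits by \<open>cube_sum_le\<close>. As \<open>nb\<close> is about log n,
  \<open>cube_log_le\<close> makes the cube of log nb linear in log n.\<close>

lemma exponent_le: "real (L * L * D) \<le> 27 * (8 * log 2 (real k) ^ 3 + 216 * (log 2 (real n) + 1) + 64)"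
proof -
  define \<kappa> where "\<kappa> = log 2 (real k)"
  define \<nu> where "\<nu> = log 2 (real nb)"
  have \<kappa>: "0 \<le> \<kappa>" "0 \<le> \<nu>" using k_ge nb_pos by (simp_all add: \<kappa>_def \<nu>_def)
  have le_log: "real (floorlog 2 x) \<le> log 2 (real x) + 1" if "1 \<le> x" for x
  proof -
    have "floorlog 2 x \<noteq> 0" using that by (simp add: floorlog_eq_zero_iff)
    then obtain j where j: "floorlog 2 x = Suc j" using not0_implies_Suc by blast
    have "2 ^ j \<le> x" using j by (intro two_power_le) simp
    then have "real (2 ^ j) \<le> real x" by (simp only: of_nat_le_iff)
    then have "real j \<le> log 2 (real x)" by (simp add: le_log_of_power)
    then show ?thesis using j by simp
  qed
  have "real bnd \<le> 4 * (real k * real k * real nb)"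
  proof -
    have "1 * 1 * 1 \<le> k * k * nb" using k_ge nb_pos by (intro mult_le_mono) auto
    then have "bnd \<le> 4 * (k * k * nb)" unfolding bnd_def by linarith
    then have "real bnd \<le> real (4 * (k * k * nb))" by (simp only: of_nat_le_iff)
    then show ?thesis by simp
  qed
  moreover have "1 \<le> bnd" by (simp add: bnd_def)
  ultimately have "log 2 (real bnd) \<le> log 2 (4 * (real k * real k * real nb))" by simp
  also have "\<dots> = 2 + (\<kappa> + \<kappa> + \<nu>)"
    using k_ge nb_pos log_of_power_eq[of 4 2 2] by (simp add: log_mult \<kappa>_def \<nu>_def)
  finally have L: "real L \<le> 2 * \<kappa> + \<nu> + 4" using le_log[of bnd] \<open>1 \<le> bnd\<close> by (simp add: L_def)
  have D: "real D \<le> 2 * \<kappa> + \<nu> + 4" using le_log[OF k_ge] \<kappa> by (simp add: D_def \<kappa>_def)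
  have "real (L * L * D) \<le> (2 * \<kappa> + \<nu> + 4) * (2 * \<kappa> + \<nu> + 4) * (2 * \<kappa> + \<nu> + 4)"
    unfolding of_nat_mult using L D \<kappa> by (intro mult_mono) auto
  also have "\<dots> = (2 * \<kappa> + \<nu> + 4) ^ 3" by (simp add: power3_eq_cube)
  also have "\<dots> \<le> 27 * ((2 * \<kappa>) ^ 3 + \<nu> ^ 3 + 4 ^ 3)" using \<kappa> by (intro cube_sum_le) auto
  also have "\<dots> \<le> 27 * (8 * \<kappa> ^ 3 + 216 * (log 2 (real n) + 1) + 64)"
  proof -
    have "\<nu> ^ 3 \<le> 216 * real nb" unfolding \<nu>_def using nb_pos by (intro cube_log_le) simp
    also have "\<dots> \<le> 216 * (log 2 (real n) + 1)" using le_log[of n] k_ge k_le by (simp add: nb_def)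
    finally show ?thesis by (simp add: power_mult_distrib)
  qed
  finally show ?thesis by (simp add: \<kappa>_def)
qed

text \<open>The three parts of the exponent become three factors: the constant 280 = 216 + 64, a
  multiple of log n that turns into a power of \<open>n\<close>, and (log k)^3 = log k (log k)^2, a
  power of \<open>k\<close> with exponent O(log^2 k).\<close>

lemma H_power_le:
  "real (H ^ j) \<le> 2 ^ (27 * j * 280) * real n ^ (27 * j * 216) *
     real k powr (real (27 * j * 8) * (log 2 (real k))\<^sup>2)"
proof -
  define a where "a = real (27 * j)"
  have "real (H ^ j) = 2 powr (real j * real (L * L * D))"
    by (simp add: H_def power_mult[symmetric] powr_realpow[symmetric] mult.commute)
  also have "\<dots> \<le> 2 powr (a * 280 + a * 216 * log 2 (real n) + log 2 (real k) * (a * 8 * (log 2 (real k))\<^sup>2))"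
  proof (rule powr_mono)
    have "real j * real (L * L * D) \<le>
        real j * (27 * (8 * log 2 (real k) ^ 3 + 216 * (log 2 (real n) + 1) + 64))"
      using exponent_le by (rule mult_left_mono) simp
    also have "\<dots> = a * 280 + a * 216 * log 2 (real n) + log 2 (real k) * (a * 8 * (log 2 (real k))\<^sup>2)"
      by (simp add: a_def algebra_simps power2_eq_square power3_eq_cube)
    finally show "real j * real (L * L * D) \<le> \<dots>" .
  qed simp
  also have "\<dots> = 2 powr (a * 280) * 2 powr (a * 216 * log 2 (real n)) *
      (2 powr log 2 (real k)) powr (a * 8 * (log 2 (real k))\<^sup>2)"
    by (simp add: powr_add powr_powr)
  also have "2 powr (a * 280) = 2 ^ (27 * j * 280)"
    using powr_realpow[of 2 "27 * j * 280"] by (simp add: a_def)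
  also have "2 powr (a * 216 * log 2 (real n)) = real n ^ (27 * j * 216)"
  proof -
    have "2 powr (a * 216 * log 2 (real n)) = (2 powr log 2 (real n)) powr real (27 * j * 216)"
      by (simp add: powr_powr a_def mult.commute)
    also have "2 powr log 2 (real n) = real n" using k_ge k_le by simp
    also have "real n powr real (27 * j * 216) = real n ^ (27 * j * 216)"
      using k_ge k_le by (intro powr_realpow) simp
    finally show ?thesis .
  qed
  also have "2 powr log 2 (real k) = real k" using k_ge by simp
  finally show ?thesis by (simp add: a_def)
qed

end

text \<open>The exponent function of \<open>k\<close> and the power of \<open>n\<close> depend only
  on \<open>j\<close> and \<open>d\<close>, as the uniformity in \<open>O_star\<close>
  requires.\<close>

lemma target_boundI:
  fixes c d j :: nat
  assumes "\<And>n k. parameters n k \<Longrightarrow> f n k \<le> c * n ^ d * (4 ^ k * parameters.H n k ^ j)"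
  shows "f \<in> target_bound"
proof -
  define e where "e = (\<lambda>k::nat. real (27 * j * 8) * (log 2 (real k))\<^sup>2)"
  have "e \<in> O(\<lambda>k::nat. (log 2 (real k))\<^sup>2)" unfolding e_def by simp
  moreover have "f \<in> O_star (\<lambda>n k. 4 ^ k * real k powr e k)"
    unfolding O_star_def
  proof (intro CollectI exI allI impI)
    fix n k :: nat assume nk: "1 \<le> k \<and> k \<le> n"
    then interpret parameters n k by unfold_locales auto
    have "real (f n k) \<le> real (c * n ^ d * (4 ^ k * H ^ j))"
      using assms[OF parameters_axioms] by (simp only: of_nat_le_iff)
    also have "\<dots> = real c * real n ^ d * 4 ^ k * real (H ^ j)" by simp
    also have "\<dots> \<le> real c * real n ^ d * 4 ^ k *
        (2 ^ (27 * j * 280) * real n ^ (27 * j * 216) * real k powr e k)"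
      unfolding e_def by (intro mult_left_mono H_power_le) simp
    also have "\<dots> = (real c * 2 ^ (27 * j * 280)) * real n ^ (d + 27 * j * 216) * (4 ^ k * real k powr e k)"
      by (simp add: power_add)
    finally show "real (f n k) \<le> \<dots>" .
  qed
  ultimately show ?thesis unfolding target_bound_def by blast
qed

theorem theorem5p3:
  shows "\<exists>(P :: com) (M :: nat \<Rightarrow> nat \<Rightarrow> (nat, nat) nfa) (T :: nat \<Rightarrow> nat \<Rightarrow> nat).
    (\<forall>n k. 1 \<le> k \<and> k \<le> n \<longrightarrow>
       constructs_in_time P n k (M n k) (T n k) \<and>
       nfa_over {1..n} (M n k) \<and>
       nfa_acyclic (M n k) \<and>
       nfa_lang (M n k) = distinct_words k n) \<and>
    (\<lambda>n k. nfa_size (M n k)) \<in> target_bound \<and>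
    T \<in> target_bound"
proof -
  \<comment> \<open>All demands in one predicate, so that automaton and time are chosen together
    while the program stays fixed.\<close>
  define good where "good n k M T \<longleftrightarrow> constructs_in_time program n k M T \<and> nfa_over {1..n} M \<and>
      nfa_acyclic M \<and> nfa_lang M = distinct_words k n \<and>
      nfa_size M \<le> 20000000 * n ^ 3 * (4 ^ k * parameters.H n k ^ 14) \<and>
      T \<le> 20000000 * n ^ 3 * (4 ^ k * parameters.H n k ^ 14)" for n k M T
  have "\<exists>M T. good n k M T"
    if "parameters n k" for n k
  proof -
    interpret parameters n k by (rule that)
    obtain T s where T: "exec program (input_store n k) T s" "T \<le> total_time * step_cost \<beta>"
      "output_nfa s = machine" "var s vCount \<le> k * A * (n + 1)"
      using program_correct by (auto simp: wp_def)
    have tr: "transitions machine = (\<lambda>j. (arr s aSrc j, if arr s aLab j = 0 then None else Some (arr s aLab j),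
        arr s aDst j)) ` {..<var s vCount}"
      unfolding T(3)[symmetric] by (auto simp: output_nfa_def)
    \<comment> \<open>The number of emitted transitions, repetitions included, bounds the number of
      distinct ones.\<close>
    have "card (transitions machine) \<le> card {..<var s vCount}"
      unfolding tr by (rule card_image_le) simp
    then have "nfa_size machine \<le> k * A + 1 + k * A * (n + 1)"
      using T(4) by (simp add: nfa_size_def machine_def)
    then have "nfa_size machine \<le> 20000000 * n ^ 3 * (4 ^ k * H ^ 14)" using size_le by (rule order_trans)
    moreover have "T \<le> 20000000 * n ^ 3 * (4 ^ k * H ^ 14)" using T(2) time_le by (rule order_trans)
    moreover have "constructs_in_time program n k machine T"
      unfolding constructs_in_time_def using T by blast
    ultimately have "good n k machine T"
      using machine_over machine_acyclic machine_lang by (simp add: good_def)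
    then show ?thesis by blast
  qed
  then obtain M T where MT: "\<And>n k. parameters n k \<Longrightarrow> good n k (M n k) (T n k)" by metis
  have "(\<lambda>n k. nfa_size (M n k)) \<in> target_bound" "T \<in> target_bound"
    using MT by (auto simp: good_def intro!: target_boundI[of _ 20000000 3 14])
  moreover have "good n k (M n k) (T n k)" if "1 \<le> k \<and> k \<le> n" for n k
    using MT that by (simp add: parameters_def)
  ultimately show ?thesis unfolding good_def by blast
qed

end
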